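(* Let $w\in S_n$, viewed as a permutation of $\mathbb{Z}$ fixing every integer outside $\{1,\dots,n\}$. Then $$\overleftarrow{\mathfrak{S}}_w(x;a)=\sum_P\mathrm{wt}(P)\,s_{\lambda(P)}(x\|a),$$ where the sum is over all $w$-rectangular bumpless pipedreams $P$.
   Context: Squares are indexed by matrix coordinates $(i,j)$ (row $i$ increasing downward, column $j$ increasing rightward). Tiles: empty; NW elbow (pipe joining north and west edges); SE elbow (joining south and east edges); horizontal; vertical; crossing (no double-elbow tile). For $w\in S_n$, a $w$-rectangular bumpless pipedream is a tiling of $R_n=\{(i,j)\mid 1\le i\le n,\ 1-n\le j\le n\}$ by these tiles, with $2n$ pipes labeled $1-n,\dots,n$, the pipe labeled $j$ entering through the south boundary in column $j$; each positively labeled pipe $j$ exits through the east boundary in row $w^{-1}(j)$; each nonpositively labeled pipe exits through the north boundary; two pipes cross at most once, and a nonpositively labeled pipe crosses no other pipe. Weight: $\mathrm{wt}(P)=\prod(x_i-a_j)$ over empty tiles $(i,j)$. The partition $\lambda(P)$ (inside an $n\times n$ box): read the $2n$ north boundary edges of $R_n$ from right to left and draw a lattice path from the upper right corner of an $n\times n$ box, taking a unit step left for each edge with no pipe and a unit step down for each edge through which a pipe exits; $\lambda(P)$ consists of the cells of the box lying west of this path. The back stable double Schubert polynomial: for $v\in S_m$, $\mathfrak{S}_{w_0^{(m)}}(x;a)=\prod_{i+j\le m}(x_i-a_j)$ and $\mathfrak{S}_v(x;a)=A_i\mathfrak{S}_{vs_i}(x;a)$ when $vs_i>v$ ($A_i$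 divided difference in $x_i,x_{i+1}$); with $\gamma$ the index shift by $1$ on permutations and on $x_i,a_i$, $\overleftarrow{\mathfrak{S}}_w(x;a)=\lim_{p\to-\infty,q\to\infty}\gamma^{p-1}(\mathfrak{S}_{\gamma^{1-p}(w)}(x;a))$. Double Schur functions: $p_k(x\|a)=\sum_{i\le0}(x_i^k-a_i^k)$; $f(x/a)$ is the image of a symmetric function $f$ under $p_k\mapsto p_k(x\|a)$; $\gamma_a$ sends $a_i\mapsto a_{i+1}$, $p_k(x\|a)\mapsto p_k(x\|a)-a_1^k$; $h_r(x\|a)=\gamma_a^{r-1}(h_r(x/a))$; $s_\lambda(x\|a)=\det\big(\gamma_a^{1-j}(h_{\lambda_i-i+j}(x\|a))\big)$. *)

theory Defs
  imports
    "HOL-Library.Poly_Mapping"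
    "HOL-Combinatorics.Permutations"
    "Jordan_Normal_Form.Determinant"
begin

section \<open>Polynomials and formal power series in arbitrarily many variables\<close>

text \<open>Monomials are finitely supported exponent functions; polynomials over the rationals are
  finitely supported coefficient functions on monomials, with the convolution product of
  \<^theory>\<open>HOL-Library.Poly_Mapping\<close>.\<close>

type_synonym 'v monomial = "'v \<Rightarrow>\<^sub>0 nat"
type_synonym 'v mpol = "'v monomial \<Rightarrow>\<^sub>0 rat"

definition mvar :: "'v \<Rightarrow> 'v mpol" where
  "mvar v = Poly_Mapping.single (Poly_Mapping.single v 1) 1"

definition mconst :: "rat \<Rightarrow> 'v mpol" where
  "mconst c = Poly_Mapping.single 0 c"

text \<open>Substitution of ring elements for the variables; \<open>emb\<close> is the structure map of
  the target as an algebra over the rationals.\<close>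

definition msubst :: "(rat \<Rightarrow> 'b::comm_ring_1) \<Rightarrow> ('v \<Rightarrow> 'b) \<Rightarrow> 'v mpol \<Rightarrow> 'b" where
  "msubst emb f P =
     (\<Sum>m\<in>Poly_Mapping.keys P. emb (Poly_Mapping.lookup P m) *
        (\<Prod>v\<in>Poly_Mapping.keys m. f v ^ Poly_Mapping.lookup m v))"

datatype 'v mser = MSer (coeff: "'v monomial \<Rightarrow> rat")

lemma mser_eqI: "(\<And>m. coeff f m = coeff g m) \<Longrightarrow> f = g"
  by (cases f; cases g) auto

definition splits :: "'v monomial \<Rightarrow> ('v monomial \<times> 'v monomial) set" where
  "splits m = {(s, t). s + t = m}"

lemma finite_splits: "finite (splits m)"
proof -
  define M where "M = (\<Sum>v\<in>Poly_Mapping.keys m. Poly_Mapping.lookup m v)"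
  have le: "Poly_Mapping.lookup m v \<le> M" for v
  proof (cases "v \<in> Poly_Mapping.keys m")
    case True
    then show ?thesis
      unfolding M_def by (intro member_le_sum) simp_all
  qed (simp add: in_keys_iff)
  define B where "B = {f. \<forall>v. (v \<in> Poly_Mapping.keys m \<longrightarrow> f v \<in> {..M}) \<and>
    (v \<notin> Poly_Mapping.keys m \<longrightarrow> f v = (0::nat))}"
  have B: "finite B"
    unfolding B_def by (rule finite_set_of_finite_funs) simp_all
  let ?h = "\<lambda>(s, t). (Poly_Mapping.lookup s, Poly_Mapping.lookup t)"
  have "?h z \<in> B \<times> B" if "z \<in> splits m" for z
  proof -
    obtain s t where z: "z = (s, t)" by fastforce
    with that have m: "Poly_Mapping.lookup m v = Poly_Mapping.lookup s v + Poly_Mapping.lookup t v" for v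
      by (auto simp: splits_def lookup_add)
    have "Poly_Mapping.lookup s v \<le> M" "Poly_Mapping.lookup t v \<le> M" for v
      using le[of v] m[of v] by linarith+
    then show ?thesis
      using m by (simp add: z B_def in_keys_iff)
  qed
  then have "finite (?h ` splits m)"
    by (intro finite_subset[OF _ finite_cartesian_product[OF B B]]) blast
  moreover have "inj_on ?h (splits m)"
    by (simp add: inj_on_def case_prod_unfold prod_eq_iff Poly_Mapping.lookup_inject)
  ultimately show ?thesis
    by (rule finite_imageD)
qed

instantiation mser :: (type) comm_ring_1
begin

definition zero_mser :: "'a mser" where "0 = MSer (\<lambda>m. 0)"
definition one_mser :: "'a mser" where "1 = MSer (\<lambda>m. if m = 0 then 1 else 0)"
definition plus_mser :: "'a mser \<Rightarrow> 'a mser \<Rightarrow> 'a mser" where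
  "f + g = MSer (\<lambda>m. coeff f m + coeff g m)"
definition uminus_mser :: "'a mser \<Rightarrow> 'a mser" where
  "- f = MSer (\<lambda>m. - coeff f m)"
definition minus_mser :: "'a mser \<Rightarrow> 'a mser \<Rightarrow> 'a mser" where
  "f - g = MSer (\<lambda>m. coeff f m - coeff g m)"
definition times_mser :: "'a mser \<Rightarrow> 'a mser \<Rightarrow> 'a mser" where
  "f * g = MSer (\<lambda>m. \<Sum>(s, t)\<in>splits m. coeff f s * coeff g t)"

instance
proof
  fix f g h :: "'a mser"
  show "f + g + h = f + (g + h)" "f + g = g + f" "0 + f = f" "- f + f = 0" "f - g = f + - g"
    by (simp_all add: plus_mser_def zero_mser_def uminus_mser_def minus_mser_def mser_eqI ac_simps)
  show "(0::'a mser) \<noteq> 1"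
    by (auto simp: zero_mser_def one_mser_def fun_eq_iff)
  show "(f + g) * h = f * h + g * h"
    by (rule mser_eqI)
       (simp add: plus_mser_def times_mser_def case_prod_unfold distrib_right sum.distrib)
  show "f * g = g * f"
  proof (rule mser_eqI)
    fix m
    have "(\<Sum>(s, t)\<in>splits m. coeff f s * coeff g t) = (\<Sum>(s, t)\<in>splits m. coeff g s * coeff f t)"
      by (rule sum.reindex_bij_witness[where i = prod.swap and j = prod.swap])
         (auto simp: splits_def add.commute)
    then show "coeff (f * g) m = coeff (g * f) m"
      by (simp add: times_mser_def)
  qed
  show "1 * f = f"
  proof (rule mser_eqI)
    fix m
    have "(\<Sum>(s, t)\<in>splits m. (if s = 0 then 1 else 0) * coeff f t) =
      (\<Sum>p\<in>{(0::'a monomial, m)}. coeff f m)"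
      by (rule sum.mono_neutral_cong_right) (simp add: finite_splits, auto simp: splits_def split: if_splits)
    then show "coeff (1 * f) m = coeff f m"
      by (simp add: times_mser_def one_mser_def)
  qed
  show "f * g * h = f * (g * h)"
  proof (rule mser_eqI)
    fix m
    have "coeff (f * g * h) m =
        (\<Sum>(p, u)\<in>splits m. \<Sum>(s, t)\<in>splits p. coeff f s * coeff g t * coeff h u)"
      by (simp add: times_mser_def sum_distrib_right case_prod_unfold)
    also have "\<dots> = (\<Sum>((p, u), (s, t))\<in>(SIGMA q:splits m. splits (fst q)).
        coeff f s * coeff g t * coeff h u)"
      by (subst sum.Sigma[symmetric]) (auto simp: finite_splits case_prod_unfold)
    also have "\<dots> = (\<Sum>((s, p), (t, u))\<in>(SIGMA q:splits m. splits (snd q)).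
        coeff f s * (coeff g t * coeff h u))"
      by (rule sum.reindex_bij_witness
            [where i = "\<lambda>((s, p), (t, u)). ((s + t, u), (s, t))"
               and j = "\<lambda>((p, u), (s, t)). ((s, t + u), (t, u))"])
         (auto simp: splits_def add.assoc mult.assoc)
    also have "\<dots> = (\<Sum>(s, p)\<in>splits m. \<Sum>(t, u)\<in>splits p. coeff f s * (coeff g t * coeff h u))"
      by (subst sum.Sigma[symmetric]) (auto simp: finite_splits case_prod_unfold)
    also have "\<dots> = coeff (f * (g * h)) m"
      by (simp add: times_mser_def sum_distrib_left case_prod_unfold)
    finally show "coeff (f * g * h) m = coeff (f * (g * h)) m" .
  qed
qed

end

definition ser_const :: "rat \<Rightarrow> 'v mser" where
  "ser_const c = MSer (\<lambda>m. if m = 0 then c else 0)"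

definition ser_of :: "'v mpol \<Rightarrow> 'v mser" where
  "ser_of P = MSer (Poly_Mapping.lookup P)"

text \<open>Coefficientwise sum of a family of series in which every monomial has a nonzero
  coefficient in only finitely many members.\<close>

definition ser_sum :: "('i \<Rightarrow> 'v mser) \<Rightarrow> 'i set \<Rightarrow> 'v mser" where
  "ser_sum F I = MSer (\<lambda>m. \<Sum>i\<in>{i\<in>I. coeff (F i) m \<noteq> 0}. coeff (F i) m)"


section \<open>Back stable double Schubert polynomials\<close>

datatype xa = Xv int | Av int

abbreviation x_var :: "int \<Rightarrow> xa mpol" where "x_var i \<equiv> mvar (Xv i)"
abbreviation a_var :: "int \<Rightarrow> xa mpol" where "a_var i \<equiv> mvar (Av i)"

definition swap_x :: "int \<Rightarrow> xa mpol \<Rightarrow> xa mpol" where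
  "swap_x i = msubst mconst
     (\<lambda>v. case v of Xv k \<Rightarrow> x_var (transpose i (i + 1) k) | Av k \<Rightarrow> a_var k)"

text \<open>The divided difference: the unique polynomial quotient of \<open>f - s\<^sub>i f\<close> by
  \<open>x\<^sub>i - x\<^sub>i\<^sub>+\<^sub>1\<close>.\<close>

definition divdiff :: "int \<Rightarrow> xa mpol \<Rightarrow> xa mpol" where
  "divdiff i f = (THE g. (x_var i - x_var (i + 1)) * g = f - swap_x i f)"

definition perm_length :: "(int \<Rightarrow> int) \<Rightarrow> nat" where
  "perm_length v = card {(i, j). i < j \<and> v j < v i}"

definition longest_perm :: "int \<Rightarrow> int \<Rightarrow> int" where
  "longest_perm m i = (if i \<in> {1..m} then m + 1 - i else i)"

text \<open>\<open>v s\<^sub>i\<close> and \<open>v\<close> are always comparable in Bruhat order, and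
  \<open>v s\<^sub>i > v\<close> means that \<open>v s\<^sub>i\<close> is the longer one.\<close>

inductive is_double_schubert :: "int \<Rightarrow> (int \<Rightarrow> int) \<Rightarrow> xa mpol \<Rightarrow> bool" for m where
  longest: "is_double_schubert m (longest_perm m)
      (\<Prod>(i, j)\<in>{(i, j). 1 \<le> i \<and> 1 \<le> j \<and> i + j \<le> m}. x_var i - a_var j)"
| descend: "is_double_schubert m v (divdiff i f)"
    if "v permutes {1..m}" "1 \<le> i" "i < m"
       "perm_length v < perm_length (v \<circ> transpose i (i + 1))"
       "is_double_schubert m (v \<circ> transpose i (i + 1)) f"

text \<open>The double Schubert polynomial of \<open>v \<in> S\<^sub>m\<close>.  It does not depend on the chain
  of divided differences used, nor on the choice of \<open>m\<close>.\<close>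

definition double_schubert :: "int \<Rightarrow> (int \<Rightarrow> int) \<Rightarrow> xa mpol" where
  "double_schubert m v = (THE f. is_double_schubert m v f)"

text \<open>The \<open>k\<close>-th power of the index shift \<open>\<gamma>\<close>, on permutations and on polynomials.\<close>

definition shift_perm :: "int \<Rightarrow> (int \<Rightarrow> int) \<Rightarrow> int \<Rightarrow> int" where
  "shift_perm k w i = w (i - k) + k"

definition shift_pol :: "int \<Rightarrow> xa mpol \<Rightarrow> xa mpol" where
  "shift_pol k = msubst mconst (\<lambda>v. case v of Xv i \<Rightarrow> x_var (i + k) | Av i \<Rightarrow> a_var (i + k))"

text \<open>If \<open>w\<close> fixes all integers outside \<open>{p..q}\<close>, then \<open>shift_perm (1 - p) w\<close> lies in
  \<open>S\<^sub>m\<close> for \<open>m = q - p + 1\<close>.\<close>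

definition double_schubert_interval :: "int \<Rightarrow> int \<Rightarrow> (int \<Rightarrow> int) \<Rightarrow> xa mpol" where
  "double_schubert_interval p q w =
     shift_pol (p - 1) (double_schubert (q - p + 1) (shift_perm (1 - p) w))"

text \<open>The limit is that of formal power series: every coefficient becomes constant as
  \<open>p\<close> tends to minus infinity and \<open>q\<close> to infinity.\<close>

definition back_stable_double_schubert :: "(int \<Rightarrow> int) \<Rightarrow> xa mser" where
  "back_stable_double_schubert w =
     (THE F. \<forall>m. \<forall>\<^sub>F (p, q) in at_bot \<times>\<^sub>F at_top.
        coeff (ser_of (double_schubert_interval p q w)) m = coeff F m)"


section \<open>Double Schur functions\<close>

text \<open>The ring of double symmetric functions is the polynomial ring over the rationals in the
  \<open>a\<^sub>i\<close> (\<open>Agen i\<close>) and the \<open>p\<^sub>k(x||a)\<close> (\<open>Pgen k\<close>, used for \<open>k \<ge> 1\<close> only).  It is realised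
  in the formal power series in \<open>x\<close> and \<open>a\<close> by \<open>dsym_ser\<close>.\<close>

datatype dgen = Pgen nat | Agen int

type_synonym dsym = "dgen mpol"

definition double_power_sum :: "nat \<Rightarrow> xa mser" where
  "double_power_sum k = ser_sum (\<lambda>i. ser_of (x_var i ^ k - a_var i ^ k)) {..0}"

definition dsym_ser :: "dsym \<Rightarrow> xa mser" where
  "dsym_ser = msubst ser_const
     (\<lambda>g. case g of Pgen k \<Rightarrow> double_power_sum k | Agen i \<Rightarrow> ser_of (a_var i))"

text \<open>\<open>complete_sym emb p r\<close> is the complete homogeneous symmetric function \<open>h\<^sub>r\<close>, as a
  polynomial in the power sums \<open>p\<^sub>1, p\<^sub>2, \<dots>\<close>, evaluated at a sequence \<open>p\<close> in an algebra
  over the rationals with structure map \<open>emb\<close>.  It is computed by Newton's identities;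
  the lemma \<open>complete_sym_power_sums\<close> below shows that on actual power sums one gets
  the sum of all monomials of degree \<open>r\<close>.\<close>

fun complete_sym :: "(rat \<Rightarrow> 'b::comm_ring_1) \<Rightarrow> (nat \<Rightarrow> 'b) \<Rightarrow> nat \<Rightarrow> 'b" where
  "complete_sym emb p 0 = 1"
| "complete_sym emb p (Suc r) =
     emb (1 / of_nat (Suc r)) * (\<Sum>k\<le>r. p (Suc k) * complete_sym emb p (r - k))"

definition mdeg :: "'v monomial \<Rightarrow> nat" where
  "mdeg m = (\<Sum>v\<in>Poly_Mapping.keys m. Poly_Mapping.lookup m v)"

lemma mdeg_single: "mdeg (Poly_Mapping.single v k) = k"
  by (simp add: mdeg_def)

lemma mdeg_add: "mdeg (s + t) = mdeg s + mdeg t"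
proof -
  let ?K = "Poly_Mapping.keys s \<union> Poly_Mapping.keys t"
  have *: "mdeg u = (\<Sum>v\<in>?K. Poly_Mapping.lookup u v)"
    if "Poly_Mapping.keys u \<subseteq> ?K" for u
    unfolding mdeg_def using that
    by (intro sum.mono_neutral_left) (auto simp: in_keys_iff)
  show ?thesis
    using *[of s] *[of t] *[of "s + t"] Poly_Mapping.keys_add[of s t]
    by (simp add: lookup_add sum.distrib)
qed

lemma complete_sym_power_sums:
  "complete_sym ser_const (\<lambda>k. ser_sum (\<lambda>v. ser_of (mvar v ^ k)) UNIV) r =
     MSer (\<lambda>m::'v monomial. if mdeg m = r then 1 else 0)"
proof -
  define p where "p = (\<lambda>k. ser_sum (\<lambda>v::'v. ser_of (mvar v ^ k)) UNIV)"
  have pw: "mvar v ^ k = Poly_Mapping.single (Poly_Mapping.single v k) 1" for v :: 'v and k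
    by (induction k) (auto simp: mvar_def Poly_Mapping.mult_single simp flip: single_add)
  have p: "coeff (p k) s = (if \<exists>v. s = Poly_Mapping.single v k then 1 else 0)"
    if "k \<noteq> 0" for k s
  proof (cases "\<exists>v. s = Poly_Mapping.single v k")
    case True
    then obtain v where s: "s = Poly_Mapping.single v k" by blast
    have eq: "Poly_Mapping.single u k = Poly_Mapping.single v k \<longleftrightarrow> u = v" for u
      using that by (metis lookup_single_eq lookup_single_not_eq)
    have "{u. coeff (ser_of (mvar u ^ k)) s \<noteq> 0} = {v}"
      by (auto simp: ser_of_def pw s eq lookup_single when_def)
    then show ?thesis
      using True by (simp add: p_def ser_sum_def) (simp add: ser_of_def pw s)
  next
    case False
    then have "{u. coeff (ser_of (mvar u ^ k)) s \<noteq> 0} = {}"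
      by (auto simp: ser_of_def pw lookup_single when_def)
    then show ?thesis
      using False by (simp add: p_def ser_sum_def)
  qed
  define H where "H = (\<lambda>r. MSer (\<lambda>m::'v monomial. if mdeg m = r then (1::rat) else 0))"
  have pH: "coeff (p (Suc k) * H (r - k)) m =
      (if mdeg m = Suc r then of_nat (card {v. Suc k \<le> Poly_Mapping.lookup m v}) else 0)"
    if "k \<le> r" for k r m
  proof -
    let ?S = "{(s, t) \<in> splits m. (\<exists>v. s = Poly_Mapping.single v (Suc k)) \<and> mdeg t = r - k}"
    have "coeff (p (Suc k) * H (r - k)) m = (\<Sum>(s, t)\<in>splits m.
        if (\<exists>v. s = Poly_Mapping.single v (Suc k)) \<and> mdeg t = r - k then 1 else 0)"
      unfolding times_mser_def by (auto simp: p H_def intro!: sum.cong)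
    also have "\<dots> = (\<Sum>z\<in>?S. 1)"
      by (rule sum.mono_neutral_cong_right) (auto simp: finite_splits split: if_splits)
    also have "\<dots> = of_nat (card ?S)"
      by simp
    also have "card ?S = (if mdeg m = Suc r then card {v. Suc k \<le> Poly_Mapping.lookup m v} else 0)"
    proof (cases "mdeg m = Suc r")
      case False
      then have empty: "?S = {}"
        using that by (auto simp: splits_def mdeg_add mdeg_single)
      show ?thesis unfolding empty using False by simp
    next
      case True
      let ?f = "\<lambda>v. (Poly_Mapping.single v (Suc k), m - Poly_Mapping.single v (Suc k))"
      have sp: "Poly_Mapping.single v (Suc k) + (m - Poly_Mapping.single v (Suc k)) = m"
        if "Suc k \<le> Poly_Mapping.lookup m v" for v
        using that
        by (intro poly_mapping_eqI) (auto simp: lookup_add lookup_minus lookup_single when_def)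
      have "bij_betw ?f {v. Suc k \<le> Poly_Mapping.lookup m v} ?S"
      proof (rule bij_betw_imageI)
        show "inj_on ?f {v. Suc k \<le> Poly_Mapping.lookup m v}"
          by (auto simp: inj_on_def) (metis lookup_single_eq lookup_single_not_eq nat.distinct(1))
        show "?f ` {v. Suc k \<le> Poly_Mapping.lookup m v} = ?S"
        proof (intro equalityI subsetI)
          fix z assume "z \<in> ?f ` {v. Suc k \<le> Poly_Mapping.lookup m v}"
          then obtain v where v: "z = ?f v" "Suc k \<le> Poly_Mapping.lookup m v" by auto
          have "mdeg (m - Poly_Mapping.single v (Suc k)) = r - k"
            using mdeg_add[of "Poly_Mapping.single v (Suc k)" "m - Poly_Mapping.single v (Suc k)"]
              sp[OF v(2)] True by (simp add: mdeg_single)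
          then show "z \<in> ?S"
            using sp[OF v(2)] by (auto simp: v(1) splits_def)
        next
          fix z assume "z \<in> ?S"
          then obtain v t where z: "z = (Poly_Mapping.single v (Suc k), t)"
            and m: "Poly_Mapping.single v (Suc k) + t = m"
            by (auto simp: splits_def)
          have "m - Poly_Mapping.single v (Suc k) = t"
            by (simp flip: m)
          moreover have "Suc k \<le> Poly_Mapping.lookup m v"
            by (simp flip: m add: lookup_add)
          ultimately show "z \<in> ?f ` {v. Suc k \<le> Poly_Mapping.lookup m v}"
            by (auto simp: z)
        qed
      qed
      then have "card {v. Suc k \<le> Poly_Mapping.lookup m v} = card ?S"
        by (rule bij_betw_same_card)
      then show ?thesis
        by (simp only: True refl if_True)
    qed
    finally show ?thesis by simp
  qed
  have count: "(\<Sum>k\<le>r. card {v. Suc k \<le> Poly_Mapping.lookup m v}) = Suc r"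
    if "mdeg m = Suc r" for m :: "'v monomial" and r
  proof -
    let ?K = "Poly_Mapping.keys m"
    have le: "Poly_Mapping.lookup m v \<le> Suc r" for v
    proof (cases "v \<in> ?K")
      case True
      then show ?thesis
        using member_le_sum[of v ?K "Poly_Mapping.lookup m"] that by (simp add: mdeg_def)
    qed (simp add: in_keys_iff)
    have "(\<Sum>k\<le>r. card {v. Suc k \<le> Poly_Mapping.lookup m v}) =
        (\<Sum>k\<le>r. \<Sum>v\<in>?K. if Suc k \<le> Poly_Mapping.lookup m v then 1 else 0)"
    proof (rule sum.cong)
      fix k
      have "{v. Suc k \<le> Poly_Mapping.lookup m v} = {v \<in> ?K. Suc k \<le> Poly_Mapping.lookup m v}"
        by (auto simp: in_keys_iff)
      then show "card {v. Suc k \<le> Poly_Mapping.lookup m v} =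
          (\<Sum>v\<in>?K. if Suc k \<le> Poly_Mapping.lookup m v then 1 else 0)"
        by (simp add: sum.If_cases Int_def)
    qed simp
    also have "\<dots> = (\<Sum>v\<in>?K. \<Sum>k\<le>r. if Suc k \<le> Poly_Mapping.lookup m v then 1 else 0)"
      by (rule sum.swap)
    also have "\<dots> = (\<Sum>v\<in>?K. Poly_Mapping.lookup m v)"
    proof (rule sum.cong)
      fix v
      have "{..r} \<inter> {k. Suc k \<le> Poly_Mapping.lookup m v} = {..<Poly_Mapping.lookup m v}"
        using le[of v] by auto
      then show "(\<Sum>k\<le>r. if Suc k \<le> Poly_Mapping.lookup m v then 1 else 0) =
          Poly_Mapping.lookup m v"
        by (simp add: sum.If_cases)
    qed simp
    finally show ?thesis using that by (simp add: mdeg_def)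
  qed
  have coeff_sum: "coeff (sum f A) m = (\<Sum>i\<in>A. coeff (f i) m)"
    for f :: "nat \<Rightarrow> 'v mser" and A m
    by (induction A rule: infinite_finite_induct) (auto simp: zero_mser_def plus_mser_def)
  have coeff_const: "coeff (ser_const c * f) m = c * coeff f m" for c and f :: "'v mser" and m
  proof -
    have "(\<Sum>(s, t)\<in>splits m. (if s = 0 then c else 0) * coeff f t) =
      (\<Sum>z\<in>{(0::'v monomial, m)}. c * coeff f m)"
      by (rule sum.mono_neutral_cong_right) (simp add: finite_splits, auto simp: splits_def split: if_splits)
    then show ?thesis
      by (simp add: times_mser_def ser_const_def)
  qed
  have "complete_sym ser_const p r = H r"
  proof (induction r rule: less_induct)
    case (less r)
    show ?case
    proof (cases r)
      case 0
      have "mdeg m = 0 \<longleftrightarrow> m = 0" for m :: "'v monomial"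
        by (auto simp: mdeg_def in_keys_iff intro: poly_mapping_eqI)
      then show ?thesis
        by (simp add: 0 H_def one_mser_def)
    next
      case (Suc r')
      show ?thesis
      proof (rule mser_eqI)
        fix m
        have "coeff (complete_sym ser_const p r) m =
            1 / of_nat (Suc r') * (\<Sum>k\<le>r'. coeff (p (Suc k) * H (r' - k)) m)"
          using less by (simp add: Suc coeff_const coeff_sum del: of_nat_Suc)
        also have "\<dots> = coeff (H r) m"
        proof (cases "mdeg m = Suc r'")
          case True
          have "(\<Sum>k\<le>r'. coeff (p (Suc k) * H (r' - k)) m) =
              of_nat (\<Sum>k\<le>r'. card {v. Suc k \<le> Poly_Mapping.lookup m v})"
            by (simp add: pH True)
          then show ?thesis
            using count[OF True] True by (simp add: H_def Suc del: of_nat_Suc)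
        next
          case False
          have "(\<Sum>k\<le>r'. coeff (p (Suc k) * H (r' - k)) m) = 0"
            by (simp add: pH False)
          then show ?thesis
            using False by (simp add: H_def Suc del: of_nat_Suc)
        qed
        finally show "coeff (complete_sym ser_const p r) m = coeff (H r) m" .
      qed
    qed
  qed
  then show ?thesis
    by (simp add: p_def H_def)
qed

text \<open>\<open>h\<^sub>r(x/a)\<close>\<close>

definition h_super :: "nat \<Rightarrow> dsym" where
  "h_super r = complete_sym mconst (\<lambda>k. mvar (Pgen k)) r"

definition gamma_a :: "dsym \<Rightarrow> dsym" where
  "gamma_a = msubst mconst
     (\<lambda>g. case g of Pgen k \<Rightarrow> mvar (Pgen k) - mvar (Agen 1) ^ k
                   | Agen i \<Rightarrow> mvar (Agen (i + 1)))"

definition gamma_a_pow :: "int \<Rightarrow> dsym \<Rightarrow> dsym" where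
  "gamma_a_pow k = (if 0 \<le> k then gamma_a ^^ nat k else inv_into UNIV gamma_a ^^ nat (- k))"

definition h_double :: "int \<Rightarrow> dsym" where
  "h_double r = (if r < 0 then 0 else gamma_a_pow (r - 1) (h_super (nat r)))"

text \<open>A partition is given by the list of its parts.  Trailing zeros are allowed; they do not
  affect the determinant, since a row \<open>i\<close> with \<open>\<lambda>\<^sub>i = 0\<close> has entries \<open>0\<close> left of the diagonal
  and \<open>1\<close> on it.  Indices of \<^const>\<open>mat\<close> and of lists start at \<open>0\<close>, so
  \<open>1 - j\<close> becomes \<open>- j\<close>.\<close>

definition double_schur :: "nat list \<Rightarrow> dsym" where
  "double_schur l =
     det (mat (length l) (length l)
       (\<lambda>(i, j). gamma_a_pow (- int j) (h_double (int (l ! i) - int i + int j))))"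


section \<open>Rectangular bumpless pipedreams\<close>

datatype tile = Empty | NW | SE | Horizontal | Vertical | Crossing

fun north :: "tile \<Rightarrow> bool" where
  "north t \<longleftrightarrow> t \<in> {NW, Vertical, Crossing}"
fun west :: "tile \<Rightarrow> bool" where
  "west t \<longleftrightarrow> t \<in> {NW, Horizontal, Crossing}"
fun south :: "tile \<Rightarrow> bool" where
  "south t \<longleftrightarrow> t \<in> {SE, Vertical, Crossing}"
fun east :: "tile \<Rightarrow> bool" where
  "east t \<longleftrightarrow> t \<in> {SE, Horizontal, Crossing}"

definition rect :: "nat \<Rightarrow> (int \<times> int) set" where
  "rect n = {1..int n} \<times> {1 - int n..int n}"

datatype side = South | West

text \<open>\<open>enters n P k d (i, j)\<close>: the pipe starting at the south boundary in column \<open>k\<close> enters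
  square \<open>(i, j)\<close> through its side \<open>d\<close>.  The squares reached include those of row \<open>0\<close> and of
  column \<open>n + 1\<close>, just outside the rectangle: the pipe exits through the north boundary in
  column \<open>j\<close> if it enters \<open>(0, j)\<close>, and through the east boundary in row \<open>i\<close> if it enters
  \<open>(i, n + 1)\<close>.\<close>

inductive enters :: "nat \<Rightarrow> (int \<times> int \<Rightarrow> tile) \<Rightarrow> int \<Rightarrow> side \<Rightarrow> int \<times> int \<Rightarrow> bool"
  for n P k where
  start: "k \<in> {1 - int n..int n} \<Longrightarrow> enters n P k South (int n, k)"
| up: "enters n P k d (i, j) \<Longrightarrow> (i, j) \<in> rect n \<Longrightarrow>
    (d, P (i, j)) \<in> {(South, Vertical), (South, Crossing), (West, NW)} \<Longrightarrow>
    enters n P k South (i - 1, j)"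
| right: "enters n P k d (i, j) \<Longrightarrow> (i, j) \<in> rect n \<Longrightarrow>
    (d, P (i, j)) \<in> {(West, Horizontal), (West, Crossing), (South, SE)} \<Longrightarrow>
    enters n P k West (i, j + 1)"

definition crossings :: "nat \<Rightarrow> (int \<times> int \<Rightarrow> tile) \<Rightarrow> int \<Rightarrow> int \<Rightarrow> (int \<times> int) set" where
  "crossings n P k l = {s \<in> rect n. P s = Crossing \<and>
     (enters n P k South s \<and> enters n P l West s \<or> enters n P k West s \<and> enters n P l South s)}"

text \<open>Tilings are extensional functions on the rectangle, so that distinct functions are
  distinct tilings.  Since no pipe comes in from the west, the \<open>2n\<close> pipes from the south
  boundary are all the pipes.\<close>

definition rect_bpd :: "nat \<Rightarrow> (int \<Rightarrow> int) \<Rightarrow> (int \<times> int \<Rightarrow> tile) \<Rightarrow> bool" where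
  "rect_bpd n w P \<longleftrightarrow>
     P \<in> rect n \<rightarrow>\<^sub>E UNIV \<and>
     (\<forall>i j. (i, j) \<in> rect n \<and> (i + 1, j) \<in> rect n \<longrightarrow> south (P (i, j)) = north (P (i + 1, j))) \<and>
     (\<forall>i j. (i, j) \<in> rect n \<and> (i, j + 1) \<in> rect n \<longrightarrow> east (P (i, j)) = west (P (i, j + 1))) \<and>
     (\<forall>i\<in>{1..int n}. \<not> west (P (i, 1 - int n))) \<and>
     (\<forall>j\<in>{1 - int n..int n}. south (P (int n, j))) \<and>
     (\<forall>k\<in>{1..int n}. enters n P k West (inv_into UNIV w k, int n + 1)) \<and>
     (\<forall>k\<in>{1 - int n..0}. \<exists>j. enters n P k South (0, j)) \<and>
     (\<forall>k\<in>{1 - int n..int n}. \<forall>l\<in>{1 - int n..int n}. k \<noteq> l \<longrightarrow> card (crossings n P k l) \<le> 1) \<and>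
     (\<forall>k\<in>{1 - int n..0}. \<forall>l\<in>{1 - int n..int n}. k \<noteq> l \<longrightarrow> crossings n P k l = {})"

definition bpd_weight :: "nat \<Rightarrow> (int \<times> int \<Rightarrow> tile) \<Rightarrow> xa mpol" where
  "bpd_weight n P = (\<Prod>(i, j)\<in>{s \<in> rect n. P s = Empty}. x_var i - a_var j)"

text \<open>Follow a lattice path (\<open>True\<close> a step down, \<open>False\<close> a step left) starting at horizontal
  distance \<open>c\<close> from the left side of the box; each step down at distance \<open>c\<close> leaves \<open>c\<close> cells of
  that row west of the path.\<close>

fun path_rows :: "nat \<Rightarrow> bool list \<Rightarrow> nat list" where
  "path_rows c [] = []"
| "path_rows c (False # bs) = path_rows (c - 1) bs"
| "path_rows c (True # bs) = c # path_rows c bs"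

definition bpd_shape :: "nat \<Rightarrow> (int \<times> int \<Rightarrow> tile) \<Rightarrow> nat list" where
  "bpd_shape n P = path_rows n (map (\<lambda>j. north (P (1, j))) (rev [1 - int n..int n]))"

end

theory Submission
  imports Defs
begin

text \<open>
  Label every edge of a bumpless pipedream by the pipe through it.  Given the labels on the south
  and west sides of a row, the tiles and the labels on its north side determine each other, so the
  weighted count of tilings is a product of row operators.  Two pipes cross at most once if and
  only if in every crossing the pipe from the west has the smaller label; hence reducedness is a
  local condition, and the model satisfies a Yang--Baxter equation.  For two neighbouring rows it
  says that the generating function \<open>Z\<^sub>v\<close> of a square satisfies
  \<open>(x\<^sub>i - x\<^sub>i\<^sub>+\<^sub>1) Z\<^sub>v = Z\<^sub>v\<^sub>s - s\<^sub>i Z\<^sub>v\<^sub>s\<close>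
  with \<open>s = s\<^sub>i\<close>, so \<open>Z\<^sub>v\<close> is the double Schubert polynomial.
  For \<open>w \<in> S\<^sub>n\<close> in the square of the interval \<open>p..q\<close>, the rows below \<open>n\<close>
  are frozen, the rows from \<open>1\<close> to \<open>n\<close> form a rectangular bumpless pipedream next to
  vertical pipes, and above them the pipes do not cross.  That last part is a sum over interlacing
  positions; column operations turn it into the Jacobi--Trudi determinant of the double Schur
  function in the variables with index at least \<open>p\<close>, and \<open>p\<close> tends to minus infinity.
\<close>

section \<open>The lattice model and its Yang--Baxter equation\<close>

text \<open>The rectangle begins at column \<open>1 - n\<close> because the rows \<open>1..n\<close>
  cannot disturb pipes further west. In a row left by a positive pipe, a nonpositive pipe that
  turned east next to a larger one would be crossed by it, and a nonpositive label with a larger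
  label to its west never gets back into order. So each row frees at most one more nonpositive pipe,
  and \<open>n\<close> rows stay within the columns \<open>1 - n..0\<close>.

  The determinant comes from the recursion \<open>entry_step\<close>, in which an entry picks up the
  factor \<open>x k - a b\<close>, the weight of an empty square, when its column grows by one. The
  part of a row between two pipes therefore turns into a row operation on the determinant. There is
  one gap fewer than pipes; the missing row is accounted for by evaluation at \<open>x k\<close>, a
  combination of columns with leading coefficient 1.

  The cut-off \<open>p\<close> does not survive in the size of the determinant: the vertical pipes
  in the columns \<open>p..-n\<close> contribute a unitriangular block, and an \<open>n\<close> by
  \<open>n\<close> determinant remains.\<close>

type_synonym lab = "int option"

text \<open>Sum over the fillings of one row, from left to right: \<open>as\<close> are the column parameters,
  \<open>h\<close> is the label entering from the west, \<open>bs\<close> are the labels on the south side, \<open>e\<close>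
  is the label required at the east end, and \<open>F\<close> is evaluated at the labels on the north side.\<close>

fun row_transfer :: "'r::comm_ring_1 \<Rightarrow> 'r list \<Rightarrow> lab \<Rightarrow> lab list \<Rightarrow> lab \<Rightarrow> (lab list \<Rightarrow> 'r) \<Rightarrow> 'r" where
  "row_transfer x (a # as) None (None # bs) e F = (x - a) * row_transfer x as None bs e (\<lambda>ts. F (None # ts))"
| "row_transfer x (a # as) None (Some k # bs) e F =
     row_transfer x as None bs e (\<lambda>ts. F (Some k # ts)) + row_transfer x as (Some k) bs e (\<lambda>ts. F (None # ts))"
| "row_transfer x (a # as) (Some k) (None # bs) e F =
     row_transfer x as (Some k) bs e (\<lambda>ts. F (None # ts)) + row_transfer x as None bs e (\<lambda>ts. F (Some k # ts))"
| "row_transfer x (a # as) (Some k) (Some l # bs) e F =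
     (if k < l then row_transfer x as (Some k) bs e (\<lambda>ts. F (Some l # ts)) else 0)"
| "row_transfer x [] h [] e F = (if h = e then F [] else 0)"
| "row_transfer x [] h (b # bs) e F = 0"
| "row_transfer x (a # as) h [] e F = 0"

lemma row_transfer_add: "row_transfer x as h bs e (\<lambda>ts. F ts + G ts) = row_transfer x as h bs e F + row_transfer x as h bs e G"
  by (induction x as h bs e F arbitrary: G rule: row_transfer.induct) (simp_all, simp_all add: algebra_simps)

lemma row_transfer_zero: "row_transfer x as h bs e (\<lambda>ts. 0) = 0"
  using row_transfer_add[of x as h bs e "\<lambda>ts. 0" "\<lambda>ts. 0"] by simp

lemma row_transfer_mult: "row_transfer x as h bs e (\<lambda>ts. c * F ts) = c * row_transfer x as h bs e F"
  by (induction x as h bs e F rule: row_transfer.induct) (simp_all, simp_all add: algebra_simps)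

text \<open>In the Yang--Baxter equation an edge without pipe behaves like one with the largest label.\<close>

fun lab_less :: "lab \<Rightarrow> lab \<Rightarrow> bool" where
  "lab_less (Some k) None = True"
| "lab_less (Some k) (Some l) = (k < l)"
| "lab_less None b = False"

definition two_rows where
  "two_rows x y as c d bs \<alpha> \<beta> F = row_transfer y as d bs \<beta> (\<lambda>ts. row_transfer x as c ts \<alpha> F)"

text \<open>The optional terms are a crossing of the two rows, attached at the west end on the left
  side and at the east end on the right: exchanging the two labels there costs \<open>x - y\<close>,
  keeping them costs 1. It is moved past one column at a time, so the induction hypothesis is needed
  for all \<open>c\<close> and \<open>d\<close>, which a column changes, while
  \<open>\<alpha>\<close> and \<open>\<beta>\<close> stay fixed. In \<open>two_rows\<close> the
  lower row has the variable \<open>y\<close> and the labels \<open>d\<close> and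
  \<open>\<beta>\<close>.\<close>

lemma row_transfer_yang_baxter:
  assumes "length bs = length as"
  shows "two_rows x y as c d bs \<alpha> \<beta> F + (if lab_less c d then (x - y) * two_rows x y as d c bs \<alpha> \<beta> F else 0) =
    two_rows y x as c d bs \<alpha> \<beta> F + (if lab_less \<beta> \<alpha> then (x - y) * two_rows y x as c d bs \<beta> \<alpha> F else 0)"
  using assms
proof (induction as arbitrary: bs c d F)
  case Nil
  then show ?case by (cases c; cases d) (auto simp: two_rows_def)
next
  case (Cons a as)
  then obtain s bs' where bs: "bs = s # bs'" "length bs' = length as" by (cases bs) auto
  define T where "T u v p q c d F = two_rows u v as c d bs' p q F" for u v p q c d F
  define K where "K c d F = (if lab_less \<beta> \<alpha> then (x - y) * T y x \<beta> \<alpha> c d F else 0)" for c d F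
  have IH: "T x y \<alpha> \<beta> c d F + (if lab_less c d then (x - y) * T x y \<alpha> \<beta> d c F else 0) =
      T y x \<alpha> \<beta> c d F + K c d F" for c d F
    unfolding T_def K_def by (rule Cons.IH[OF bs(2)])
  \<comment> \<open>Eight cases, according to which of the two west labels and the south label are
    present; each summand is one way to fill the two squares of the column.\<close>
  have step: "two_rows u v (a # as) c d (s # bs') p q F =
      (let C = \<lambda>c d t. T u v p q c d (\<lambda>ts. F (t # ts)) in
       case (c, d, s) of
         (None, None, None) \<Rightarrow> (v - a) * (u - a) * C None None None
       | (Some k, None, None) \<Rightarrow> (v - a) * (C (Some k) None None + C None None (Some k))
       | (None, Some l, None) \<Rightarrow> (u - a) * C None (Some l) None
           + C None None (Some l) + C (Some l) None None
       | (Some k, Some l, None) \<Rightarrow> C (Some k) (Some l) None + C None (Some l) (Some k)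
           + (if k < l then C (Some k) None (Some l) else 0)
       | (None, None, Some m) \<Rightarrow> C None None (Some m) + C (Some m) None None
           + (u - a) * C None (Some m) None
       | (Some k, None, Some m) \<Rightarrow> (if k < m then C (Some k) None (Some m) else 0)
           + C (Some k) (Some m) None + C None (Some m) (Some k)
       | (None, Some l, Some m) \<Rightarrow> (if l < m then C None (Some l) (Some m) + C (Some m) (Some l) None else 0)
       | (Some k, Some l, Some m) \<Rightarrow> (if k < m \<and> l < m then C (Some k) (Some l) (Some m) else 0))"
    for u v p q c d F
    by (cases c; cases d; cases s)
       (auto simp: T_def two_rows_def row_transfer_add row_transfer_mult row_transfer_zero; simp add: algebra_simps)+
  \<comment> \<open>Exchanging the east labels does not affect the recursion at the west end, so the
    extra term obeys it as well.\<close>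
  have K_expand: "(if lab_less \<beta> \<alpha> then (x - y) * two_rows y x (a # as) c d (s # bs') \<beta> \<alpha> F else 0) =
      (let C = \<lambda>c d t. K c d (\<lambda>ts. F (t # ts)) in
       case (c, d, s) of
         (None, None, None) \<Rightarrow> (x - a) * (y - a) * C None None None
       | (Some k, None, None) \<Rightarrow> (x - a) * (C (Some k) None None + C None None (Some k))
       | (None, Some l, None) \<Rightarrow> (y - a) * C None (Some l) None
           + C None None (Some l) + C (Some l) None None
       | (Some k, Some l, None) \<Rightarrow> C (Some k) (Some l) None + C None (Some l) (Some k)
           + (if k < l then C (Some k) None (Some l) else 0)
       | (None, None, Some m) \<Rightarrow> C None None (Some m) + C (Some m) None None
           + (y - a) * C None (Some m) None
       | (Some k, None, Some m) \<Rightarrow> (if k < m then C (Some k) None (Some m) else 0)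
           + C (Some k) (Some m) None + C None (Some m) (Some k)
       | (None, Some l, Some m) \<Rightarrow> (if l < m then C None (Some l) (Some m) + C (Some m) (Some l) None else 0)
       | (Some k, Some l, Some m) \<Rightarrow> (if k < m \<and> l < m then C (Some k) (Some l) (Some m) else 0))"
    unfolding step Let_def
    by (auto simp: K_def algebra_simps split: option.splits)
  have rew: "T x y \<alpha> \<beta> c d F = T y x \<alpha> \<beta> c d F + K c d F" if "\<not> lab_less c d" for c d F
    using IH[of c d F] that by simp
  \<comment> \<open>The exchanged labels fall under \<open>rew\<close>. Every \<open>T x y\<close>
    is thereby eliminated, and an identity in \<open>T y x\<close> and \<open>K\<close> is left to
    check.\<close>
  have rew': "T x y \<alpha> \<beta> c d F = T y x \<alpha> \<beta> c d F + K c d F - (x - y) * (T y x \<alpha> \<beta> d c F + K d c F)"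
    if "lab_less c d" for c d F
  proof -
    have "\<not> lab_less d c" using that by (cases c; cases d) auto
    then show ?thesis using IH[of c d F] rew[of d c F] that by (simp add: algebra_simps)
  qed
  show ?case
    unfolding bs K_expand unfolding step
    by (cases c; cases d; cases s) (simp_all add: Let_def rew rew' algebra_simps)
qed

section \<open>Polynomial algebra\<close>

text \<open>The order serves only to make polynomials in these variables an integral domain.\<close>

instantiation xa :: linorder
begin

fun xa_code :: "xa \<Rightarrow> bool \<times> int" where
  "xa_code (Xv i) = (False, i)"
| "xa_code (Av i) = (True, i)"

definition less_eq_xa :: "xa \<Rightarrow> xa \<Rightarrow> bool" where
  "u \<le> v \<longleftrightarrow> fst (xa_code u) < fst (xa_code v) \<or>
     fst (xa_code u) = fst (xa_code v) \<and> snd (xa_code u) \<le> snd (xa_code v)"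
definition less_xa :: "xa \<Rightarrow> xa \<Rightarrow> bool" where
  "u < v \<longleftrightarrow> u \<le> v \<and> \<not> v \<le> (u :: xa)"

instance
proof
  fix u v w :: xa
  show "u = v" if "u \<le> v" "v \<le> u"
    using that by (cases u; cases v) (auto simp: less_eq_xa_def)
qed (auto simp: less_eq_xa_def less_xa_def)

end

lemma poly_mapping_sum_single:
  "P = (\<Sum>m\<in>Poly_Mapping.keys P. Poly_Mapping.single m (Poly_Mapping.lookup P m))"
  by (rule poly_mapping_eqI)
     (auto simp: lookup_sum lookup_single when_def in_keys_iff)

lemma mconst_hom: "comm_ring_hom mconst"
  by unfold_locales (auto simp: mconst_def single_add mult_single)

lemma ser_const_eq: "ser_const c = ser_of (mconst c)"
  by (auto simp: ser_const_def ser_of_def mconst_def lookup_single when_def intro!: mser_eqI)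

lemma ser_of_hom: "comm_ring_hom ser_of"
proof unfold_locales
  fix P Q :: "'a mpol"
  show "ser_of (P + Q) = ser_of P + ser_of Q"
    by (rule mser_eqI) (simp add: ser_of_def plus_mser_def lookup_add)
  show "ser_of (P * Q) = ser_of P * ser_of Q"
  proof (rule mser_eqI)
    fix m
    let ?K = "Poly_Mapping.keys P \<times> Poly_Mapping.keys Q"
    have "Poly_Mapping.lookup (P * Q) m =
        (\<Sum>(s, t)\<in>?K. if s + t = m then Poly_Mapping.lookup P s * Poly_Mapping.lookup Q t else 0)"
      by (subst (1) poly_mapping_sum_single[of P], subst (1) poly_mapping_sum_single[of Q])
         (simp add: sum_product lookup_sum mult_single lookup_single when_def sum.cartesian_product
           case_prod_unfold)
    also have "\<dots> = (\<Sum>(s, t)\<in>splits m. Poly_Mapping.lookup P s * Poly_Mapping.lookup Q t)"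
      by (rule sum.mono_neutral_cong) (insert finite_splits[of m], auto simp: splits_def in_keys_iff)
    finally show "coeff (ser_of (P * Q)) m = coeff (ser_of P * ser_of Q) m"
      by (simp add: ser_of_def times_mser_def)
  qed
qed (auto simp: ser_of_def zero_mser_def one_mser_def lookup_one when_def intro!: mser_eqI)

context
  fixes emb :: "rat \<Rightarrow> 'b::comm_ring_1" and f :: "'v \<Rightarrow> 'b"
  assumes emb: "comm_ring_hom emb"
begin

interpretation emb: comm_ring_hom emb by (rule emb)

lemma msubst_superset:
  assumes "finite A" "Poly_Mapping.keys P \<subseteq> A"
  shows "msubst emb f P = (\<Sum>m\<in>A. emb (Poly_Mapping.lookup P m) *
    (\<Prod>v\<in>Poly_Mapping.keys m. f v ^ Poly_Mapping.lookup m v))"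
  unfolding msubst_def using assms by (intro sum.mono_neutral_left) (auto simp: in_keys_iff)

lemma msubst_single:
  "msubst emb f (Poly_Mapping.single m c) =
     emb c * (\<Prod>v\<in>Poly_Mapping.keys m. f v ^ Poly_Mapping.lookup m v)"
  by (subst msubst_superset[of "{m}"]) auto

lemma msubst_add: "msubst emb f (P + Q) = msubst emb f P + msubst emb f Q"
  by (subst (1 2 3) msubst_superset[of "Poly_Mapping.keys P \<union> Poly_Mapping.keys Q"])
     (use keys_add[of P Q] in \<open>auto simp: lookup_add emb.hom_add algebra_simps sum.distrib\<close>)

lemma msubst_zero: "msubst emb f 0 = 0"
  by (simp add: msubst_def)

lemma msubst_sum: "msubst emb f (sum g A) = (\<Sum>i\<in>A. msubst emb f (g i))"
  by (induction A rule: infinite_finite_induct) (auto simp: msubst_zero msubst_add)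

lemma prod_monomial_add:
  "(\<Prod>v\<in>Poly_Mapping.keys (s + t). f v ^ Poly_Mapping.lookup (s + t) v) =
     (\<Prod>v\<in>Poly_Mapping.keys s. f v ^ Poly_Mapping.lookup s v) *
     (\<Prod>v\<in>Poly_Mapping.keys t. f v ^ Poly_Mapping.lookup t v)"
proof -
  let ?K = "Poly_Mapping.keys s \<union> Poly_Mapping.keys t"
  have *: "(\<Prod>v\<in>Poly_Mapping.keys u. f v ^ Poly_Mapping.lookup u v) = (\<Prod>v\<in>?K. f v ^ Poly_Mapping.lookup u v)"
    if "Poly_Mapping.keys u \<subseteq> ?K" for u
    using that by (intro prod.mono_neutral_left) (auto simp: in_keys_iff)
  show ?thesis
    unfolding *[OF Poly_Mapping.keys_add] *[OF Un_upper1] *[OF Un_upper2]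
    by (simp add: lookup_add power_add prod.distrib)
qed

lemma msubst_hom: "comm_ring_hom (msubst emb f)"
proof unfold_locales
  fix P Q :: "'v mpol"
  have "msubst emb f (P * Q) = (\<Sum>s\<in>Poly_Mapping.keys P. \<Sum>t\<in>Poly_Mapping.keys Q.
      msubst emb f (Poly_Mapping.single s (Poly_Mapping.lookup P s) * Poly_Mapping.single t (Poly_Mapping.lookup Q t)))"
    by (subst (1) poly_mapping_sum_single[of P], subst (1) poly_mapping_sum_single[of Q])
       (simp add: sum_product msubst_sum)
  also have "\<dots> = msubst emb f P * msubst emb f Q"
    unfolding msubst_def[of emb f P] msubst_def[of emb f Q]
    by (simp add: mult_single msubst_single prod_monomial_add emb.hom_mult sum_product mult_ac)
  finally show "msubst emb f (P * Q) = msubst emb f P * msubst emb f Q" .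
  show "msubst emb f 1 = 1"
    by (simp flip: single_one add: msubst_single)
qed (simp_all add: msubst_add msubst_zero)

lemma msubst_mvar: "msubst emb f (mvar v) = f v"
  by (simp add: mvar_def msubst_single)

lemma msubst_mconst: "msubst emb f (mconst c) = emb c"
  by (simp add: mconst_def msubst_single)

end

lemma hom_msubst:
  assumes "comm_ring_hom \<phi>" "\<And>c. \<phi> (emb c) = emb' c"
  shows "\<phi> (msubst emb f P) = msubst emb' (\<lambda>v. \<phi> (f v)) P"
proof -
  interpret comm_ring_hom \<phi> by (rule assms(1))
  show ?thesis
    by (simp add: msubst_def hom_sum hom_mult hom_prod hom_power assms(2))
qed

lemma mvar_power: "mvar v ^ k = Poly_Mapping.single (Poly_Mapping.single v k) 1"
  by (induction k) (auto simp: mvar_def Poly_Mapping.mult_single simp flip: single_add)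

lemma msubst_id: "msubst mconst mvar P = P"
proof -
  have pr: "(\<Prod>v\<in>A. Poly_Mapping.single (g v) (1::rat)) = Poly_Mapping.single (\<Sum>v\<in>A. g v) 1"
    for A and g :: "'a \<Rightarrow> 'a monomial"
    by (induction A rule: infinite_finite_induct) (auto simp: mult_single)
  have "msubst mconst mvar P = (\<Sum>m\<in>Poly_Mapping.keys P. Poly_Mapping.single m (Poly_Mapping.lookup P m))"
    unfolding msubst_def
  proof (rule sum.cong[OF refl])
    fix m :: "'a monomial"
    have "m = (\<Sum>v\<in>Poly_Mapping.keys m. Poly_Mapping.single v (Poly_Mapping.lookup m v))"
      by (rule poly_mapping_eqI) (auto simp: lookup_sum lookup_single when_def in_keys_iff)
    then show "mconst (Poly_Mapping.lookup P m) * (\<Prod>v\<in>Poly_Mapping.keys m. mvar v ^ Poly_Mapping.lookup m v)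
        = Poly_Mapping.single m (Poly_Mapping.lookup P m)"
      by (simp add: mvar_power pr mconst_def mult_single)
  qed
  then show ?thesis
    by (simp flip: poly_mapping_sum_single)
qed

section \<open>Double Schubert polynomials as partition functions\<close>

lemma row_transfer_cong:
  assumes "\<And>ts. length ts = length as \<Longrightarrow> F ts = G ts"
  shows "row_transfer x as h bs e F = row_transfer x as h bs e G"
  using assms by (induction x as h bs e F arbitrary: G rule: row_transfer.induct) auto

lemma row_transfer_diff: "row_transfer x as h bs e (\<lambda>ts. F ts - G ts) = row_transfer x as h bs e F - row_transfer x as h bs e G"
  using row_transfer_add[of x as h bs e "\<lambda>ts. F ts - G ts" G] by simp

lemma row_transfer_hom:
  assumes "comm_ring_hom \<phi>"
  shows "\<phi> (row_transfer x as h bs e F) = row_transfer (\<phi> x) (map \<phi> as) h bs e (\<lambda>ts. \<phi> (F ts))"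
proof -
  interpret comm_ring_hom \<phi> by (rule assms)
  show ?thesis
    by (induction x as h bs e F rule: row_transfer.induct)
      (simp_all add: hom_add hom_mult hom_minus)
qed

text \<open>Pipes neither begin nor change their label inside a row, so a label leaving in the east
  has come in from the west or the south.\<close>

lemma row_transfer_exit_absent:
  assumes "Some k \<notin> set (h # bs)"
  shows "row_transfer x as h bs (Some k) F = 0"
  using assms by (induction x as h bs "Some k" F rule: row_transfer.induct) auto

lemma row_transfer_cross_all:
  assumes "length ls = length as" "\<forall>l\<in>set ls. k < l"
  shows "row_transfer x as (Some k) (map Some ls) (Some k) F = F (map Some ls)"
  using assms
  by (induction ls arbitrary: as F) (auto simp: Suc_length_conv)

text \<open>The rows are listed from bottom to top, each with its variable and its east label.\<close>

fun rows_transfer :: "'r::comm_ring_1 list \<Rightarrow> ('r \<times> lab) list \<Rightarrow> lab list \<Rightarrow> (lab list \<Rightarrow> 'r) \<Rightarrow> 'r" where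
  "rows_transfer as [] bs F = F bs"
| "rows_transfer as ((x, e) # rs) bs F = row_transfer x as None bs e (\<lambda>ts. rows_transfer as rs ts F)"

lemma rows_transfer_append: "rows_transfer as (rs @ rs') bs F = rows_transfer as rs bs (\<lambda>ts. rows_transfer as rs' ts F)"
  by (induction as rs bs F rule: rows_transfer.induct) auto

lemma rows_transfer_cong:
  assumes "length bs = length as" "\<And>ts. length ts = length as \<Longrightarrow> F ts = G ts"
  shows "rows_transfer as rs bs F = rows_transfer as rs bs G"
  using assms
  by (induction as rs bs F rule: rows_transfer.induct) (auto intro: row_transfer_cong)

lemma rows_transfer_diff: "rows_transfer as rs bs (\<lambda>ts. F ts - G ts) = rows_transfer as rs bs F - rows_transfer as rs bs G"
  by (induction as rs bs F rule: rows_transfer.induct) (auto simp: row_transfer_diff)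

lemma rows_transfer_mult: "rows_transfer as rs bs (\<lambda>ts. c * F ts) = c * rows_transfer as rs bs F"
  by (induction as rs bs F rule: rows_transfer.induct) (auto simp: row_transfer_mult)

lemma rows_transfer_hom:
  assumes "comm_ring_hom \<phi>"
  shows "\<phi> (rows_transfer as rs bs F) =
    rows_transfer (map \<phi> as) (map (\<lambda>(x, e). (\<phi> x, e)) rs) bs (\<lambda>ts. \<phi> (F ts))"
  by (induction as rs bs F rule: rows_transfer.induct) (auto simp: row_transfer_hom[OF assms])

text \<open>The west edges are empty, so only the crossing at the east end can appear in the
  Yang-Baxter equation. With the larger label in the lower row it does not appear, and the pair of
  rows is symmetric in \<open>x\<close> and \<open>y\<close>; with the larger label in the upper row
  it appears and gives the divided difference.\<close>

lemma rows_transfer_swap: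
  assumes "k < l" "length bs = length as"
  shows "(x - y) * rows_transfer as (pre @ (y, Some l) # (x, Some k) # post) bs F =
    rows_transfer as (pre @ (y, Some k) # (x, Some l) # post) bs F -
    rows_transfer as (pre @ (x, Some k) # (y, Some l) # post) bs F"
proof -
  have "(x - y) * rows_transfer as ((y, Some l) # (x, Some k) # post) ts F =
    rows_transfer as ((y, Some k) # (x, Some l) # post) ts F -
    rows_transfer as ((x, Some k) # (y, Some l) # post) ts F" if "length ts = length as" for ts
    using row_transfer_yang_baxter[OF that, of x y None None "Some l" "Some k" "\<lambda>ts. rows_transfer as post ts F"]
      row_transfer_yang_baxter[OF that, of x y None None "Some k" "Some l" "\<lambda>ts. rows_transfer as post ts F"] assms(1)
    by (simp add: two_rows_def algebra_simps)
  then show ?thesis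
    unfolding rows_transfer_append rows_transfer_mult[symmetric] rows_transfer_diff[symmetric]
    using assms(2) by (intro rows_transfer_cong) auto
qed

definition no_pipes :: "lab list \<Rightarrow> 'r::comm_ring_1" where
  "no_pipes ts = (if set ts \<subseteq> {None} then 1 else 0)"

text \<open>The function \<open>Z\<close> for the square on \<open>p..q\<close>. The variables are
  arguments, so that exchanging two of them, shifting indices and applying a ring homomorphism are
  all changes of \<open>x\<close> and \<open>a\<close>.\<close>

definition pipe_sum :: "int \<Rightarrow> int \<Rightarrow> (int \<Rightarrow> 'r) \<Rightarrow> (int \<Rightarrow> 'r) \<Rightarrow> (int \<Rightarrow> int) \<Rightarrow> 'r::comm_ring_1" where
  "pipe_sum p q x a w = rows_transfer (map a [p..q]) (map (\<lambda>i. (x i, Some (w i))) (rev [p..q]))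
     (map Some [p..q]) no_pipes"

lemma pipe_sum_hom:
  assumes "comm_ring_hom \<phi>"
  shows "\<phi> (pipe_sum p q x a w) = pipe_sum p q (\<lambda>i. \<phi> (x i)) (\<lambda>i. \<phi> (a i)) w"
proof -
  interpret comm_ring_hom \<phi> by (rule assms)
  have "(\<lambda>ts. \<phi> (no_pipes ts)) = no_pipes"
    by (simp add: no_pipes_def fun_eq_iff)
  then show ?thesis
    by (simp add: pipe_sum_def rows_transfer_hom[OF assms] comp_def)
qed

lemma upto_split_pair: 
  assumes "p \<le> i" "i < q"
  shows "[p..q] = [p..i - 1] @ i # (i + 1) # [i + 2..q]"
  using upto_split2[of p i q] upto_rec2[of p i] upto_rec1[of "i + 1" q] assms by (simp add: add.commute)

text \<open>Row \<open>i\<close> lies above row \<open>i + 1\<close>, so an ascent of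
  \<open>w\<close> puts the smaller label into the upper row, as \<open>rows_transfer_swap\<close>
  requires.\<close>

lemma pipe_sum_swap:
  assumes "p \<le> i" "i < q" "w i < w (i + 1)"
  shows "(x i - x (i + 1)) * pipe_sum p q x a w =
    pipe_sum p q x a (w \<circ> transpose i (i + 1)) -
    pipe_sum p q (x \<circ> transpose i (i + 1)) a (w \<circ> transpose i (i + 1))"
proof -
  have eq: "map (\<lambda>k. (u (transpose i (i + 1) k), Some (v (transpose i (i + 1) k)))) (rev [i + 2..q])
      = map (\<lambda>k. (u k, Some (v k))) (rev [i + 2..q])"
    "map (\<lambda>k. (u (transpose i (i + 1) k), Some (v (transpose i (i + 1) k)))) (rev [p..i - 1])
      = map (\<lambda>k. (u k, Some (v k))) (rev [p..i - 1])"
    "map (\<lambda>k. (u k, Some (v (transpose i (i + 1) k)))) (rev [i + 2..q])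
      = map (\<lambda>k. (u k, Some (v k))) (rev [i + 2..q])"
    "map (\<lambda>k. (u k, Some (v (transpose i (i + 1) k)))) (rev [p..i - 1])
      = map (\<lambda>k. (u k, Some (v k))) (rev [p..i - 1])"
    for u :: "int \<Rightarrow> 'a" and v :: "int \<Rightarrow> int"
    by (auto simp: transpose_def)
  have rows: "map g (rev [p..q]) = map g (rev [i + 2..q]) @ g (i + 1) # g i # map g (rev [p..i - 1])"
    for g :: "int \<Rightarrow> 'a \<times> lab"
    by (subst upto_split_pair[OF assms(1,2)]) simp
  show ?thesis
    unfolding pipe_sum_def rows comp_def eq
    using rows_transfer_swap[OF assms(3), of "map Some [p..q]" "map a [p..q]"] by simp
qed

lemma swap_x_hom: "comm_ring_hom (swap_x i)"
  unfolding swap_x_def by (rule msubst_hom[OF mconst_hom])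

lemma swap_x_var: "swap_x i (x_var k) = x_var (transpose i (i + 1) k)" "swap_x i (a_var k) = a_var k"
  by (simp_all add: swap_x_def msubst_mvar[OF mconst_hom])

lemma mvar_inject: "mvar u = mvar v \<longleftrightarrow> u = v"
  by (metis lookup_single_eq lookup_single_not_eq mvar_def zero_neq_one)

lemma divdiff_eqI:
  assumes "(x_var i - x_var (i + 1)) * g = f - swap_x i f"
  shows "divdiff i f = g"
  unfolding divdiff_def
proof (rule the_equality)
  show "(x_var i - x_var (i + 1)) * g = f - swap_x i f" by (rule assms)
next
  fix g' assume "(x_var i - x_var (i + 1)) * g' = f - swap_x i f"
  then have "(x_var i - x_var (i + 1)) * g' = (x_var i - x_var (i + 1)) * g"
    by (simp add: assms)
  moreover have "x_var i - x_var (i + 1) \<noteq> 0"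
    by (simp add: mvar_inject)
  ultimately show "g' = g" by simp
qed

abbreviation schubert_sum :: "int \<Rightarrow> (int \<Rightarrow> int) \<Rightarrow> xa mpol" where
  "schubert_sum m v \<equiv> pipe_sum 1 m x_var a_var v"

lemma divdiff_schubert_sum:
  assumes "1 \<le> i" "i < m" "v i < v (i + 1)"
  shows "divdiff i (schubert_sum m (v \<circ> transpose i (i + 1))) = schubert_sum m v"
proof (rule divdiff_eqI)
  have "swap_x i (schubert_sum m (v \<circ> transpose i (i + 1))) =
      pipe_sum 1 m (x_var \<circ> transpose i (i + 1)) a_var (v \<circ> transpose i (i + 1))"
    by (simp add: pipe_sum_hom[OF swap_x_hom] swap_x_var comp_def)
  then show "(x_var i - x_var (i + 1)) * schubert_sum m v =
      schubert_sum m (v \<circ> transpose i (i + 1)) - swap_x i (schubert_sum m (v \<circ> transpose i (i + 1)))"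
    using pipe_sum_swap[OF assms, of x_var a_var] by simp
qed

text \<open>The columns \<open>cs\<close> hold no pipe and stay empty. The pipe \<open>k\<close> has
  to turn east at once, since after rising it could no longer leave this row in the east, and being
  the smallest it may cross all the others.\<close>

lemma row_transfer_longest_row:
  assumes "length ls = length as" "\<forall>l\<in>set ls. k < l"
  shows "row_transfer x (cs @ a # as) None (replicate (length cs) None @ Some k # map Some ls) (Some k) F =
    (\<Prod>c\<leftarrow>cs. x - c) * F (replicate (Suc (length cs)) None @ map Some ls)"
proof (induction cs arbitrary: F)
  case Nil
  have "row_transfer x as None (map Some ls) (Some k) G = 0" for G
    using assms(2) by (intro row_transfer_exit_absent) auto
  then show ?case
    using row_transfer_cross_all[OF assms] by simp
qed (simp add: mult.assoc)

text \<open>A single tiling contributes: in row \<open>i\<close> the first \<open>m - i\<close>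
  squares are empty, and the pipe \<open>m + 1 - i\<close> crosses everything east of it.\<close>

lemma schubert_sum_longest:
  "schubert_sum (int m) (longest_perm (int m)) =
    (\<Prod>(i, j)\<in>{(i, j). 1 \<le> i \<and> 1 \<le> j \<and> i + j \<le> int m}. x_var i - a_var j)"
proof -
  define wt :: "int \<Rightarrow> xa mpol" where "wt i = (\<Prod>j\<in>{1..int m - i}. x_var i - a_var j)" for i
  \<comment> \<open>With \<open>k\<close> rows left to read, the pipes \<open>1..m - k\<close> have
    gone and their columns are empty.\<close>
  have rows: "rows_transfer (map a_var [1..int m]) (map (\<lambda>i. (x_var i, Some (int m + 1 - i))) (rev [1..int k]))
      (replicate (m - k) None @ map Some [int (m - k) + 1..int m]) no_pipes = (\<Prod>i\<in>{1..int k}. wt i)"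
    if "k \<le> m" for k
    using that
  proof (induction k)
    case 0
    then show ?case by (auto simp: no_pipes_def)
  next
    case (Suc k)
    have rev: "rev [1..int (Suc k)] = int (Suc k) # rev [1..int k]"
      by (subst upto_rec2) auto
    let ?r = "m - Suc k"
    have split: "[1..int m] = [1..r] @ (r + 1) # [r + 2..int m]" if "0 \<le> r" "r < int m" for r
      using upto_split3[of 1 "r + 1" "int m"] that by (simp add: add.commute)
    have cols: "[1..int m] = [1..int ?r] @ (int ?r + 1) # [int ?r + 2..int m]"
      by (rule split) (use Suc.prems in auto)
    have split': "[r + 1..int m] = (r + 1) # [r + 2..int m]" if "r < int m" for r
      using upto_rec1[of "r + 1" "int m"] that by (simp add: add.commute)
    have bs: "[int ?r + 1..int m] = (int ?r + 1) # [int ?r + 2..int m]"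
      by (rule split') (use Suc.prems in auto)
    have e: "int m + 1 - int (Suc k) = int ?r + 1"
      using Suc.prems by auto
    have r: "Suc ?r = m - k" "int ?r + 2 = int (m - k) + 1"
      using Suc.prems by auto
    have len: "?r = length (map a_var [1..int ?r])"
      by simp
    have pr: "(\<Prod>c\<leftarrow>map a_var [1..int ?r]. x_var (int (Suc k)) - c) = wt (int (Suc k))"
    proof -
      have "(\<Prod>c\<leftarrow>map a_var [1..int ?r]. x_var (int (Suc k)) - c) =
          (\<Prod>j\<in>set [1..int ?r]. x_var (int (Suc k)) - a_var j)"
        by (subst prod.distinct_set_conv_list) (auto simp: comp_def)
      then show ?thesis
        using Suc.prems by (simp add: wt_def of_nat_diff algebra_simps)
    qed
    have "rows_transfer (map a_var [1..int m]) (map (\<lambda>i. (x_var i, Some (int m + 1 - i))) (rev [1..int (Suc k)]))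
        (replicate ?r None @ map Some [int ?r + 1..int m]) no_pipes =
       wt (int (Suc k)) * rows_transfer (map a_var [1..int m])
         (map (\<lambda>i. (x_var i, Some (int m + 1 - i))) (rev [1..int k]))
         (replicate (Suc ?r) None @ map Some [int ?r + 2..int m]) no_pipes"
      unfolding rev list.map rows_transfer.simps e bs
      using row_transfer_longest_row[of "[int ?r + 2..int m]" "map a_var [int ?r + 2..int m]" "int ?r + 1"
          "x_var (int (Suc k))" "map a_var [1..int ?r]" "a_var (int ?r + 1)"]
      unfolding pr
      by (subst cols) (simp del: replicate_Suc)
    also have "\<dots> = wt (int (Suc k)) * (\<Prod>i\<in>{1..int k}. wt i)"
      unfolding r using Suc by simp
    also have "\<dots> = (\<Prod>i\<in>{1..int (Suc k)}. wt i)"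
    proof -
      have "{1..int (Suc k)} = insert (int (Suc k)) {1..int k}" by auto
      then show ?thesis by simp
    qed
    finally show ?case by simp
  qed
  have eq: "map (\<lambda>i. (x_var i, Some (longest_perm (int m) i))) (rev [1..int m]) =
      map (\<lambda>i. (x_var i, Some (int m + 1 - i))) (rev [1..int m])"
    by (auto simp: longest_perm_def)
  have "schubert_sum (int m) (longest_perm (int m)) = (\<Prod>i\<in>{1..int m}. wt i)"
    unfolding pipe_sum_def eq using rows[of m] by simp
  also have "\<dots> = (\<Prod>(i, j)\<in>(SIGMA i:{1..int m}. {1..int m - i}). x_var i - a_var j)"
    by (simp add: wt_def prod.Sigma)
  also have "(SIGMA i:{1..int m}. {1..int m - i}) = {(i, j). 1 \<le> i \<and> 1 \<le> j \<and> i + j \<le> int m}"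
    by auto
  finally show ?thesis .
qed

section \<open>Length of permutations and chains of ascents up to the longest one\<close>

definition inversions :: "(int \<Rightarrow> int) \<Rightarrow> (int \<times> int) set" where
  "inversions v = {(i, j). i < j \<and> v j < v i}"

lemma perm_length_eq: "perm_length v = card (inversions v)"
  by (simp add: perm_length_def inversions_def)

lemma inversions_subset:
  assumes "v permutes {1..m}"
  shows "inversions v \<subseteq> {1..m} \<times> {1..m}"
proof safe
  fix i j assume "(i, j) \<in> inversions v"
  then have ij: "i < j" "v j < v i" by (auto simp: inversions_def)
  have v: "v k \<in> {1..m} \<longleftrightarrow> k \<in> {1..m}" "k \<notin> {1..m} \<Longrightarrow> v k = k" for k
    using permutes_in_image[OF assms] permutes_not_in[OF assms] by auto
  show "i \<in> {1..m}" "j \<in> {1..m}"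
    using ij v[of i] v[of j] by (force simp del: atLeastAtMost_iff | (simp, linarith))+
qed

lemma perm_length_ascent:
  assumes "v permutes {1..m}" "v i < v (i + 1)"
  shows "perm_length (v \<circ> transpose i (i + 1)) = Suc (perm_length v)"
proof -
  let ?t = "transpose i (i + 1)"
  have fin: "finite (inversions v)"
    by (rule finite_subset[OF inversions_subset[OF assms(1)]]) simp
  \<comment> \<open>Moving both positions by the transposition carries inversions to inversions;
    only the pair \<open>(i, i + 1)\<close> is new.\<close>
  have 1: "inversions (v \<circ> ?t) = insert (i, i + 1) (map_prod ?t ?t ` inversions v)"
  proof (intro equalityI subsetI)
    fix z assume "z \<in> inversions (v \<circ> ?t)"
    then obtain a b where z: "z = (a, b)" "a < b" "v (?t b) < v (?t a)"
      by (auto simp: inversions_def)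
    show "z \<in> insert (i, i + 1) (map_prod ?t ?t ` inversions v)"
    proof (cases "z = (i, i + 1)")
      case False
      then have "(?t a, ?t b) \<in> inversions v"
        using z by (auto simp: inversions_def transpose_def split: if_splits)
      then show ?thesis
        by (intro insertI2 image_eqI[of _ _ "(?t a, ?t b)"]) (auto simp: z)
    qed simp
  next
    fix z assume "z \<in> insert (i, i + 1) (map_prod ?t ?t ` inversions v)"
    then show "z \<in> inversions (v \<circ> ?t)"
      using assms(2) by (auto simp: inversions_def) (auto simp: transpose_def split: if_splits)
  qed
  have "inj_on (map_prod ?t ?t) (inversions v)"
    by (auto simp: inj_on_def dest: injD[OF inj_transpose])
  moreover have "(i, i + 1) \<notin> map_prod ?t ?t ` inversions v"
    by (auto simp: inversions_def transpose_def split: if_splits)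
  ultimately show ?thesis
    using fin by (simp add: perm_length_eq 1 card_image)
qed

lemma transpose_permutes: 
  assumes "v permutes {1..m}" "1 \<le> i" "i < m"
  shows "v \<circ> transpose i (i + 1) permutes {1..m::int}"
  by (rule permutes_compose[OF permutes_swap_id assms(1)]) (use assms in auto)

lemma perm_length_less_iff:
  assumes "v permutes {1..m}" "1 \<le> i" "i < m"
  shows "perm_length v < perm_length (v \<circ> transpose i (i + 1)) \<longleftrightarrow> v i < v (i + 1)"
proof
  assume less: "perm_length v < perm_length (v \<circ> transpose i (i + 1))"
  show "v i < v (i + 1)"
  proof (rule ccontr)
    assume "\<not> v i < v (i + 1)"
    then have "v (i + 1) < v i"
      using injD[OF permutes_inj[OF assms(1)], of i "i + 1"] by fastforce
    then show False
      using perm_length_ascent[OF transpose_permutes[OF assms], of i] less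
      by (simp add: comp_assoc)
  qed
qed (simp add: perm_length_ascent[OF assms(1)])

lemma longest_perm_permutes: "longest_perm m permutes {1..m}"
  by (rule bij_imp_permutes)
     (auto simp: longest_perm_def bij_betw_def inj_on_def image_iff intro!: bexI[of _ "m + 1 - _"])

text \<open>\<open>divdiff_schubert_sum\<close> holds at every ascent, so all chains of divided
  differences end in the same polynomial. This also gives the uniqueness that
  \<open>double_schubert\<close> asks for.\<close>

lemma is_double_schubert_imp:
  assumes "is_double_schubert m v f" "0 \<le> m"
  shows "v permutes {1..m} \<and> f = schubert_sum m v"
  using assms
proof induction
  case longest
  then show ?case
    using schubert_sum_longest[of "nat m"] longest_perm_permutes by simp
next
  case (descend v i f)
  then show ?case
    using divdiff_schubert_sum[of i m v] perm_length_less_iff[of v m i] by metis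
qed

text \<open>Without ascents, \<open>v i + i\<close> is weakly decreasing on \<open>1..m\<close>. It
  is at most \<open>m + 1\<close> at the left end and at least \<open>m + 1\<close> at the right
  end, hence constant.\<close>

lemma no_ascent_imp_longest:
  assumes "v permutes {1..m}" "\<And>i. 1 \<le> i \<Longrightarrow> i < m \<Longrightarrow> \<not> v i < v (i + 1)"
  shows "v = longest_perm m"
proof
  fix i
  have step: "v (i + 1) + (i + 1) \<le> v i + i" if "1 \<le> i" "i < m" for i
    using assms(2)[OF that] injD[OF permutes_inj[OF assms(1)], of i "i + 1"] by fastforce
  have mono: "v (i + int d) + (i + int d) \<le> v i + i" if "1 \<le> i" "i + int d \<le> m" for i d
    using that
  proof (induction d)
    case (Suc d)
    have eq: "i + int (Suc d) = i + int d + 1" by simp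
    have "1 \<le> i + int d" "i + int d < m" "i + int d \<le> m" using Suc.prems by auto
    then show ?case
      unfolding eq using Suc.IH Suc.prems(1) step[of "i + int d"] by linarith
  qed simp
  show "v i = longest_perm m i"
  proof (cases "i \<in> {1..m}")
    case True
    then have "v 1 \<in> {1..m}" "v m \<in> {1..m}"
      using permutes_in_image[OF assms(1)] by auto
    moreover have "v i + i \<le> v 1 + 1" "v m + m \<le> v i + i"
      using mono[of 1 "nat (i - 1)"] mono[of i "nat (m - i)"] True by auto
    ultimately show ?thesis
      using True by (simp add: longest_perm_def)
  next
    case False
    then show ?thesis
      using permutes_not_in[OF assms(1) False] by (auto simp: longest_perm_def)
  qed
qed

lemma is_double_schubert_exists:
  assumes "v permutes {1..m}"
  shows "\<exists>f. is_double_schubert m v f"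
  using assms
\<comment> \<open>The length grows along an ascent and is bounded by the number of pairs of
  positions.\<close>
proof (induction "card ({1..m} \<times> {1..m}) - perm_length v" arbitrary: v rule: less_induct)
  case less
  show ?case
  proof (cases "v = longest_perm m")
    case True
    then show ?thesis using is_double_schubert.longest by blast
  next
    case False
    then obtain i where i: "1 \<le> i" "i < m" "v i < v (i + 1)"
      using no_ascent_imp_longest[OF less.prems] by blast
    let ?u = "v \<circ> transpose i (i + 1)"
    have u: "?u permutes {1..m}"
      by (rule transpose_permutes[OF less.prems i(1,2)])
    have "perm_length v < perm_length ?u"
      using i perm_length_less_iff[OF less.prems] by simp
    moreover have "perm_length ?u \<le> card ({1..m} \<times> {1..m})"
      unfolding perm_length_eq by (rule card_mono[OF _ inversions_subset[OF u]]) simp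
    ultimately obtain f where "is_double_schubert m ?u f"
      using less.hyps[OF _ u] by force
    then show ?thesis
      using is_double_schubert.descend[OF less.prems i(1,2)] \<open>perm_length v < perm_length ?u\<close> by blast
  qed
qed

lemma double_schubert_eq:
  assumes "v permutes {1..m}" "0 \<le> m"
  shows "double_schubert m v = schubert_sum m v"
  unfolding double_schubert_def
  using is_double_schubert_exists[OF assms(1)] is_double_schubert_imp[OF _ assms(2)]
  by (intro the_equality) blast+

section \<open>Shifting labels, from \<open>1..m\<close> to an interval \<open>p..q\<close>\<close>

lemma row_transfer_relabel:
  assumes "strict_mono g"
  shows "row_transfer x as (map_option g h) (map (map_option g) bs) (map_option g e) F =
    row_transfer x as h bs e (\<lambda>ts. F (map (map_option g) ts))"
proof -
  have inj: "map_option g u = map_option g v \<longleftrightarrow> u = v" for u v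
    using option.inj_map[OF strict_mono_imp_inj_on[OF assms, of UNIV]] by (auto dest: injD)
  show ?thesis
    by (induction x as h bs e "\<lambda>ts. F (map (map_option g) ts)" arbitrary: F rule: row_transfer.induct)
      (simp_all add: inj strict_mono_less[OF assms])
qed

lemma rows_transfer_relabel:
  assumes "strict_mono g"
  shows "rows_transfer as (map (\<lambda>(x, e). (x, map_option g e)) rs) (map (map_option g) bs) F =
    rows_transfer as rs bs (\<lambda>ts. F (map (map_option g) ts))"
  by (induction as rs bs F rule: rows_transfer.induct)
    (auto simp: row_transfer_relabel[OF assms, of _ _ None, simplified])

lemma upto_shift: "[p + k..q + k] = map (\<lambda>i. i + k) [p..q :: int]"
  by (induction p q rule: upto.induct) (subst (1 2) upto.simps, simp add: algebra_simps)

lemma pipe_sum_shift: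
  "pipe_sum (p + k) (q + k) x a w =
     pipe_sum p q (\<lambda>i. x (i + k)) (\<lambda>i. a (i + k)) (shift_perm (- k) w)"
proof -
  have mono: "strict_mono (\<lambda>i :: int. i + k)"
    by (simp add: strict_mono_def)
  have np: "no_pipes (map (map_option (\<lambda>i. i + k)) ts) = (no_pipes ts :: 'a)" for ts
    by (auto simp: no_pipes_def subset_iff)
  have "pipe_sum (p + k) (q + k) x a w = rows_transfer (map (\<lambda>i. a (i + k)) [p..q])
      (map (\<lambda>(x, e). (x, map_option (\<lambda>i. i + k) e))
         (map (\<lambda>i. (x (i + k), Some (shift_perm (- k) w i))) (rev [p..q])))
      (map (map_option (\<lambda>i. i + k)) (map Some [p..q])) no_pipes"
    by (simp add: pipe_sum_def upto_shift comp_def rev_map shift_perm_def)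
  also have "\<dots> = pipe_sum p q (\<lambda>i. x (i + k)) (\<lambda>i. a (i + k)) (shift_perm (- k) w)"
    unfolding rows_transfer_relabel[OF mono] by (simp add: pipe_sum_def np)
  finally show ?thesis .
qed

lemma double_schubert_interval_eq:
  assumes "w permutes {p..q}" "p \<le> q"
  shows "double_schubert_interval p q w = pipe_sum p q x_var a_var w"
proof -
  have hom: "comm_ring_hom (shift_pol (p - 1))"
    unfolding shift_pol_def by (rule msubst_hom[OF mconst_hom])
  have var: "shift_pol (p - 1) (x_var i) = x_var (i + (p - 1))"
    "shift_pol (p - 1) (a_var i) = a_var (i + (p - 1))" for i
    by (simp_all add: shift_pol_def msubst_mvar[OF mconst_hom])
  have "shift_perm (1 - p) w permutes {1..q - p + 1}"
  proof (rule bij_imp_permutes)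
    have w: "bij_betw w {p..q} {p..q}"
      by (rule permutes_imp_bij[OF assms(1)])
    have "bij_betw (\<lambda>i. i + (p - 1)) {1..q - p + 1} {p..q}"
      by (rule bij_betw_byWitness[of _ "\<lambda>i. i - (p - 1)"]) auto
    moreover have "bij_betw (\<lambda>i. i + (1 - p)) {p..q} {1..q - p + 1}"
      by (rule bij_betw_byWitness[of _ "\<lambda>i. i - (1 - p)"]) auto
    ultimately have "bij_betw ((\<lambda>i. i + (1 - p)) \<circ> w \<circ> (\<lambda>i. i + (p - 1))) {1..q - p + 1} {1..q - p + 1}"
      using w by (blast intro: bij_betw_trans)
    moreover have "(\<lambda>i. i + (1 - p)) \<circ> w \<circ> (\<lambda>i. i + (p - 1)) = shift_perm (1 - p) w"
      by (simp add: shift_perm_def fun_eq_iff algebra_simps)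
    ultimately show "bij_betw (shift_perm (1 - p) w) {1..q - p + 1} {1..q - p + 1}"
      by simp
    show "shift_perm (1 - p) w i = i" if "i \<notin> {1..q - p + 1}" for i
      using that permutes_not_in[OF assms(1), of "i - (1 - p)"] by (auto simp: shift_perm_def)
  qed
  then have "double_schubert_interval p q w =
      pipe_sum 1 (q - p + 1) (\<lambda>i. x_var (i + (p - 1))) (\<lambda>i. a_var (i + (p - 1))) (shift_perm (- (p - 1)) w)"
    using assms(2)
    by (simp add: double_schubert_interval_def double_schubert_eq pipe_sum_hom[OF hom] var)
  then show ?thesis
    using pipe_sum_shift[of 1 "p - 1" "q - p + 1" x_var a_var w] by simp
qed

section \<open>Cutting the square\<close>

fun labels :: "lab list \<Rightarrow> int list" where
  "labels [] = []"
| "labels (None # ts) = labels ts"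
| "labels (Some k # ts) = k # labels ts"

lemma labels_append [simp]: "labels (ts @ us) = labels ts @ labels us"
  by (induction ts rule: labels.induct) auto

lemma labels_map_Some [simp]: "labels (map Some ls) = ls"
  by (induction ls) auto

lemma labels_empty_iff: "labels ts = [] \<longleftrightarrow> set ts \<subseteq> {None}"
  by (induction ts rule: labels.induct) auto

text \<open>Read from left to right along the row, the labels change only by crossings, and a crossing
  exchanges two neighbouring labels in increasing order.\<close>

lemma row_transfer_vanish:
  assumes "\<And>u v k l. Bad (u @ k # l # v) \<Longrightarrow> k < l \<Longrightarrow> Bad (u @ l # k # v)"
    and "\<And>ts. Bad (pre @ labels ts @ labels [e]) \<Longrightarrow> F ts = 0"
    and "Bad (pre @ labels [h] @ labels bs)"
  shows "row_transfer x as h bs e F = 0"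
  using assms(2,3)
proof (induction x as h bs e F arbitrary: pre rule: row_transfer.induct)
  case (2 x a as k bs e F)
  show ?case
    using 2(1)[of "pre @ [k]"] 2(2)[of pre] 2(3)[of "Some k # _"] 2(3)[of "None # _"] 2(4) by simp
next
  case (3 x a as k bs e F)
  show ?case
    using 3(2)[of "pre @ [k]"] 3(1)[of pre] 3(3)[of "Some k # _"] 3(3)[of "None # _"] 3(4) by simp
next
  case (4 x a as k l bs e F)
  show ?case
    using 4(1)[of "pre @ [l]"] 4(2)[of "Some l # _"] 4(3) assms(1)[of pre k l "labels bs"] by simp
next
  case (1 x a as bs e F)
  show ?case
    using 1(1)[of pre] 1(2)[of "None # _"] 1(3) by simp
qed auto

text \<open>The label leaving in the east is the last letter of the word of its row and is missing
  in the next row; hence \<open>Bad\<close> also has to survive the removal of such a final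
  letter.\<close>

lemma rows_transfer_vanish:
  assumes "\<And>u v k l. Bad (u @ k # l # v) \<Longrightarrow> k < l \<Longrightarrow> Bad (u @ l # k # v)"
    and "\<And>u e. e \<in> snd ` set rs \<Longrightarrow> Bad (u @ labels [e]) \<Longrightarrow> Bad u"
    and "\<And>ts. Bad (labels ts) \<Longrightarrow> F ts = 0"
    and "Bad (labels bs)"
  shows "rows_transfer as rs bs F = 0"
  using assms(2-)
proof (induction as rs bs F rule: rows_transfer.induct)
  case (2 as x e rs bs F)
  have "rows_transfer as rs ts F = 0" if "Bad (labels ts @ labels [e])" for ts
  proof (rule "2.IH")
    show "Bad u" if "e' \<in> snd ` set rs" "Bad (u @ labels [e'])" for u e'
      using 2(2)[of e' u] that by auto
    show "Bad (labels ts)"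
      using 2(2)[of e "labels ts"] that by simp
  qed (rule 2(3))
  then show ?case
    using row_transfer_vanish[of Bad "[]" e "\<lambda>ts. rows_transfer as rs ts F" None bs x as] assms(1) 2(4) by simp
qed auto

text \<open>A nonpositive label to the right of a larger one can never return to its place.\<close>

fun blocked :: "int list \<Rightarrow> bool" where
  "blocked [] = False"
| "blocked (l # w) = ((\<exists>j\<in>set w. j < l \<and> j \<le> 0) \<or> blocked w)"

lemma blocked_append:
  "blocked (u @ v) \<longleftrightarrow> blocked u \<or> blocked v \<or> (\<exists>l\<in>set u. \<exists>j\<in>set v. j < l \<and> j \<le> 0)"
  by (induction u) auto

lemma blocked_swap: "blocked (u @ k # l # v) \<Longrightarrow> k < l \<Longrightarrow> blocked (u @ l # k # v)"
  by (auto simp: blocked_append)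

lemma blocked_sorted: "sorted_wrt (<) w \<Longrightarrow> \<not> blocked w"
  by (induction w) auto

text \<open>If a pipe \<open>j\<close> of \<open>js\<close> turned east, it would be crossed in the
  next column by a larger pipe, which then stands west of it. The word is blocked from there on, and
  the positive exit label \<open>e\<close> does not repair this. For the last pipe of
  \<open>js\<close>, the pipe \<open>m\<close> plays the part of the larger neighbour.\<close>

lemma row_transfer_frozen:
  assumes "sorted_wrt (<) (js @ [m])" "\<forall>j\<in>set js. j \<le> 0" "0 < e" "length as1 = length js"
    and "\<And>ts. blocked (labels ts) \<Longrightarrow> F ts = 0"
  shows "row_transfer x (as1 @ as2) None (map Some js @ Some m # bs) (Some e) F =
    row_transfer x as2 None (Some m # bs) (Some e) (\<lambda>ts. F (map Some js @ ts))"
  using assms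
proof (induction js arbitrary: as1 F)
  case (Cons j js)
  then obtain a as1' where as1: "as1 = a # as1'" by (cases as1) auto
  obtain j' bs' where j': "map Some js @ Some m # bs = Some j' # bs'" "j < j'"
    using Cons.prems(1) by (cases js) auto
  have "row_transfer x (as1' @ as2) (Some j) (map Some js @ Some m # bs) (Some e) (\<lambda>ts. F (None # ts)) = 0"
  proof (cases "as1' @ as2")
    case (Cons a' as')
    have "row_transfer x as' (Some j) bs' (Some e) (\<lambda>ts. F (None # Some j' # ts)) = 0"
      by (rule row_transfer_vanish[of blocked "[j']"])
         (use Cons.prems j' \<open>0 < e\<close> in \<open>auto intro: blocked_swap simp: blocked_append\<close>)
    then show ?thesis
      by (simp add: j' Cons)
  qed (simp add: j')
  moreover have "row_transfer x (as1' @ as2) None (map Some js @ Some m # bs) (Some e) (\<lambda>ts. F (Some j # ts)) =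
      row_transfer x as2 None (Some m # bs) (Some e) (\<lambda>ts. F (Some j # map Some js @ ts))"
    by (rule Cons.IH) (use Cons.prems as1 in auto)
  ultimately show ?case
    by (simp add: as1)
qed simp

text \<open>\<open>ms\<close> provides one nonpositive guard per row. A row can move at most the
  easternmost guard still in place, which is the \<open>m\<close> of
  \<open>row_transfer_frozen\<close>; the others stay vertical and protect \<open>js\<close> in the
  rows above.\<close>

lemma rows_transfer_frozen:
  assumes "sorted_wrt (<) (js @ ms)" "\<forall>j\<in>set (js @ ms). j \<le> 0" "length rs = length ms"
    and "\<forall>e\<in>snd ` set rs. \<exists>k>0. e = Some k"
    and "length as1 = length js" "length ms \<le> length as2"
    and "\<And>ts. blocked (labels ts) \<Longrightarrow> F ts = 0"
  shows "rows_transfer (as1 @ as2) rs (map Some js @ map Some ms @ bs) F =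
    rows_transfer as2 rs (map Some ms @ bs) (\<lambda>ts. F (map Some js @ ts))"
  using assms
proof (induction rs arbitrary: ms bs)
  case (Cons r rs)
  obtain x e where r: "r = (x, Some e)" "0 < e"
    using Cons.prems(4) by (cases r) auto
  obtain ms1 m where ms: "ms = ms1 @ [m]"
    using Cons.prems(3) by (cases ms rule: rev_cases) auto
  obtain as2' as3 where as2: "as2 = as2' @ as3" "length as2' = length ms1"
    using Cons.prems(6) ms by (metis append_take_drop_id length_append length_take le_add1 min.absorb2 order_trans)
  let ?F' = "\<lambda>ts. F (map Some js @ ts)"
  have van: "rows_transfer as rs ts G = 0"
    if "blocked (labels ts)" "\<And>ts. blocked (labels ts) \<Longrightarrow> G ts = 0" for as ts and G :: "lab list \<Rightarrow> 'a"
    by (rule rows_transfer_vanish[of blocked])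
       (use Cons.prems(4) that in \<open>auto intro: blocked_swap simp: blocked_append\<close>)
  have IH: "rows_transfer (as1 @ as2) rs (map Some js @ map Some ms1 @ ts) F = rows_transfer as2 rs (map Some ms1 @ ts) ?F'"
    for ts
    by (rule Cons.IH) (use Cons.prems ms in \<open>auto simp: sorted_wrt_append\<close>)
  have "rows_transfer (as1 @ as2) (r # rs) (map Some js @ map Some ms @ bs) F =
      row_transfer x ((as1 @ as2') @ as3) None (map Some (js @ ms1) @ Some m # bs) (Some e)
        (\<lambda>ts. rows_transfer (as1 @ as2) rs ts F)"
    by (simp add: r ms as2)
  also have "\<dots> = row_transfer x as3 None (Some m # bs) (Some e)
      (\<lambda>ts. rows_transfer (as1 @ as2) rs (map Some (js @ ms1) @ ts) F)"
    by (rule row_transfer_frozen) (use Cons.prems r ms as2 van in auto)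
  also have "\<dots> = row_transfer x as3 None (Some m # bs) (Some e) (\<lambda>ts. rows_transfer as2 rs (map Some ms1 @ ts) ?F')"
    using IH by simp
  \<comment> \<open>The same freezing read backwards, in the narrower grid without the columns of
    \<open>js\<close>.\<close>
  also have "\<dots> = row_transfer x (as2' @ as3) None (map Some ms1 @ Some m # bs) (Some e) (\<lambda>ts. rows_transfer as2 rs ts ?F')"
    by (rule row_transfer_frozen[symmetric])
       (use Cons.prems r ms as2 van in \<open>auto simp: sorted_wrt_append blocked_append\<close>)
  also have "\<dots> = rows_transfer as2 (r # rs) (map Some ms @ bs) ?F'"
    by (simp add: r ms as2)
  finally show ?case .
qed simp

section \<open>The rows below the rectangle\<close>

lemma row_transfer_last_None:
  assumes "length bs = length as"
  shows "row_transfer x (as @ [a]) h (bs @ [None]) (Some e) F = row_transfer x as h bs (Some e) (\<lambda>ts. F (ts @ [None]))"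
  using assms
proof (induction as arbitrary: bs h F)
  case Nil
  then show ?case by (cases h) auto
next
  case (Cons a as)
  then obtain b bs' where "bs = b # bs'" by (cases bs) auto
  with Cons show ?case by (cases h; cases b) auto
qed

lemma rows_transfer_last_None:
  assumes "length bs = length as" "\<forall>e\<in>snd ` set rs. e \<noteq> None"
  shows "rows_transfer (as @ [a]) rs (bs @ [None]) F = rows_transfer as rs bs (\<lambda>ts. F (ts @ [None]))"
  using assms
proof (induction rs arbitrary: bs)
  case (Cons r rs)
  then obtain x e where r: "r = (x, Some e)" by (cases r) auto
  have "row_transfer x as None bs (Some e) (\<lambda>ts. rows_transfer (as @ [a]) rs (ts @ [None]) F) =
      row_transfer x as None bs (Some e) (\<lambda>ts. rows_transfer as rs ts (\<lambda>ts. F (ts @ [None])))"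
    by (rule row_transfer_cong) (use Cons in auto)
  then show ?case
    using row_transfer_last_None[OF Cons.prems(1)] by (simp add: r)
qed simp

lemma row_transfer_cross_stuck:
  assumes "e \<noteq> Some k"
  shows "row_transfer x as (Some k) (map Some ls) e F = 0"
  using assms
proof (induction ls arbitrary: as F)
  case Nil
  then show ?case by (cases as) auto
next
  case (Cons l ls)
  then show ?case by (cases as) auto
qed

lemma row_transfer_last_exit:
  assumes "length as = length ls" "k \<notin> set ls"
  shows "row_transfer x (as @ [a]) None (map Some (ls @ [k])) (Some k) F = F (map Some ls @ [None])"
  using assms
proof (induction ls arbitrary: as F)
  case (Cons l ls)
  then obtain b as' where as: "as = b # as'" by (cases as) auto
  show ?case
    using Cons row_transfer_cross_stuck[of "Some k" l x "as' @ [a]" "ls @ [k]"] by (simp add: as)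
qed simp

text \<open>In the bottom row every column carries a pipe, so a pipe that turns east can only cross
  and stays in the row to its end. As \<open>q\<close> is the exit label, only the last pipe turns.
  In the rows above, the last column has no pipe of its own and is passed horizontally, with weight
  1.\<close>

lemma pipe_sum_drop_last:
  assumes "p \<le> q" "w q = q"
  shows "pipe_sum p q x a w = pipe_sum p (q - 1) x a w"
proof -
  have q: "[p..q] = [p..q - 1] @ [q]"
    using upto_rec2[OF assms(1)] .
  have np: "no_pipes (ts @ [None]) = (no_pipes ts :: 'a)" for ts
    by (simp add: no_pipes_def)
  have "pipe_sum p q x a w = rows_transfer (map a [p..q - 1] @ [a q])
      (map (\<lambda>i. (x i, Some (w i))) (rev [p..q - 1])) (map Some [p..q - 1] @ [None]) no_pipes"
    unfolding pipe_sum_def q using assms(2) row_transfer_last_exit[of "map a [p..q - 1]" "[p..q - 1]" q] by simp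
  also have "\<dots> = pipe_sum p (q - 1) x a w"
    by (subst rows_transfer_last_None) (auto simp: pipe_sum_def np)
  finally show ?thesis .
qed

lemma pipe_sum_drop:
  assumes "p \<le> n + 1" "\<And>i. n < i \<Longrightarrow> w i = i"
  shows "pipe_sum p (n + int d) x a w = pipe_sum p n x a w"
proof (induction d)
  case (Suc d)
  show ?case
    using pipe_sum_drop_last[of p "n + int (Suc d)" w x a] assms(1) assms(2)[of "n + int (Suc d)"] Suc by simp
qed simp

section \<open>The order of the pipes above the rectangle\<close>

definition top_rows :: "int \<Rightarrow> int \<Rightarrow> (int \<Rightarrow> 'r) \<Rightarrow> 'r list \<Rightarrow> lab list \<Rightarrow> 'r::comm_ring_1" where
  "top_rows p k x as ts = rows_transfer as (map (\<lambda>i. (x i, Some i)) (rev [p..k])) ts no_pipes"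

lemma top_rows_Nil: "top_rows p (p - 1) x as ts = no_pipes ts"
  by (simp add: top_rows_def)

lemma top_rows_step:
  assumes "p \<le> k"
  shows "top_rows p k x as ts = row_transfer (x k) as None ts (Some k) (top_rows p (k - 1) x as)"
  unfolding top_rows_def upto_rec2[OF assms] by (simp add: top_rows_def)

text \<open>A crossing places a larger label before a smaller one and so never produces
  \<open>[p..k]\<close>: a word that differs from it stays different.\<close>

lemma top_rows_vanish:
  assumes "p - 1 \<le> k" "labels ts \<noteq> [p..k]"
  shows "top_rows p k x as ts = 0"
  using assms
proof (induction "nat (k - p + 1)" arbitrary: k ts)
  case 0
  then have "k = p - 1" by simp
  with 0 show ?case
    by (simp add: top_rows_Nil no_pipes_def flip: labels_empty_iff)
next
  case (Suc d)
  then have k: "p \<le> k" "[p..k] = [p..k - 1] @ [k]"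
    using upto_rec2[of p k] by auto
  show ?case
    unfolding top_rows_step[OF k(1)]
  proof (rule row_transfer_vanish[of "\<lambda>w. w \<noteq> [p..k]" "[]"])
    fix u v :: "int list" and i j :: int
    assume "i < j"
    then have "\<not> sorted_wrt (<) (u @ j # i # v)"
      by (auto simp: sorted_wrt_append)
    then show "u @ j # i # v \<noteq> [p..k]"
      using sorted_wrt_upto by metis
  next
    fix ts assume "[] @ labels ts @ labels [Some k] \<noteq> [p..k]"
    then show "top_rows p (k - 1) x as ts = 0"
      using Suc(1)[of "k - 1" ts] Suc(2) k by simp
  next
    show "[] @ labels [None] @ labels ts \<noteq> [p..k]"
      using Suc.prems by simp
  qed
qed

lemma upto_append: "i \<le> j + 1 \<Longrightarrow> j \<le> k \<Longrightarrow> [i..k] = [i..j] @ [j + 1..k]"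
  using upto_split2[of i j k] by (cases "i = j + 1") auto

text \<open>The \<open>n\<close> pipes \<open>1 - n..0\<close> are the guards for the
  \<open>n\<close> rows \<open>1..n\<close>. Blocked words contribute 0 because the upper part needs
  its labels in the order \<open>p..0\<close>.\<close>

lemma pipe_sum_cut:
  assumes "w permutes {1..int n}" "p \<le> 1 - int n"
  shows "pipe_sum p (int n) x a w =
    rows_transfer (map a [1 - int n..int n]) (map (\<lambda>i. (x i, Some (w i))) (rev [1..int n]))
      (map Some [1 - int n..int n])
      (\<lambda>ts. top_rows p 0 x (map a [p..int n]) (map Some [p..- int n] @ ts))"
proof -
  have s1: "[p..int n] = [p..- int n] @ [1 - int n..0] @ [1..int n]"
    using upto_append[of p "- int n" "int n"] upto_append[of "1 - int n" 0 "int n"] assms(2) by simp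
  have s2: "[p..int n] = [p..0] @ [1..int n]"
    using upto_append[of p 0 "int n"] assms(2) by simp
  have s3: "[1 - int n..int n] = [1 - int n..0] @ [1..int n]"
    using upto_append[of "1 - int n" 0 "int n"] by simp
  have w_id: "map (\<lambda>i. (x i, Some (w i))) (rev [p..0]) = map (\<lambda>i. (x i, Some i)) (rev [p..0])"
    using permutes_not_in[OF assms(1)] by simp
  have "pipe_sum p (int n) x a w = rows_transfer (map a [p..int n])
      (map (\<lambda>i. (x i, Some (w i))) (rev [1..int n])) (map Some [p..int n])
      (top_rows p 0 x (map a [p..int n]))"
    unfolding pipe_sum_def
    by (subst (2) s2) (simp only: rev_append map_append rows_transfer_append w_id top_rows_def[abs_def])
  also have "\<dots> = rows_transfer (map a [p..- int n] @ map a [1 - int n..int n])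
      (map (\<lambda>i. (x i, Some (w i))) (rev [1..int n]))
      (map Some [p..- int n] @ map Some [1 - int n..0] @ map Some [1..int n])
      (top_rows p 0 x (map a [p..int n]))"
    using s1 s3 by simp
  also have "\<dots> = rows_transfer (map a [1 - int n..int n]) (map (\<lambda>i. (x i, Some (w i))) (rev [1..int n]))
      (map Some [1 - int n..0] @ map Some [1..int n])
      (\<lambda>ts. top_rows p 0 x (map a [p..int n]) (map Some [p..- int n] @ ts))"
  proof (rule rows_transfer_frozen)
    have "[p..- int n] @ [1 - int n..0] = [p..0]"
      using upto_append[of p "- int n" 0] assms(2) by simp
    then show "sorted_wrt (<) ([p..- int n] @ [1 - int n..0])"
      by simp
    show "\<forall>e\<in>snd ` set (map (\<lambda>i. (x i, Some (w i))) (rev [1..int n])). \<exists>k>0. e = Some k"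
      using permutes_in_image[OF assms(1)] by force
    show "top_rows p 0 x (map a [p..int n]) ts = 0" if "blocked (labels ts)" for ts
    proof (rule top_rows_vanish)
      show "labels ts \<noteq> [p..0]"
        using that blocked_sorted[of "[p..0]"] by auto
    qed (use assms(2) in simp)
  qed auto
  also have "map Some [1 - int n..0] @ map Some [1..int n] = map Some [1 - int n..int n]"
    using s3 by simp
  finally show ?thesis .
qed

section \<open>The rows above the rectangle\<close>

context
  fixes emb :: "rat \<Rightarrow> 'r::comm_ring_1"
  assumes emb: "comm_ring_hom emb"
begin

interpretation emb: comm_ring_hom emb by (rule emb)

text \<open>The ring may have zero divisors, but \<open>emb\<close> supplies an inverse of
  \<open>Suc r\<close>.\<close>

lemma of_nat_cancel:
  assumes "of_nat (Suc r) * u = of_nat (Suc r) * (v :: 'r)"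
  shows "u = v"
proof -
  have inv: "emb (1 / of_nat (Suc r)) * of_nat (Suc r) = 1"
    by (simp flip: emb.hom_of_nat emb.hom_mult del: of_nat_Suc)
  have "emb (1 / of_nat (Suc r)) * (of_nat (Suc r) * u) = emb (1 / of_nat (Suc r)) * (of_nat (Suc r) * v)"
    by (simp only: assms)
  then show ?thesis
    unfolding mult.assoc[symmetric] inv by simp
qed

lemma complete_sym_newton:
  "of_nat (Suc r) * complete_sym emb P (Suc r) = (\<Sum>k\<le>r. P (Suc k) * complete_sym emb P (r - k))"
proof -
  have "of_nat (Suc r) * emb (1 / of_nat (Suc r)) = 1"
    by (simp flip: emb.hom_of_nat emb.hom_mult del: of_nat_Suc)
  then show ?thesis
    by (simp add: mult.assoc[symmetric] del: of_nat_Suc)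
qed

text \<open>A new variable \<open>x\<close> multiplies the generating function by
  \<open>1 / (1 - x * u)\<close>. As \<open>P\<close> is an arbitrary sequence, the proof goes
  through Newton's identities: after multiplication by the degree \<open>r\<close>, the part with
  \<open>P\<close> gives the \<open>i\<close>-th summand the weight \<open>r - i\<close>, and the
  part with \<open>x\<close> gives it the weight \<open>i\<close>.\<close>

lemma complete_sym_add_power_sum:
  "complete_sym emb (\<lambda>k. P k + x ^ k) r = (\<Sum>i\<le>r. x ^ i * complete_sym emb P (r - i))"
proof (induction r rule: less_induct)
  case (less r)
  show ?case
  proof (cases r)
    case (Suc r')
    let ?G = "complete_sym emb P"
    \<comment> \<open>Both sides run over all triples of indices with sum \<open>r'\<close>.\<close>
    have conv: "(\<Sum>k\<le>r'. f (Suc k) * (\<Sum>i\<le>r' - k. g i * h (r' - k - i))) =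
        (\<Sum>i\<le>r'. g i * (\<Sum>k\<le>r' - i. f (Suc k) * h (r' - i - k)))" for f g h :: "nat \<Rightarrow> 'r"
    proof -
      have "(\<Sum>k\<le>r'. f (Suc k) * (\<Sum>i\<le>r' - k. g i * h (r' - k - i))) =
          (\<Sum>(k, i)\<in>(SIGMA k:{..r'}. {..r' - k}). f (Suc k) * g i * h (r' - k - i))"
        by (simp add: sum_distrib_left sum.Sigma mult.assoc)
      also have "\<dots> = (\<Sum>(i, k)\<in>(SIGMA i:{..r'}. {..r' - i}). f (Suc k) * g i * h (r' - k - i))"
        by (rule sum.reindex_bij_witness[of _ prod.swap prod.swap]) auto
      also have "\<dots> = (\<Sum>i\<le>r'. g i * (\<Sum>k\<le>r' - i. f (Suc k) * h (r' - i - k)))"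
        by (simp add: sum_distrib_left sum.Sigma ac_simps diff_commute)
      finally show ?thesis .
    qed
    have "of_nat (Suc r') * complete_sym emb (\<lambda>k. P k + x ^ k) r =
        (\<Sum>k\<le>r'. (P (Suc k) + x ^ Suc k) * (\<Sum>i\<le>r' - k. x ^ i * ?G (r' - k - i)))"
      using less by (subst Suc, subst complete_sym_newton) (simp add: Suc)
    also have "\<dots> = (\<Sum>k\<le>r'. P (Suc k) * (\<Sum>i\<le>r' - k. x ^ i * ?G (r' - k - i))) +
        (\<Sum>k\<le>r'. x ^ Suc k * (\<Sum>i\<le>r' - k. x ^ i * ?G (r' - k - i)))"
      by (simp only: distrib_right sum.distrib)
    also have "(\<Sum>k\<le>r'. P (Suc k) * (\<Sum>i\<le>r' - k. x ^ i * ?G (r' - k - i))) =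
        (\<Sum>i\<le>r'. x ^ i * (of_nat (Suc r' - i) * ?G (Suc r' - i)))"
      unfolding conv
    proof (rule sum.cong[OF refl])
      fix i assume "i \<in> {..r'}"
      then have i: "Suc r' - i = Suc (r' - i)" by auto
      show "x ^ i * (\<Sum>k\<le>r' - i. P (Suc k) * ?G (r' - i - k)) = x ^ i * (of_nat (Suc r' - i) * ?G (Suc r' - i))"
        unfolding i complete_sym_newton ..
    qed
    also have "\<dots> = (\<Sum>i\<le>Suc r'. of_nat (Suc r' - i) * (x ^ i * ?G (Suc r' - i)))"
      by (simp add: algebra_simps)
    also have "(\<Sum>k\<le>r'. x ^ Suc k * (\<Sum>i\<le>r' - k. x ^ i * ?G (r' - k - i))) =
        (\<Sum>m\<le>Suc r'. of_nat m * (x ^ m * ?G (Suc r' - m)))"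
    proof -
      have "(\<Sum>k\<le>r'. x ^ Suc k * (\<Sum>i\<le>r' - k. x ^ i * ?G (r' - k - i))) =
          (\<Sum>(k, i)\<in>(SIGMA k:{..r'}. {..r' - k}). x ^ (Suc k + i) * ?G (r' - k - i))"
        by (simp add: sum_distrib_left sum.Sigma mult.assoc power_add)
      also have "\<dots> = (\<Sum>(m, k)\<in>(SIGMA m:{..Suc r'}. {..<m}). x ^ m * ?G (Suc r' - m))"
        by (rule sum.reindex_bij_witness
            [of _ "\<lambda>(m, k). (k, m - Suc k)" "\<lambda>(k, i). (Suc k + i, k)"]) auto
      also have "\<dots> = (\<Sum>m\<le>Suc r'. of_nat m * (x ^ m * ?G (Suc r' - m)))"
        by (simp add: sum.Sigma[symmetric])
      finally show ?thesis .
    qed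
    also have "(\<Sum>i\<le>Suc r'. of_nat (Suc r' - i) * (x ^ i * ?G (Suc r' - i))) +
        (\<Sum>m\<le>Suc r'. of_nat m * (x ^ m * ?G (Suc r' - m))) =
        (\<Sum>i\<le>Suc r'. of_nat (Suc r') * (x ^ i * ?G (Suc r' - i)))"
      unfolding sum.distrib[symmetric]
      by (rule sum.cong) (auto simp flip: distrib_right of_nat_add)
    finally have "of_nat (Suc r') * complete_sym emb (\<lambda>k. P k + x ^ k) r =
        of_nat (Suc r') * (\<Sum>i\<le>r. x ^ i * ?G (r - i))"
      unfolding Suc sum_distrib_left .
    then show ?thesis
      by (rule of_nat_cancel)
  qed simp
qed

text \<open>Multiplying the new generating function by \<open>1 - x * u\<close> gives back the old
  one.\<close>

lemma complete_sym_add_var: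
  "complete_sym emb (\<lambda>k. P k + x ^ k) (Suc r) =
     complete_sym emb P (Suc r) + x * complete_sym emb (\<lambda>k. P k + x ^ k) r"
  unfolding complete_sym_add_power_sum
  by (subst sum.atMost_Suc_shift) (simp add: sum_distrib_left mult_ac)

end

text \<open>The coefficient of \<open>u\<^sup>r\<close> in
  \<open>(\<Prod>i\<in>{p..c}. 1 - a i * u) / (\<Prod>i\<in>{p..k}. 1 - x i * u)\<close>.\<close>

definition super_complete :: "(rat \<Rightarrow> 'r::comm_ring_1) \<Rightarrow> (int \<Rightarrow> 'r) \<Rightarrow> (int \<Rightarrow> 'r) \<Rightarrow> int \<Rightarrow> int \<Rightarrow> int \<Rightarrow> int \<Rightarrow> 'r" where
  "super_complete emb x a p k c r = (if r < 0 then 0 else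
     complete_sym emb (\<lambda>m. (\<Sum>i\<in>{p..k}. x i ^ m) - (\<Sum>i\<in>{p..c}. a i ^ m)) (nat r))"

text \<open>Equivalently, the coefficient of \<open>z\<close> to the power \<open>- j - 1\<close> in the expansion at infinity of
  \<open>(\<Prod>l\<in>{p..b - 1}. z - a l) / (\<Prod>l\<in>{p..k}. z - x l)\<close>.\<close>

definition schur_entry :: "(rat \<Rightarrow> 'r::comm_ring_1) \<Rightarrow> (int \<Rightarrow> 'r) \<Rightarrow> (int \<Rightarrow> 'r) \<Rightarrow> int \<Rightarrow> int \<Rightarrow> int \<Rightarrow> nat \<Rightarrow> 'r" where
  "schur_entry emb x a p k b j = super_complete emb x a p k (b - 1) (b - k + int j)"

lemma atLeastAtMost_top: "p \<le> k \<Longrightarrow> {p..k} = insert k {p..k - 1}" for k :: int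
  by auto

locale schur_entries =
  fixes emb :: "rat \<Rightarrow> 'r::comm_ring_1" and x a :: "int \<Rightarrow> 'r" and p :: int
  assumes emb: "comm_ring_hom emb"
begin

abbreviation (input) "hx \<equiv> super_complete emb x a p"
abbreviation (input) "ent \<equiv> schur_entry emb x a p"

lemma super_complete_add_x:
  assumes "p \<le> k"
  shows "hx k c r = hx (k - 1) c r + x k * hx k c (r - 1)"
proof (cases "r \<le> 0")
  case True
  then show ?thesis by (cases "r = 0") (auto simp: super_complete_def)
next
  case False
  then obtain s where "r = int (Suc s)"
    by (metis gr0_conv_Suc not_le zero_less_imp_eq_int of_nat_0_less_iff)
  then have r: "nat r = Suc s" "nat (r - 1) = s" "\<not> r < 0" "\<not> r < 1"
    by auto
  have "(\<lambda>m. (\<Sum>i\<in>{p..k}. x i ^ m) - (\<Sum>i\<in>{p..c}. a i ^ m)) =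
      (\<lambda>m. ((\<Sum>i\<in>{p..k - 1}. x i ^ m) - (\<Sum>i\<in>{p..c}. a i ^ m)) + x k ^ m)"
    using assms by (simp add: atLeastAtMost_top algebra_simps)
  then show ?thesis
    using complete_sym_add_var[OF emb, of _ "x k" s] by (simp add: super_complete_def r del: complete_sym.simps)
qed

lemma super_complete_add_a:
  assumes "p \<le> c"
  shows "hx k c r = hx k (c - 1) r - a c * hx k (c - 1) (r - 1)"
proof (cases "r \<le> 0")
  case True
  then show ?thesis by (cases "r = 0") (auto simp: super_complete_def)
next
  case False
  then obtain s where "r = int (Suc s)"
    by (metis gr0_conv_Suc not_le zero_less_imp_eq_int of_nat_0_less_iff)
  then have r: "nat r = Suc s" "nat (r - 1) = s" "\<not> r < 0" "\<not> r < 1"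
    by auto
  have "(\<lambda>m. (\<Sum>i\<in>{p..k}. x i ^ m) - (\<Sum>i\<in>{p..c - 1}. a i ^ m)) =
      (\<lambda>m. ((\<Sum>i\<in>{p..k}. x i ^ m) - (\<Sum>i\<in>{p..c}. a i ^ m)) + a c ^ m)"
    using assms by (simp add: atLeastAtMost_top algebra_simps)
  then show ?thesis
    using complete_sym_add_var[OF emb, of _ "a c" s] by (simp add: super_complete_def r del: complete_sym.simps)
qed

text \<open>Without \<open>x\<close> the generating function is a product of \<open>d\<close> linear
  factors in \<open>u\<close>, hence a polynomial of degree at most \<open>d\<close>.\<close>

lemma super_complete_no_x:
  assumes "int d < r"
  shows "hx (p - 1) (p - 1 + int d) r = 0"
  using assms
proof (induction d arbitrary: r)
  case 0
  then obtain s where "nat r = Suc s"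
    by (cases "nat r") auto
  then show ?case
    by (simp add: super_complete_def)
next
  case (Suc d)
  have d: "p - 1 + int (Suc d) - 1 = p - 1 + int d" by simp
  show ?case
    using super_complete_add_a[of "p - 1 + int (Suc d)" "p - 1" r, unfolded d] Suc.IH[of r] Suc.IH[of "r - 1"]
      Suc.prems by simp
qed

lemma entry_shift: 
  assumes "p \<le> k"
  shows "ent k b (Suc j) = ent (k - 1) b j + x k * ent k b j"
  using super_complete_add_x[OF assms, of "b - 1" "b - k + int (Suc j)"] by (simp add: schur_entry_def algebra_simps)

text \<open>In terms of generating functions, the new factor \<open>z - a b\<close> is
  \<open>(z - x k) + (x k - a b)\<close>. The first summand cancels the denominator belonging to
  \<open>x k\<close>; the second is the weight of an empty square in row \<open>k\<close> and column
  \<open>b\<close>.\<close>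

lemma entry_step:
  assumes "p \<le> k" "p \<le> b"
  shows "ent k (b + 1) j = ent (k - 1) b j + (x k - a b) * ent k b j"
proof -
  have "ent k (b + 1) j = ent k b (Suc j) - a b * ent k b j"
    using super_complete_add_a[OF assms(2), of k "b + 1 - k + int j"] by (simp add: schur_entry_def algebra_simps)
  then show ?thesis
    by (simp add: entry_shift[OF assms(1)] algebra_simps)
qed

lemma entry_low: "b - k + int j < 0 \<Longrightarrow> ent k b j = 0"
  "b - k + int j = 0 \<Longrightarrow> ent k b j = 1"
  by (simp_all add: schur_entry_def super_complete_def)

text \<open>The vector \<open>Q\<close> consists of the coefficients of the polynomial with the roots
  \<open>x\<^sub>p, \<dots>, x\<^sub>k\<close>; multiplying the generating function of the entries by it leaves a
  polynomial.\<close>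

lemma entry_relation:
  assumes "p \<le> k + 1"
  shows "\<exists>Q. Q (nat (k + 1 - p)) = 1 \<and> (\<forall>b\<ge>p. (\<Sum>j\<le>nat (k + 1 - p). Q j * ent k b j) = 0)"
  using assms
proof (induction "nat (k + 1 - p)" arbitrary: k)
  case 0
  then have k: "k = p - 1" by simp
  have "ent k b 0 = 0" if "p \<le> b" for b
    using super_complete_no_x[of "nat (b - p)" "b - k"] that by (simp add: schur_entry_def k)
  then show ?case by (intro exI[of _ "\<lambda>j. 1"]) (simp add: k)
next
  case (Suc d)
  then have k: "p \<le> k" "nat (k - p) = d" by auto
  obtain Q where Q: "Q d = 1" "\<And>b. b \<ge> p \<Longrightarrow> (\<Sum>j\<le>d. Q j * ent (k - 1) b j) = 0"
    using Suc(1)[of "k - 1"] Suc(2) k by force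
  \<comment> \<open>The coefficients after multiplication by the linear factor with root
    \<open>x k\<close>.\<close>
  define Q' where "Q' j = (if j = 0 then 0 else Q (j - 1)) - (if j \<le> d then x k * Q j else 0)" for j
  have "(\<Sum>j\<le>Suc d. Q' j * ent k b j) = 0" if "p \<le> b" for b
  proof -
    have "(\<Sum>j\<le>Suc d. Q' j * ent k b j) =
        (\<Sum>j\<le>Suc d. (if j = 0 then 0 else Q (j - 1)) * ent k b j) -
        (\<Sum>j\<le>Suc d. (if j \<le> d then x k * Q j else 0) * ent k b j)"
      by (simp only: Q'_def left_diff_distrib sum_subtractf)
    also have "\<dots> = (\<Sum>j\<le>d. Q j * ent k b (Suc j)) - (\<Sum>j\<le>d. x k * Q j * ent k b j)"
      by (subst sum.atMost_Suc_shift) (simp add: sum.atMost_Suc)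
    also have "\<dots> = (\<Sum>j\<le>d. Q j * ent (k - 1) b j)"
      by (simp add: entry_shift[OF k(1)] algebra_simps sum.distrib)
    finally show ?thesis using Q(2)[OF that] by simp
  qed
  moreover have "Q' (Suc d) = 1" by (simp add: Q'_def Q(1))
  ultimately show ?case
    unfolding Suc(2)[symmetric] by blast
qed

text \<open>The weight of a run of empty squares in row \<open>k\<close>, up to but excluding column
  \<open>b'\<close>.\<close>

definition span_weight :: "int \<Rightarrow> int \<Rightarrow> int \<Rightarrow> 'r" where
  "span_weight k b b' = (\<Prod>l\<in>{b..b' - 1}. x k - a l)"

lemma span_weight_refl: "span_weight k b b = 1"
  by (simp add: span_weight_def)

lemma span_weight_Suc: 
  assumes "b \<le> b'" 
  shows "span_weight k b (b' + 1) = (x k - a b') * span_weight k b b'"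
proof -
  have "{b..b'} = insert b' {b..b' - 1}" using assms by auto
  then show ?thesis by (simp add: span_weight_def)
qed

lemma span_weight_trans:
  assumes "b \<le> c" "c \<le> d"
  shows "span_weight k b d = span_weight k b c * span_weight k c d"
proof -
  have "{b..d - 1} = {b..c - 1} \<union> {c..d - 1}" using assms by auto
  then show ?thesis
    unfolding span_weight_def by (simp add: prod.union_disjoint)
qed

text \<open>The combination of the columns is evaluation at \<open>x\<^sub>k\<close>.\<close>

lemma entry_evaluation:
  assumes "p \<le> k"
  shows "\<exists>Q. Q (nat (k - p)) = 1 \<and> (\<forall>b\<ge>p. (\<Sum>j\<le>nat (k - p). Q j * ent k b j) = span_weight k p b)"
proof -
  \<comment> \<open>This \<open>Q\<close> kills the entries for \<open>k - 1\<close>, so in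
    \<open>entry_step\<close> only the factor \<open>x k - a b\<close> survives. In column
    \<open>p\<close> the entries with \<open>j\<close> below \<open>k - p\<close> vanish and the
    next one is 1, which fixes the initial value.\<close>
  obtain Q where Q: "Q (nat (k - p)) = 1" "\<And>b. b \<ge> p \<Longrightarrow> (\<Sum>j\<le>nat (k - p). Q j * ent (k - 1) b j) = 0"
    using entry_relation[of "k - 1"] assms by auto
  have "(\<Sum>j\<le>nat (k - p). Q j * ent k (p + int d) j) = span_weight k p (p + int d)" for d
  proof (induction d)
    case 0
    have "(\<Sum>j\<le>nat (k - p). Q j * ent k p j) = (\<Sum>j\<in>{nat (k - p)}. Q j * ent k p j)"
    proof (rule sum.mono_neutral_right)
      show "\<forall>j\<in>{..nat (k - p)} - {nat (k - p)}. Q j * ent k p j = 0"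
      proof
        fix j assume "j \<in> {..nat (k - p)} - {nat (k - p)}"
        then have "p - k + int j < 0" by auto
        then show "Q j * ent k p j = 0" by (simp add: entry_low(1))
      qed
    qed auto
    then show ?case
      using assms by (simp add: Q(1) entry_low(2) span_weight_refl)
  next
    case (Suc d)
    let ?b = "p + int d"
    have b: "p + int (Suc d) = ?b + 1" by simp
    have e: "ent k (?b + 1) j = ent (k - 1) ?b j + (x k - a ?b) * ent k ?b j" for j
      by (rule entry_step) (use assms in auto)
    have "(\<Sum>j\<le>nat (k - p). Q j * ent k (?b + 1) j) =
        (\<Sum>j\<le>nat (k - p). Q j * ent (k - 1) ?b j) + (x k - a ?b) * (\<Sum>j\<le>nat (k - p). Q j * ent k ?b j)"
      unfolding e by (simp add: algebra_simps sum.distrib sum_distrib_left sum_subtractf)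
    then show ?case
      unfolding b using Suc Q(2)[of ?b] by (simp add: span_weight_Suc)
  qed
  note eval = this
  have "(\<Sum>j\<le>nat (k - p). Q j * ent k b j) = span_weight k p b" if "p \<le> b" for b
    using eval[of "nat (b - p)"] that by simp
  then show ?thesis
    using Q(1) by blast
qed

end

text \<open>The rows are reversed because positions are listed from left to right, while the parts of a
  partition decrease.\<close>

definition det_rows :: "(nat \<Rightarrow> 'r) list \<Rightarrow> 'r::comm_ring_1" where
  "det_rows vs = det (mat (length vs) (length vs) (\<lambda>(i, j). (rev vs ! i) j))"

lemma det_rows_leibniz:
  "det_rows vs = (\<Sum>\<pi> | \<pi> permutes {0..<length vs}.
     signof \<pi> * (\<Prod>i\<in>{0..<length vs}. (rev vs ! i) (\<pi> i)))"
proof -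
  have "(\<Prod>i = 0..<length vs. mat (length vs) (length vs) (\<lambda>(i, j). (rev vs ! i) j) $$ (i, \<pi> i)) =
      (\<Prod>i\<in>{0..<length vs}. (rev vs ! i) (\<pi> i))" if "\<pi> permutes {0..<length vs}" for \<pi>
    by (rule prod.cong) (use permutes_in_image[OF that] in auto)
  then show ?thesis
    unfolding det_rows_def by (subst det_def') auto
qed

lemma det_rows_linear:
  "det_rows (pre @ (\<lambda>j. c * u j + v j) # post) = c * det_rows (pre @ u # post) + det_rows (pre @ v # post)"
proof -
  let ?n = "length pre + Suc (length post)" and ?i = "length post"
  have nth: "rev (pre @ w # post) ! i = (if i = ?i then w else rev (pre @ v # post) ! i)"
    if "i < ?n" for i w
    using that by (auto simp: nth_append)
  have prod: "(\<Prod>i\<in>{0..<?n}. (rev (pre @ w # post) ! i) (\<pi> i)) =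
      w (\<pi> ?i) * (\<Prod>i\<in>{0..<?n} - {?i}. (rev (pre @ v # post) ! i) (\<pi> i))" for w \<pi>
  proof -
    have "(\<Prod>i\<in>{0..<?n}. (rev (pre @ w # post) ! i) (\<pi> i)) =
        (rev (pre @ w # post) ! ?i) (\<pi> ?i) * (\<Prod>i\<in>{0..<?n} - {?i}. (rev (pre @ w # post) ! i) (\<pi> i))"
      by (rule prod.remove) auto
    also have "rev (pre @ w # post) ! ?i = w"
      using nth[of ?i w] by simp
    also have "(\<Prod>i\<in>{0..<?n} - {?i}. (rev (pre @ w # post) ! i) (\<pi> i)) =
        (\<Prod>i\<in>{0..<?n} - {?i}. (rev (pre @ v # post) ! i) (\<pi> i))"
    proof (rule prod.cong[OF refl])
      fix i assume "i \<in> {0..<?n} - {?i}"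
      then show "(rev (pre @ w # post) ! i) (\<pi> i) = (rev (pre @ v # post) ! i) (\<pi> i)"
        using nth[of i w] by auto
    qed
    finally show ?thesis .
  qed
  have len: "length (pre @ w # post) = ?n" for w by simp
  show ?thesis
    unfolding det_rows_leibniz len prod
    by (simp add: algebra_simps sum.distrib sum_distrib_left)
qed

fun positions :: "int \<Rightarrow> lab list \<Rightarrow> int list" where
  "positions c [] = []"
| "positions c (None # ts) = positions (c + 1) ts"
| "positions c (Some k # ts) = c # positions (c + 1) ts"

lemma length_positions [simp]: "length (positions c ts) = length (labels ts)"
  by (induction c ts rule: positions.induct) auto

lemma positions_empty_iff: "positions c ts = [] \<longleftrightarrow> labels ts = []"
  by (metis length_0_conv length_positions)

lemma positions_bounds: "b \<in> set (positions c ts) \<Longrightarrow> c \<le> b"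
  by (induction c ts rule: positions.induct) force+

lemma positions_sorted: "sorted_wrt (<) (positions c ts)"
  by (induction c ts rule: positions.induct) (auto dest: positions_bounds)

lemma positions_append: "positions c (ts @ us) = positions c ts @ positions (c + int (length ts)) us"
  by (induction c ts rule: positions.induct) (auto simp: algebra_simps)

section \<open>One row of tiles as an operation on determinants\<close>

context schur_entries
begin

text \<open>By \<open>gap_Suc\<close> this is, for \<open>b < b'\<close>, the sum of
  \<open>ent (k - 1) l\<close> over the columns \<open>l\<close> from \<open>b\<close> to
  \<open>b' - 1\<close>, each times the weight of the columns \<open>l + 1..b' - 1\<close>. It
  describes a pipe that comes from column \<open>b\<close>, rises in column \<open>l\<close> and
  leaves empty squares up to the next pipe, in column \<open>b'\<close>.\<close>

definition gap :: "int \<Rightarrow> int \<Rightarrow> int \<Rightarrow> nat \<Rightarrow> 'r" where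
  "gap k b b' j = ent k b' j - span_weight k b b' * ent k b j"

fun gaps :: "int \<Rightarrow> int \<Rightarrow> int list \<Rightarrow> (nat \<Rightarrow> 'r) list" where
  "gaps k b [] = []"
| "gaps k b (b' # bs) = gap k b b' # gaps k b' bs"

lemma length_gaps [simp]: "length (gaps k b bs) = length bs"
  by (induction bs arbitrary: b) auto

lemma gap_Suc_self:
  assumes "p \<le> k" "p \<le> b"
  shows "gap k b (b + 1) = ent (k - 1) b"
  using entry_step[OF assms] span_weight_Suc[of b b k] span_weight_refl[of k b]
  by (simp add: gap_def fun_eq_iff)

lemma gap_Suc:
  assumes "p \<le> k" "p \<le> l" "b \<le> l"
  shows "gap k b (l + 1) = (\<lambda>j. (x k - a l) * gap k b l j + ent (k - 1) l j)"
  unfolding gap_def entry_step[OF assms(1,2)] span_weight_Suc[OF assms(3)]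
  by (simp add: algebra_simps)

lemma upto_Cons_iff: "j # w = [i..k] \<longleftrightarrow> i \<le> k \<and> j = i \<and> w = [i + 1..k]" for i k :: int
  by (subst upto.simps) auto

text \<open>The two summands are the cases that the pipe \<open>i\<close> has already left the row upwards and that
  it is still running to the right.\<close>

lemma row_transfer_interlacing:
  assumes "p \<le> b" "b < l" "i \<le> k" "p \<le> k" "labels bs = [i + 1..k]" "length bs = length ls"
    and "ls = map a [l..m]"
  shows "row_transfer (x k) ls None bs (Some k) (\<lambda>ts. if labels ts = [i + 1..k - 1]
        then det_rows (pre @ gap k b l # map (ent (k - 1)) (positions l ts)) else 0) +
      row_transfer (x k) ls (Some i) bs (Some k) (\<lambda>ts. if labels ts = [i..k - 1]
        then det_rows (pre @ map (ent (k - 1)) (positions l ts)) else 0) =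
    det_rows (pre @ gaps k b (positions l bs))"
  using assms
proof (induction bs arbitrary: b l i ls pre)
  case Nil
  then have "i = k" "ls = []" by auto
  then show ?case by simp
next
  case (Cons c bs)
  have "l \<le> m"
    using Cons.prems(6,7) by (cases "l \<le> m") auto
  then have lm: "l \<le> m" "ls = a l # map a [l + 1..m]"
    using Cons.prems(7) by (simp_all add: upto_rec1)
  let ?ls = "map a [l + 1..m]"
  have len: "length bs = length ?ls" using Cons.prems(6) lm by simp
  let ?v = "ent (k - 1)"
  have pl: "p \<le> l" using Cons.prems by simp
  show ?case
  proof (cases c)
    case None
    have lab: "labels bs = [i + 1..k]" using Cons.prems(5) None by simp
    have bl: "b < l + 1" using Cons.prems(2) by simp
    note IH = Cons.IH[of b "l + 1" i ?ls pre, OF Cons.prems(1) bl Cons.prems(3,4) lab len refl]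
    \<comment> \<open>For \<open>i = k\<close> both sides vanish: this pipe has to leave in the
      east, and after rising it is gone from the row.\<close>
    have up: "row_transfer (x k) ?ls None bs (Some k) (\<lambda>ts. if labels (Some i # ts) = [i..k - 1]
          then det_rows (pre @ map ?v (positions l (Some i # ts))) else 0) =
        row_transfer (x k) ?ls None bs (Some k) (\<lambda>ts. if labels ts = [i + 1..k - 1]
          then det_rows (pre @ ?v l # map ?v (positions (l + 1) ts)) else 0)"
    proof (cases "i = k")
      case True
      then have "Some k \<notin> set (None # bs)"
        using lab labels_empty_iff[of bs] by auto
      then show ?thesis by (simp add: row_transfer_exit_absent)
    next
      case False
      then show ?thesis using Cons.prems(3) by (simp add: upto_Cons_iff cong: if_cong)
    qed
    have "det_rows (pre @ gap k b (l + 1) # w) =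
        (x k - a l) * det_rows (pre @ gap k b l # w) + det_rows (pre @ ?v l # w)" for w
      unfolding gap_Suc[OF Cons.prems(4) pl less_imp_le[OF Cons.prems(2)]] by (rule det_rows_linear)
    \<comment> \<open>The gap is widened by column \<open>l\<close>: the square is empty, with
      weight \<open>x k - a l\<close>, or the pipe \<open>i\<close> rises there. Linearity of the
      determinant in this row separates the two cases.\<close>
    then have split: "row_transfer (x k) ?ls None bs (Some k) (\<lambda>ts. if labels ts = [i + 1..k - 1]
          then det_rows (pre @ gap k b (l + 1) # map ?v (positions (l + 1) ts)) else 0) =
        (x k - a l) * row_transfer (x k) ?ls None bs (Some k) (\<lambda>ts. if labels ts = [i + 1..k - 1]
          then det_rows (pre @ gap k b l # map ?v (positions (l + 1) ts)) else 0) +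
        row_transfer (x k) ?ls None bs (Some k) (\<lambda>ts. if labels ts = [i + 1..k - 1]
          then det_rows (pre @ ?v l # map ?v (positions (l + 1) ts)) else 0)"
      unfolding row_transfer_mult[symmetric] row_transfer_add[symmetric]
      by (intro arg_cong[of _ _ "row_transfer (x k) ?ls None bs (Some k)"]) auto
    show ?thesis
      unfolding None lm(2) row_transfer.simps up unfolding labels.simps positions.simps
      using IH[unfolded split] by (simp only: ac_simps)
  next
    case (Some j)
    then have j: "i < k" "j = i + 1" "labels bs = [i + 1 + 1..k]"
      using Cons.prems(5) by (simp_all add: upto_Cons_iff)
    have il: "l < l + 1" "i + 1 \<le> k" using j(1) by auto
    note IH = Cons.IH[of l "l + 1" "i + 1" ?ls "pre @ [gap k b l]", OF pl il(1,2) Cons.prems(4) j(3) len refl]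
    have up: "row_transfer (x k) ?ls None bs (Some k) (\<lambda>ts. if labels (Some j # ts) = [i + 1..k - 1]
          then det_rows (pre @ gap k b l # map ?v (positions l (Some j # ts))) else 0) =
        row_transfer (x k) ?ls None bs (Some k) (\<lambda>ts. if labels ts = [i + 1 + 1..k - 1]
          then det_rows ((pre @ [gap k b l]) @ gap k l (l + 1) # map ?v (positions (l + 1) ts)) else 0)"
    proof (cases "i + 1 = k")
      case True
      then have "Some k \<notin> set (None # bs)"
        using j labels_empty_iff[of bs] by auto
      then show ?thesis by (simp add: row_transfer_exit_absent)
    next
      case False
      then show ?thesis
        using j gap_Suc_self[OF Cons.prems(4) pl] by (simp add: upto_Cons_iff cong: if_cong)
    qed
    \<comment> \<open>The crossing would put \<open>i + 1\<close> before \<open>i\<close> on the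
      north side.\<close>
    have cross: "row_transfer (x k) ?ls (Some i) bs (Some k) (\<lambda>ts. if labels (Some j # ts) = [i..k - 1]
          then det_rows (pre @ map ?v (positions l (Some j # ts))) else 0) = 0"
      using j by (simp add: upto_Cons_iff row_transfer_zero)
    have run: "(\<lambda>ts. if labels (None # ts) = [i + 1..k - 1]
          then det_rows (pre @ gap k b l # map ?v (positions l (None # ts))) else 0) =
        (\<lambda>ts. if labels ts = [i + 1..k - 1]
          then det_rows ((pre @ [gap k b l]) @ map ?v (positions (l + 1) ts)) else 0)"
      by auto
    show ?thesis
      unfolding Some lm(2) row_transfer.simps up cross run
      using IH unfolding j(2) by (simp only: if_cancel positions.simps gaps.simps append_assoc append.simps add_0_right if_cancel)
  qed
qed

text \<open>West of the first pipe all squares are empty. The first pipe rises at once or runs on to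
  the east, which are the two summands of \<open>row_transfer_interlacing\<close>, entered one
  column further east.\<close>

lemma row_transfer_interlacing_start:
  assumes "p \<le> l" "p \<le> k" "labels bs = [p..k]" "length bs = length ls" "ls = map a [l..m]"
  shows "row_transfer (x k) ls None bs (Some k) (\<lambda>ts. if labels ts = [p..k - 1]
        then det_rows (map (ent (k - 1)) (positions l ts)) else 0) =
    span_weight k l (hd (positions l bs)) * det_rows (gaps k (hd (positions l bs)) (tl (positions l bs)))"
  using assms
proof (induction bs arbitrary: l ls)
  case (Cons c bs)
  have "l \<le> m"
    using Cons.prems(4,5) by (cases "l \<le> m") auto
  then have lm: "l \<le> m" "ls = a l # map a [l + 1..m]"
    using Cons.prems(5) by (simp_all add: upto_rec1)
  let ?ls = "map a [l + 1..m]"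
  have len: "length bs = length ?ls" using Cons.prems(4) lm by simp
  show ?case
  proof (cases c)
    case None
    then have lab: "labels bs = [p..k]" using Cons.prems(3) by simp
    have "positions (l + 1) bs \<noteq> []"
      using lab Cons.prems(2) by (simp add: positions_empty_iff)
    then have "l + 1 \<le> hd (positions (l + 1) bs)"
      by (intro positions_bounds[of _ _ bs]) simp
    then have "span_weight k l (hd (positions (l + 1) bs)) = (x k - a l) * span_weight k (l + 1) (hd (positions (l + 1) bs))"
      using span_weight_trans[of l "l + 1" _ k] span_weight_Suc[of l l k] span_weight_refl[of k l]
      by simp
    then show ?thesis
      unfolding None lm(2) using Cons.IH[of "l + 1" ?ls] Cons.prems(1,2) lab len
      by (simp add: mult.assoc cong: if_cong)
  next
    case (Some j)
    then have j: "j = p" "labels bs = [p + 1..k]"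
      using Cons.prems(3) by (simp_all add: upto_Cons_iff)
    have up: "row_transfer (x k) ?ls None bs (Some k) (\<lambda>ts. if labels (Some j # ts) = [p..k - 1]
          then det_rows (map (ent (k - 1)) (positions l (Some j # ts))) else 0) =
        row_transfer (x k) ?ls None bs (Some k) (\<lambda>ts. if labels ts = [p + 1..k - 1]
          then det_rows ([] @ gap k l (l + 1) # map (ent (k - 1)) (positions (l + 1) ts)) else 0)"
    proof (cases "p = k")
      case True
      then have "Some k \<notin> set (None # bs)"
        using j labels_empty_iff[of bs] by auto
      then show ?thesis by (simp add: row_transfer_exit_absent)
    next
      case False
      then show ?thesis
        using j gap_Suc_self[OF Cons.prems(2,1)] Cons.prems(2) by (simp add: upto_Cons_iff cong: if_cong)
    qed
    show ?thesis
      unfolding Some lm(2) row_transfer.simps up unfolding labels.simps positions.simps list.sel span_weight_refl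
      using row_transfer_interlacing[of l "l + 1" p k bs ?ls m "[]", OF Cons.prems(1) _ Cons.prems(2,2) j(2) len refl]
      by (simp only: append.simps mult_1_left less_add_one j(1) True_implies_equals)
  qed
qed (simp add: upto.simps[of p k])

lemma gaps_nth: 
  assumes "i < length bs"
  shows "gaps k b bs ! i = gap k ((b # bs) ! i) (bs ! i)"
  using assms by (induction bs arbitrary: b i) (auto simp: nth_Cons split: nat.splits)

text \<open>The combination \<open>Q\<close> of the columns replaces the last column by evaluations
  at \<open>x k\<close>, which are weights of spans beginning at \<open>p\<close>. These are
  multiplicative, so subtracting from each row a multiple of the next one, that is, of the next pipe
  to the west, clears the last column except for the westernmost pipe \<open>b\<close> and turns the
  other entries into gaps.\<close>

lemma det_rows_gaps:
  assumes "p \<le> k" "length bs = nat (k - p)" "sorted_wrt (<) (b # bs)" "p \<le> b"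
  shows "det_rows (map (ent k) (b # bs)) = span_weight k p b * det_rows (gaps k b bs)"
proof -
  let ?M = "length bs"
  let ?N = "Suc ?M"
  let ?ds = "rev (b # bs)"
  obtain Q where Q: "Q ?M = 1" "\<And>c. p \<le> c \<Longrightarrow> (\<Sum>j\<le>?M. Q j * ent k c j) = span_weight k p c"
    using entry_evaluation[OF assms(1)] assms(2) by auto
  define A where "A = mat ?N ?N (\<lambda>(i, j). ent k (?ds ! i) j)"
  \<comment> \<open>The column operation; it has determinant 1 because \<open>Q\<close> has leading
    coefficient 1.\<close>
  define U where "U = mat ?N ?N (\<lambda>(i, j). if j = ?M then Q i else if i = j then 1 else 0)"
  \<comment> \<open>The row operation. In the reversed list \<open>?ds\<close> the index
    \<open>Suc i\<close> belongs to the neighbour in the west.\<close>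
  define L where "L = mat ?N ?N (\<lambda>(i, j). if i = j then 1 else
    if j = Suc i then - span_weight k (?ds ! j) (?ds ! i) else 0)"
  have carr: "A \<in> carrier_mat ?N ?N" "U \<in> carrier_mat ?N ?N" "L \<in> carrier_mat ?N ?N"
    by (simp_all add: A_def U_def L_def)
  have detU: "det U = 1"
    by (subst det_upper_triangular[of _ ?N])
       (auto simp: U_def upper_triangular_def prod_list_diag_prod Q(1) intro!: prod.neutral)
  have detL: "det L = 1"
    by (subst det_upper_triangular[of _ ?N])
       (auto simp: L_def upper_triangular_def prod_list_diag_prod intro!: prod.neutral)
  have ge: "p \<le> ?ds ! i" if "i < ?N" for i
  proof -
    have "?ds ! i \<in> set (b # bs)" using that nth_mem[of i ?ds] by simp
    then show ?thesis using assms(3,4) by force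
  qed
  have less: "?ds ! Suc i < ?ds ! i" if "Suc i < ?N" for i
  proof -
    have "sorted_wrt (\<lambda>x y. y < x) ?ds"
      using assms(3) unfolding sorted_wrt_rev .
    then show ?thesis
      using sorted_wrt_nth_less[of _ ?ds i "Suc i"] that by simp
  qed
  have AU: "(A * U) $$ (i, j) = (if j = ?M then span_weight k p (?ds ! i) else ent k (?ds ! i) j)"
    if "i < ?N" "j < ?N" for i j
  proof -
    have "(A * U) $$ (i, j) = (\<Sum>l\<in>{0..<?N}. ent k (?ds ! i) l * U $$ (l, j))"
      using that by (simp add: A_def U_def scalar_prod_def)
    also have "\<dots> = (if j = ?M then span_weight k p (?ds ! i) else ent k (?ds ! i) j)"
    proof (cases "j = ?M")
      case True
      have "(\<Sum>l\<in>{0..<?N}. ent k (?ds ! i) l * U $$ (l, j)) = (\<Sum>l\<le>?M. Q l * ent k (?ds ! i) l)"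
        using True by (intro sum.cong) (auto simp: U_def)
      then show ?thesis using True Q(2)[OF ge[OF that(1)]] by simp
    next
      case False
      have "(\<Sum>l\<in>{0..<?N}. ent k (?ds ! i) l * U $$ (l, j)) =
          (\<Sum>l\<in>{0..<?N}. if l = j then ent k (?ds ! i) l else 0)"
        using False that by (intro sum.cong) (auto simp: U_def)
      then show ?thesis using False that by simp
    qed
    finally show ?thesis .
  qed
  let ?G = "mat ?M ?M (\<lambda>(i, j). (rev (gaps k b bs) ! i) j)"
  have LAU: "L * (A * U) = four_block_mat ?G (0\<^sub>m ?M 1) (mat 1 ?M (\<lambda>(i, j). ent k b j)) (mat 1 1 (\<lambda>_. span_weight k p b))"
    (is "_ = ?B")
  proof (rule eq_matI)
    fix i j assume "i < dim_row ?B" "j < dim_col ?B"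
    then have ij: "i < ?N" "j < ?N" by auto
    have "(L * (A * U)) $$ (i, j) = (\<Sum>l\<in>{0..<?N}. L $$ (i, l) * (A * U) $$ (l, j))"
      using ij carr by (simp add: scalar_prod_def)
    also have "\<dots> = (\<Sum>l\<in>{0..<?N}. (if l = i then (A * U) $$ (i, j) else 0) +
        (if l = Suc i then - span_weight k (?ds ! Suc i) (?ds ! i) * (A * U) $$ (Suc i, j) else 0))"
      using ij by (intro sum.cong) (auto simp: L_def simp del: index_mult_mat)
    also have "\<dots> = (A * U) $$ (i, j) +
        (if i < ?M then - span_weight k (?ds ! Suc i) (?ds ! i) * (A * U) $$ (Suc i, j) else 0)"
      using ij by (simp add: sum.distrib del: index_mult_mat)
    also have "\<dots> = ?B $$ (i, j)"
    proof (cases "i < ?M")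
      case True
      have tr: "span_weight k p (?ds ! i) = span_weight k p (?ds ! Suc i) * span_weight k (?ds ! Suc i) (?ds ! i)"
        using span_weight_trans[OF ge[of "Suc i"] less_imp_le[OF less[of i]]] True by simp
      have G: "rev (gaps k b bs) ! i = gap k (?ds ! Suc i) (?ds ! i)"
        using True by (simp add: rev_nth gaps_nth nth_append Suc_diff_Suc)
      show ?thesis
        using True ij AU[of i j] AU[of "Suc i" j]
        by (auto simp del: index_mult_mat rev.simps simp: G gap_def tr mult.commute)
    next
      case False
      then have "i = ?M" using ij by simp
      then show ?thesis
        using ij AU[of i j] by (auto simp del: index_mult_mat simp: nth_append)
    qed
    finally show "(L * (A * U)) $$ (i, j) = ?B $$ (i, j)" .
  qed (use carr in auto)
  have "det_rows (map (ent k) (b # bs)) = det A"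
    unfolding det_rows_def A_def
    by (intro arg_cong[of _ _ det] eq_matI) (simp_all add: rev_map nth_append del: rev.simps list.map)
  also have "det A = det (L * (A * U))"
    using carr by (simp add: det_mult[of _ ?N] detU detL)
  also have "\<dots> = det ?G * det (mat 1 1 (\<lambda>_. span_weight k p b))"
    unfolding LAU by (rule det_four_block_mat_upper_right_zero_col[of _ ?M]) auto
  also have "\<dots> = span_weight k p b * det_rows (gaps k b bs)"
    by (simp add: det_single det_rows_def mult.commute)
  finally show ?thesis .
qed

text \<open>Induction over the rows from the top down. With the determinant for \<open>k - 1\<close>
  inserted, the sum over row \<open>k\<close> is the determinant of the gaps times the weight of the
  empty squares in the west, and \<open>det_rows_gaps\<close> recognises the determinant for
  \<open>k\<close>, larger by one row and column.\<close>

lemma top_rows_eq_det: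
  assumes "p - 1 \<le> k" "labels ts = [p..k]" "length ts = length [p..m]"
  shows "top_rows p k x (map a [p..m]) ts = det_rows (map (ent k) (positions p ts))"
  using assms
proof (induction "nat (k - p + 1)" arbitrary: k ts)
  case 0
  then have "k = p - 1" by simp
  moreover from this have "labels ts = []" using 0 by simp
  ultimately have "set ts \<subseteq> {None}" "positions p ts = []"
    by (simp_all only: labels_empty_iff[symmetric] positions_empty_iff)
  then show ?case
    by (simp add: \<open>k = p - 1\<close> top_rows_Nil no_pipes_def det_rows_def)
next
  case (Suc d)
  then have k: "p \<le> k" by auto
  have "positions p ts \<noteq> []"
    using Suc.prems(2) k by (simp add: positions_empty_iff)
  then obtain b bs where pos: "positions p ts = b # bs" by (cases "positions p ts") auto
  have "top_rows p k x (map a [p..m]) ts = row_transfer (x k) (map a [p..m]) None ts (Some k)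
      (\<lambda>us. if labels us = [p..k - 1] then det_rows (map (ent (k - 1)) (positions p us)) else 0)"
    unfolding top_rows_step[OF k]
  proof (rule row_transfer_cong)
    fix us :: "lab list" assume "length us = length (map a [p..m])"
    then show "top_rows p (k - 1) x (map a [p..m]) us =
        (if labels us = [p..k - 1] then det_rows (map (ent (k - 1)) (positions p us)) else 0)"
      using Suc(1)[of "k - 1" us] Suc(2) top_rows_vanish[of p "k - 1" us x] k by auto
  qed
  also have "\<dots> = span_weight k p b * det_rows (gaps k b bs)"
    using row_transfer_interlacing_start[of p k ts _ m] k Suc.prems pos by simp
  also have "\<dots> = det_rows (map (ent k) (b # bs))"
  proof (rule det_rows_gaps[symmetric])
    have "length (positions p ts) = length [p..k]"
      by (simp add: Suc.prems(2))
    then show "length bs = nat (k - p)" by (simp add: pos)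
    show "p \<le> b" using positions_bounds[of b p ts] pos by simp
    show "sorted_wrt (<) (b # bs)" using positions_sorted[of p ts] pos by simp
  qed (rule k)
  finally show ?case by (simp add: pos)
qed

end

section \<open>Truncation of double Schur functions and the limit\<close>

lemma complete_sym_hom:
  assumes "comm_ring_hom \<phi>" "\<And>c. \<phi> (emb c) = emb' c"
  shows "\<phi> (complete_sym emb P r) = complete_sym emb' (\<lambda>k. \<phi> (P k)) r"
proof -
  interpret comm_ring_hom \<phi> by (rule assms(1))
  show ?thesis
    by (induction r rule: less_induct) (case_tac x, simp_all add: hom_mult hom_sum assms(2) del: of_nat_Suc)
qed

text \<open>A signed sum over the indices between 0 and \<open>c\<close>; at least one of the two
  intervals is empty.\<close>

definition a_shift :: "int \<Rightarrow> nat \<Rightarrow> dsym" where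
  "a_shift c k = (\<Sum>i\<in>{1..c}. mvar (Agen i) ^ k) - (\<Sum>i\<in>{c + 1..0}. mvar (Agen i) ^ k)"

text \<open>A closed form for all integral powers of \<open>gamma_a\<close>. It makes the inverse
  explicit, which \<open>gamma_a_pow\<close> only has as \<open>inv_into\<close>.\<close>

definition gamma_shift :: "int \<Rightarrow> dsym \<Rightarrow> dsym" where
  "gamma_shift c = msubst mconst
     (\<lambda>g. case g of Pgen k \<Rightarrow> mvar (Pgen k) - a_shift c k | Agen i \<Rightarrow> mvar (Agen (i + c)))"

lemma gamma_shift_hom: "comm_ring_hom (gamma_shift c)"
  unfolding gamma_shift_def by (rule msubst_hom[OF mconst_hom])

lemma gamma_shift_gen:
  "gamma_shift c (mvar (Pgen k)) = mvar (Pgen k) - a_shift c k"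
  "gamma_shift c (mvar (Agen i)) = mvar (Agen (i + c))"
  by (simp_all add: gamma_shift_def msubst_mvar[OF mconst_hom])

lemma a_shift_Suc: "a_shift (c + 1) k = a_shift c k + mvar (Agen (c + 1)) ^ k"
proof (cases "0 \<le> c")
  case True
  then have "{1..c + 1} = insert (c + 1) {1..c}" "{c + 1 + 1..0} = {}" "{c + 1..0} = {}" by auto
  then show ?thesis by (simp add: a_shift_def add.commute)
next
  case False
  then have "{1..c + 1} = {}" "{1..c} = {}" "{c + 1..0} = insert (c + 1) {c + 1 + 1..0}" by auto
  then show ?thesis by (simp add: a_shift_def)
qed

lemma a_shift_0: "a_shift 0 k = 0"
  by (simp add: a_shift_def)

text \<open>The cocycle identity behind the additivity of \<open>gamma_shift\<close> in
  \<open>c\<close>.\<close>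

lemma a_shift_add: "a_shift c k + gamma_shift c (a_shift d k) = a_shift (c + d) k"
proof -
  interpret g: comm_ring_hom "gamma_shift c" by (rule gamma_shift_hom)
  have step: "a_shift c k + gamma_shift c (a_shift (d + 1) k) =
      (a_shift c k + gamma_shift c (a_shift d k)) + mvar (Agen (c + d + 1)) ^ k" for d
    unfolding a_shift_Suc g.hom_add g.hom_power gamma_shift_gen by (simp add: ac_simps)
  have step': "a_shift (c + (d + 1)) k = a_shift (c + d) k + mvar (Agen (c + d + 1)) ^ k" for d
    using a_shift_Suc[of "c + d" k] by (simp add: add.assoc)
  show ?thesis
  proof (induction d rule: int_induct[where k = 0])
    case base
    show ?case by (simp add: a_shift_0)
  next
    case (step1 i)
    then show ?case unfolding step step' by simp
  next
    case (step2 i)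
    then show ?case using step[of "i - 1"] step'[of "i - 1"] by simp
  qed
qed

lemma gamma_shift_gamma_shift: "gamma_shift c (gamma_shift d P) = gamma_shift (c + d) P"
proof -
  interpret g: comm_ring_hom "gamma_shift c" by (rule gamma_shift_hom)
  have gen: "gamma_shift c (case g of Pgen k \<Rightarrow> mvar (Pgen k) - a_shift d k | Agen i \<Rightarrow> mvar (Agen (i + d))) =
      (case g of Pgen k \<Rightarrow> mvar (Pgen k) - a_shift (c + d) k | Agen i \<Rightarrow> mvar (Agen (i + (c + d))))" for g
    by (simp add: g.hom_minus gamma_shift_gen add_ac flip: a_shift_add[of c _ d] split: dgen.split)
  have "gamma_shift c (gamma_shift d P) = msubst mconst (\<lambda>g. gamma_shift c
      (case g of Pgen k \<Rightarrow> mvar (Pgen k) - a_shift d k | Agen i \<Rightarrow> mvar (Agen (i + d)))) P"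
    unfolding gamma_shift_def[of d] by (rule hom_msubst[OF gamma_shift_hom])
      (simp add: gamma_shift_def msubst_mconst[OF mconst_hom])
  then show ?thesis
    unfolding gen by (simp add: gamma_shift_def)
qed

lemma gamma_shift_0: "gamma_shift 0 P = P"
proof -
  have eq: "(\<lambda>g. case g of Pgen k \<Rightarrow> mvar (Pgen k) - a_shift 0 k | Agen i \<Rightarrow> mvar (Agen (i + 0))) = mvar"
    by (auto simp: fun_eq_iff a_shift_0 split: dgen.split)
  show ?thesis
    unfolding gamma_shift_def eq by (rule msubst_id)
qed

lemma gamma_a_eq: "gamma_a = gamma_shift 1"
proof -
  have "a_shift 1 k = mvar (Agen 1) ^ k" for k
    by (simp add: a_shift_def)
  then show ?thesis
    by (simp only: gamma_a_def gamma_shift_def)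
qed

lemma gamma_a_pow_eq: "gamma_a_pow c = gamma_shift c"
proof -
  have pow: "gamma_shift d ^^ n = gamma_shift (int n * d)" for d n
    by (induction n) (auto simp: gamma_shift_gamma_shift gamma_shift_0 fun_eq_iff algebra_simps)
  have "inv_into UNIV gamma_a = gamma_shift (- 1)"
    unfolding gamma_a_eq
    by (rule inv_unique_comp) (simp_all add: fun_eq_iff gamma_shift_gamma_shift gamma_shift_0)
  then show ?thesis
    by (auto simp: gamma_a_pow_def pow gamma_a_eq)
qed

text \<open>A polynomial stand-in for \<open>dsym_ser\<close>: the power sums stop at
  \<open>p\<close>, while the generators \<open>Agen i\<close> are kept for all
  \<open>i\<close>.\<close>

definition truncate :: "int \<Rightarrow> dsym \<Rightarrow> xa mpol" where
  "truncate p = msubst mconst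
     (\<lambda>g. case g of Pgen k \<Rightarrow> \<Sum>i\<in>{p..0}. x_var i ^ k - a_var i ^ k | Agen i \<Rightarrow> a_var i)"

lemma truncate_hom: "comm_ring_hom (truncate p)"
  unfolding truncate_def by (rule msubst_hom[OF mconst_hom])

lemma truncate_gen:
  "truncate p (mvar (Pgen k)) = (\<Sum>i\<in>{p..0}. x_var i ^ k - a_var i ^ k)"
  "truncate p (mvar (Agen i)) = a_var i"
  by (simp_all add: truncate_def msubst_mvar[OF mconst_hom])

lemma truncate_h_super:
  assumes "p - 1 \<le> c" "p \<le> 1"
  shows "truncate p (gamma_shift c (h_super r)) =
    complete_sym mconst (\<lambda>m. (\<Sum>i\<in>{p..0}. x_var i ^ m) - (\<Sum>i\<in>{p..c}. a_var i ^ m)) r"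
proof -
  interpret t: comm_ring_hom "truncate p" by (rule truncate_hom)
  have eq: "truncate p (gamma_shift c (mvar (Pgen m))) =
      (\<Sum>i\<in>{p..0}. x_var i ^ m) - (\<Sum>i\<in>{p..c}. a_var i ^ m)" for m
  proof (cases "0 \<le> c")
    case True
    have "{p..c} = {p..0} \<union> {1..c}" "{p..0} \<inter> {1..c} = {}" "{c + 1..0} = {}" using True assms by auto
    then show ?thesis
      by (simp add: gamma_shift_gen t.hom_minus truncate_gen a_shift_def t.hom_sum t.hom_power sum_subtractf
          sum.union_disjoint)
  next
    case False
    have "{p..0} = {p..c} \<union> {c + 1..0}" "{p..c} \<inter> {c + 1..0} = {}" "{1..c} = {}" using False assms by auto
    then have s: "(\<Sum>i\<in>{p..0}. a_var i ^ m) = (\<Sum>i\<in>{p..c}. a_var i ^ m) + (\<Sum>i\<in>{c + 1..0}. a_var i ^ m)"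
      by (metis finite_atLeastAtMost_int sum.union_disjoint)
    show ?thesis
      using \<open>{1..c} = {}\<close>
      by (simp add: gamma_shift_gen t.hom_minus t.hom_add truncate_gen a_shift_def t.hom_sum t.hom_power sum_subtractf s)
  qed
  have "truncate p (gamma_shift c (h_super r)) =
      truncate p (complete_sym mconst (\<lambda>k. gamma_shift c (mvar (Pgen k))) r)"
    unfolding h_super_def
    by (subst complete_sym_hom[OF gamma_shift_hom, of c mconst mconst])
       (simp_all add: gamma_shift_def msubst_mconst[OF mconst_hom])
  also have "\<dots> = complete_sym mconst (\<lambda>k. truncate p (gamma_shift c (mvar (Pgen k)))) r"
    by (rule complete_sym_hom[OF truncate_hom]) (simp add: truncate_def msubst_mconst[OF mconst_hom])
  finally show ?thesis
    unfolding eq .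
qed

text \<open>The shift by \<open>- j\<close> and the one inside \<open>h_double\<close> compose to
  the shift by \<open>l ! i - i - 1\<close>, which does not depend on \<open>j\<close>. So row
  \<open>i\<close> of the Jacobi-Trudi matrix belongs to the grid column \<open>l ! i - i\<close>.
  The bound on \<open>p\<close> keeps the variables affected by this shift within the truncated
  power sums.\<close>

lemma truncate_double_schur:
  assumes "\<And>i. i < length l \<Longrightarrow> p \<le> int (l ! i) - int i" "p \<le> 1"
  shows "truncate p (double_schur l) = det (mat (length l) (length l)
    (\<lambda>(i, j). schur_entry mconst x_var a_var p 0 (int (l ! i) - int i) j))"
proof -
  interpret t: comm_ring_hom "truncate p" by (rule truncate_hom)
  interpret g: comm_ring_hom "gamma_shift c" for c by (rule gamma_shift_hom)
  have entry: "truncate p (gamma_a_pow (- int j) (h_double (int (l ! i) - int i + int j))) =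
      schur_entry mconst x_var a_var p 0 (int (l ! i) - int i) j" if "i < length l" for i j
  proof -
    have c: "int (l ! i) - int i + int j - 1 + - int j = int (l ! i) - int i - 1" by simp
    have "truncate p (gamma_shift (int (l ! i) - int i - 1) (h_super (nat (int (l ! i) - int i + int j)))) =
      complete_sym mconst (\<lambda>m. (\<Sum>i\<in>{p..0}. x_var i ^ m) - (\<Sum>i\<in>{p..int (l ! i) - int i - 1}. a_var i ^ m))
        (nat (int (l ! i) - int i + int j))"
      by (rule truncate_h_super) (use assms(1)[OF that] assms(2) in auto)
    then show ?thesis
      by (simp add: h_double_def gamma_a_pow_eq gamma_shift_gamma_shift schur_entry_def super_complete_def
          g.hom_zero t.hom_zero algebra_simps)
  qed
  have "truncate p (double_schur l) = det (map_mat (truncate p) (mat (length l) (length l)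
       (\<lambda>(i, j). gamma_a_pow (- int j) (h_double (int (l ! i) - int i + int j)))))"
    unfolding double_schur_def by (rule t.hom_det[symmetric])
  also have "map_mat (truncate p) (mat (length l) (length l)
       (\<lambda>(i, j). gamma_a_pow (- int j) (h_double (int (l ! i) - int i + int j)))) =
      mat (length l) (length l) (\<lambda>(i, j). schur_entry mconst x_var a_var p 0 (int (l ! i) - int i) j)"
    by (rule eq_matI) (auto simp: entry)
  finally show ?thesis .
qed

section \<open>Partitions and the positions of the pipes\<close>

definition shape :: "nat \<Rightarrow> lab list \<Rightarrow> nat list" where
  "shape c ts = path_rows c (map (\<lambda>t. t \<noteq> None) (rev ts))"

text \<open>The part recorded at a pipe is \<open>c\<close> minus the number of columns without pipe
  to its east. For \<open>c = n\<close> and the columns \<open>1 - n..n\<close> the constant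
  vanishes, and the part minus its index is the column of the pipe. The assumption keeps the natural
  subtraction in \<open>path_rows\<close> from stopping at 0.\<close>

lemma shape_positions:
  assumes "length ts \<le> c + length (labels ts)"
  shows "length (shape c ts) = length (labels ts) \<and> (\<forall>i<length (labels ts).
    int (shape c ts ! i) = int c - (l + int (length ts) - 1) + rev (positions l ts) ! i + int i)"
  using assms
proof (induction ts arbitrary: c rule: rev_induct)
  case (snoc t ts)
  have le: "length (labels ts) \<le> length ts"
    by (induction ts rule: labels.induct) auto
  show ?case
  proof (cases t)
    case None
    then have c: "c \<noteq> 0" using snoc.prems le by auto
    have sh: "shape c (ts @ [t]) = shape (c - 1) ts"
      by (simp add: None shape_def)
    show ?thesis
      unfolding sh using snoc.IH[of "c - 1"] snoc.prems None c
      by (simp add: positions_append of_nat_diff algebra_simps)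
  next
    case (Some k)
    have sh: "shape c (ts @ [t]) = c # shape c ts"
      by (simp add: Some shape_def)
    show ?thesis
      unfolding sh using snoc.IH[of c] snoc.prems Some
      by (auto simp: positions_append nth_Cons algebra_simps split: nat.splits)
  qed
qed (simp add: shape_def)

lemma positions_map_Some: "positions c (map Some ls) = [c..c + int (length ls) - 1]"
  by (induction ls arbitrary: c) (auto simp: upto_rec1 algebra_simps)

text \<open>The pipes in the columns \<open>p..-n\<close> give the last rows of the determinant.
  Their first \<open>n\<close> entries have negative degree and vanish, and the rest is a
  unitriangular block. The remaining \<open>n\<close> by \<open>n\<close> block is the Jacobi-Trudi
  matrix of the shape.\<close>

lemma top_rows_eq_truncate:
  assumes "p \<le> 1 - int n" "length ts = 2 * n"
  shows "top_rows p 0 x_var (map a_var [p..int n]) (map Some [p..- int n] @ ts) =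
    (if labels ts = [1 - int n..0] then truncate p (double_schur (shape n ts)) else 0)"
proof -
  have split: "[p..0] = [p..- int n] @ [1 - int n..0]"
    using upto_append[of p "- int n" 0] assms by simp
  show ?thesis
  proof (cases "labels ts = [1 - int n..0]")
    case False
    then show ?thesis
      using top_rows_vanish[of p 0 "map Some [p..- int n] @ ts" x_var "map a_var [p..int n]"] split assms by simp
  next
    case True
    interpret schur_entries mconst x_var a_var p
      by (rule schur_entries.intro[OF mconst_hom])
    let ?ds = "rev (positions (1 - int n) ts)" and ?M = "nat (1 - int n - p)"
    have len: "length (labels ts) = n" by (simp add: True)
    have sh: "length (shape n ts) = n" "\<And>i. i < n \<Longrightarrow> int (shape n ts ! i) = ?ds ! i + int i"
      using shape_positions[of ts n "1 - int n"] assms(2) by (auto simp: len)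
    have ds: "p \<le> ?ds ! i" if "i < n" for i
      using positions_bounds[of "?ds ! i" "1 - int n" ts] nth_mem[of i ?ds] that assms(1) len by simp
    have pos: "positions p (map Some [p..- int n] @ ts) = [p..- int n] @ positions (1 - int n) ts"
      using assms(1) by (simp add: positions_append positions_map_Some)
    have low: "rev [p..- int n] ! i = - int n - int i" if "i < ?M" for i
      using that by (simp add: rev_nth)
    let ?A = "mat n n (\<lambda>(i, j). ent 0 (?ds ! i) j)"
    let ?B = "mat n ?M (\<lambda>(i, j). ent 0 (?ds ! i) (j + n))"
    let ?D = "mat ?M ?M (\<lambda>(i, j). ent 0 (- int n - int i) (j + n))"
    have "top_rows p 0 x_var (map a_var [p..int n]) (map Some [p..- int n] @ ts) =
        det_rows (map (ent 0) ([p..- int n] @ positions (1 - int n) ts))"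
      unfolding pos[symmetric]
      by (rule top_rows_eq_det) (use assms True split in auto)
    also have "\<dots> = det (four_block_mat ?A ?B (0\<^sub>m ?M n) ?D)"
      unfolding det_rows_def
    proof (intro arg_cong[of _ _ det] eq_matI)
      fix i j
      assume "i < dim_row (four_block_mat ?A ?B (0\<^sub>m ?M n) ?D)" "j < dim_col (four_block_mat ?A ?B (0\<^sub>m ?M n) ?D)"
      then have ij: "i < n + ?M" "j < n + ?M" by auto
      have "rev (map (ent 0) ([p..- int n] @ positions (1 - int n) ts)) ! i =
          (if i < n then ent 0 (?ds ! i) else ent 0 (- int n - int (i - n)))"
        using ij low[of "i - n"] by (simp add: nth_append rev_map len)
      then show "mat (length (map (ent 0) ([p..- int n] @ positions (1 - int n) ts)))
           (length (map (ent 0) ([p..- int n] @ positions (1 - int n) ts)))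
           (\<lambda>(i, j). (rev (map (ent 0) ([p..- int n] @ positions (1 - int n) ts)) ! i) j) $$ (i, j) =
         four_block_mat ?A ?B (0\<^sub>m ?M n) ?D $$ (i, j)"
        using ij by (auto simp: len entry_low(1))
    qed (auto simp: len)
    also have "\<dots> = det ?A * det ?D"
      by (rule det_four_block_mat_lower_left_zero[of _ n _ ?M]) auto
    also have "det ?D = 1"
      by (subst det_upper_triangular[of _ ?M])
         (auto simp: upper_triangular_def prod_list_diag_prod entry_low intro!: prod.neutral)
    also have "det ?A * 1 = truncate p (double_schur (shape n ts))"
    proof -
      have "?A = mat (length (shape n ts)) (length (shape n ts))
          (\<lambda>(i, j). ent 0 (int (shape n ts ! i) - int i) j)"
        by (rule eq_matI) (auto simp: sh)
      then show ?thesis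
        using truncate_double_schur[of "shape n ts" p] assms(1) ds sh by simp
    qed
    finally show ?thesis using True by simp
  qed
qed

section \<open>Power series compared on monomials without variables of index below
  \<open>p\<close>\<close>

definition above :: "int \<Rightarrow> xa monomial \<Rightarrow> bool" where
  "above p m \<longleftrightarrow> (\<forall>i<p. Poly_Mapping.lookup m (Xv i) = 0 \<and> Poly_Mapping.lookup m (Av i) = 0)"

definition agree :: "int \<Rightarrow> xa mser \<Rightarrow> xa mser \<Rightarrow> bool" where
  "agree p f g \<longleftrightarrow> (\<forall>m. above p m \<longrightarrow> coeff f m = coeff g m)"

lemma agree_refl: "agree p f f"
  by (simp add: agree_def)

lemma agree_add: "agree p f g \<Longrightarrow> agree p f' g' \<Longrightarrow> agree p (f + f') (g + g')"
  by (simp add: agree_def plus_mser_def)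

text \<open>Factors of a monomial without low variables have no low variables either, so the
  convolution only uses coefficients on which the series agree.\<close>

lemma agree_mult:
  assumes "agree p f g" "agree p f' g'"
  shows "agree p (f * f') (g * g')"
  unfolding agree_def
proof (intro allI impI)
  fix m assume m: "above p m"
  have "above p s \<and> above p t" if "(s, t) \<in> splits m" for s t
    using m that by (auto simp: above_def splits_def lookup_add)
  then show "coeff (f * f') m = coeff (g * g') m"
    using assms by (auto simp: times_mser_def agree_def intro!: sum.cong)
qed

lemma agree_sum: "(\<And>i. i \<in> A \<Longrightarrow> agree p (f i) (g i)) \<Longrightarrow> agree p (sum f A) (sum g A)"
  by (induction A rule: infinite_finite_induct) (auto simp: agree_refl agree_add)

lemma agree_prod: "(\<And>i. i \<in> A \<Longrightarrow> agree p (f i) (g i)) \<Longrightarrow> agree p (prod f A) (prod g A)"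
  by (induction A rule: infinite_finite_induct) (auto simp: agree_refl agree_mult)

lemma agree_power: "agree p f g \<Longrightarrow> agree p (f ^ k) (g ^ k)"
  by (induction k) (auto simp: agree_refl agree_mult)

lemma agree_double_power_sum:
  "agree p (double_power_sum k) (ser_of (\<Sum>i\<in>{p..0}. x_var i ^ k - a_var i ^ k))"
  unfolding agree_def
proof (intro allI impI)
  fix m assume m: "above p m"
  have zero: "coeff (ser_of (x_var i ^ k - a_var i ^ k)) m = 0" if "i < p" for i
  proof (cases "k = 0")
    case False
    have "m \<noteq> Poly_Mapping.single (Xv i) k" "m \<noteq> Poly_Mapping.single (Av i) k"
      using m that False by (auto simp: above_def)
    then show ?thesis
      by (auto simp: ser_of_def mvar_power lookup_minus lookup_single when_def)
  qed (simp add: ser_of_def)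
  have "coeff (double_power_sum k) m =
      (\<Sum>i\<in>{i \<in> {..0}. coeff (ser_of (x_var i ^ k - a_var i ^ k)) m \<noteq> 0}. coeff (ser_of (x_var i ^ k - a_var i ^ k)) m)"
    by (simp add: double_power_sum_def ser_sum_def)
  also have "\<dots> = (\<Sum>i\<in>{p..0}. coeff (ser_of (x_var i ^ k - a_var i ^ k)) m)"
    by (rule sum.mono_neutral_left) (use zero not_le in fastforce)+
  also have "\<dots> = coeff (ser_of (\<Sum>i\<in>{p..0}. x_var i ^ k - a_var i ^ k)) m"
    by (simp add: ser_of_def lookup_sum)
  finally show "coeff (double_power_sum k) m = coeff (ser_of (\<Sum>i\<in>{p..0}. x_var i ^ k - a_var i ^ k)) m" .
qed

lemma agree_truncate: "agree p (dsym_ser P) (ser_of (truncate p P))"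
proof -
  have "ser_of (truncate p P) = msubst ser_const (\<lambda>g. ser_of
      (case g of Pgen k \<Rightarrow> \<Sum>i\<in>{p..0}. x_var i ^ k - a_var i ^ k | Agen i \<Rightarrow> a_var i)) P"
    unfolding truncate_def by (rule hom_msubst[OF ser_of_hom]) (simp add: ser_const_eq)
  then show ?thesis
    unfolding dsym_ser_def msubst_def
    by (auto intro!: agree_sum agree_mult agree_prod agree_power agree_double_power_sum
        split: dgen.split simp: agree_refl)
qed

lemma back_stable_eqI:
  assumes "\<And>p q. p \<le> p0 \<Longrightarrow> q0 \<le> q \<Longrightarrow> agree p (ser_of (double_schubert_interval p q w)) F"
  shows "back_stable_double_schubert w = F"
  unfolding back_stable_double_schubert_def
proof (rule the_equality)
  have ev: "\<forall>\<^sub>F (p, q) in at_bot \<times>\<^sub>F at_top. coeff (ser_of (double_schubert_interval p q w)) m = coeff F m" for m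
  proof -
    define K where "K = {i. Xv i \<in> Poly_Mapping.keys m \<or> Av i \<in> Poly_Mapping.keys m}"
    have "K = Xv -` Poly_Mapping.keys m \<union> Av -` Poly_Mapping.keys m"
      by (auto simp: K_def)
    then have fin: "finite K"
      by (simp add: finite_vimageI inj_def)
    \<comment> \<open>At most \<open>p0\<close> and at most every index occurring in
      \<open>m\<close>.\<close>
    define p1 where "p1 = Min (insert p0 K)"
    have "above p m" if "p \<le> p1" for p
      unfolding above_def
    proof (intro allI impI)
      fix i assume "i < p"
      then have "i \<notin> K"
        using that Min_le[of "insert p0 K" i] fin by (auto simp: p1_def)
      then show "Poly_Mapping.lookup m (Xv i) = 0 \<and> Poly_Mapping.lookup m (Av i) = 0"
        by (auto simp: K_def in_keys_iff)
    qed
    moreover have "p1 \<le> p0"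
      using fin by (simp add: p1_def)
    ultimately have coeff: "coeff (ser_of (double_schubert_interval p q w)) m = coeff F m" if "p \<le> p1" "q0 \<le> q" for p q
      using assms[of p q] that by (auto simp: agree_def)
    show ?thesis
      unfolding eventually_prod_filter
      by (rule exI[of _ "\<lambda>p. p \<le> p1"], rule exI[of _ "\<lambda>q. q0 \<le> q"])
         (auto simp: coeff eventually_le_at_bot eventually_ge_at_top)
  qed
  then show "\<forall>m. \<forall>\<^sub>F (p, q) in at_bot \<times>\<^sub>F at_top. coeff (ser_of (double_schubert_interval p q w)) m = coeff F m"
    by blast
  fix G assume G: "\<forall>m. \<forall>\<^sub>F (p, q) in at_bot \<times>\<^sub>F at_top. coeff (ser_of (double_schubert_interval p q w)) m = coeff G m"
  show "G = F"
  proof (rule mser_eqI)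
    fix m
    have "\<forall>\<^sub>F (p :: int, q :: int) in at_bot \<times>\<^sub>F at_top. coeff G m = coeff F m"
      using eventually_conj[OF ev[of m] G[rule_format, of m]] by eventually_elim auto
    then have "\<forall>\<^sub>F z :: int \<times> int in at_bot \<times>\<^sub>F at_top. coeff G m = coeff F m"
      by (simp add: case_prod_unfold)
    then show "coeff G m = coeff F m"
      by (simp add: eventually_const_iff prod_filter_eq_bot)
  qed
qed

section \<open>Labelled tilings and rectangular bumpless pipedreams\<close>

fun north_label :: "tile \<Rightarrow> lab \<Rightarrow> lab \<Rightarrow> lab" where
  "north_label NW h s = h"
| "north_label Vertical h s = s"
| "north_label Crossing h s = s"
| "north_label _ h s = None"

fun east_label :: "tile \<Rightarrow> lab \<Rightarrow> lab \<Rightarrow> lab" where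
  "east_label SE h s = s"
| "east_label Horizontal h s = h"
| "east_label Crossing h s = h"
| "east_label _ h s = None"

definition fits :: "tile \<Rightarrow> lab \<Rightarrow> lab \<Rightarrow> bool" where
  "fits t h s \<longleftrightarrow> (west t \<longleftrightarrow> h \<noteq> None) \<and> (south t \<longleftrightarrow> s \<noteq> None)"

text \<open>The local form of reducedness. Its equivalence with at most one crossing per pair is a
  property of the whole tiling, shown in \<open>reduced_imp_crossed_le_1\<close> and
  \<open>crossed_le_1_imp_reduced\<close>.\<close>

definition fits_reduced :: "tile \<Rightarrow> lab \<Rightarrow> lab \<Rightarrow> bool" where
  "fits_reduced t h s \<longleftrightarrow> fits t h s \<and> (t = Crossing \<longrightarrow> the h < the s)"

definition tile_weight :: "'r::comm_ring_1 \<Rightarrow> 'r \<Rightarrow> tile \<Rightarrow> 'r" where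
  "tile_weight x a t = (if t = Empty then x - a else 1)"

lemma UNIV_tile: "UNIV = {Empty, NW, SE, Horizontal, Vertical, Crossing}"
  using tile.exhaust by blast

lemma finite_UNIV_tile: "finite (UNIV :: tile set)"
  by (simp add: UNIV_tile)

lemma row_transfer_Cons_sum:
  "row_transfer x (a # as) h (s # bs) e F = (\<Sum>t\<in>UNIV. if fits_reduced t h s
     then tile_weight x a t * row_transfer x as (east_label t h s) bs e (\<lambda>ts. F (north_label t h s # ts)) else 0)"
  by (cases h; cases s) (simp_all add: UNIV_tile fits_reduced_def fits_def tile_weight_def)

fun row_fits :: "tile list \<Rightarrow> lab \<Rightarrow> lab list \<Rightarrow> lab \<Rightarrow> bool" where
  "row_fits (t # \<tau>) h (s # bs) e \<longleftrightarrow> fits_reduced t h s \<and> row_fits \<tau> (east_label t h s) bs e"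
| "row_fits _ h _ e \<longleftrightarrow> h = e"

fun row_top :: "tile list \<Rightarrow> lab \<Rightarrow> lab list \<Rightarrow> lab list" where
  "row_top (t # \<tau>) h (s # bs) = north_label t h s # row_top \<tau> (east_label t h s) bs"
| "row_top _ h _ = []"

definition row_weight :: "'r::comm_ring_1 \<Rightarrow> 'r list \<Rightarrow> tile list \<Rightarrow> 'r" where
  "row_weight x as \<tau> = (\<Prod>(a, t)\<leftarrow>zip as \<tau>. tile_weight x a t)"

lemma sum_lists_Suc:
  fixes f :: "'z list \<Rightarrow> 'r::comm_monoid_add"
  shows "(\<Sum>zs | length zs = Suc m \<and> set zs \<subseteq> A. f zs) =
     (\<Sum>z\<in>A. \<Sum>zs | length zs = m \<and> set zs \<subseteq> A. f (z # zs))"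
proof -
  have eq: "{zs. length zs = Suc m \<and> set zs \<subseteq> A} =
      (\<lambda>p. fst p # snd p) ` (A \<times> {zs. length zs = m \<and> set zs \<subseteq> A})"
    by (auto simp: length_Suc_conv image_iff)
  have inj: "inj_on (\<lambda>p. fst p # snd p) B" for B :: "('z \<times> 'z list) set"
    by (auto simp: inj_on_def prod_eq_iff)
  show ?thesis
    unfolding eq sum.reindex[OF inj] by (simp add: comp_def sum.cartesian_product case_prod_unfold)
qed

lemma sum_lists_0: "(\<Sum>zs | length zs = 0 \<and> set zs \<subseteq> A. f zs) = f []"
proof -
  have "{zs. length zs = 0 \<and> set zs \<subseteq> A} = {[]}" by auto
  then show ?thesis by simp
qed

text \<open>The condition \<open>set \<tau> \<subseteq> UNIV\<close> gives the index set the form of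
  \<open>sum_lists_Suc\<close>.\<close>

lemma row_transfer_eq_sum:
  assumes "length bs = length as"
  shows "row_transfer x as h bs e F = (\<Sum>\<tau> | length \<tau> = length as \<and> set \<tau> \<subseteq> UNIV.
    if row_fits \<tau> h bs e then row_weight x as \<tau> * F (row_top \<tau> h bs) else 0)"
  using assms
proof (induction as arbitrary: bs h F)
  case Nil
  then show ?case by (cases "h = e") (auto simp: sum_lists_0[simplified] row_weight_def)
next
  case (Cons a as)
  then obtain s bs' where bs: "bs = s # bs'" "length bs' = length as" by (cases bs) auto
  show ?case
    unfolding bs(1) row_transfer_Cons_sum length_Cons sum_lists_Suc Cons.IH[OF bs(2)]
    by (rule sum.cong[OF refl])
       (auto simp: row_weight_def sum_distrib_left mult.assoc intro!: sum.cong)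
qed

fun rows_fit :: "tile list list \<Rightarrow> lab list \<Rightarrow> lab list \<Rightarrow> bool" where
  "rows_fit (\<tau> # T) bs (e # es) \<longleftrightarrow> row_fits \<tau> None bs e \<and> rows_fit T (row_top \<tau> None bs) es"
| "rows_fit _ bs _ \<longleftrightarrow> True"

fun rows_top :: "tile list list \<Rightarrow> lab list \<Rightarrow> lab list" where
  "rows_top (\<tau> # T) bs = rows_top T (row_top \<tau> None bs)"
| "rows_top [] bs = bs"

lemma length_row_top: "length \<tau> = length bs \<Longrightarrow> length (row_top \<tau> h bs) = length bs"
  by (induction \<tau> h bs rule: row_top.induct) auto

lemma rows_transfer_eq_sum:
  assumes "length bs = length as"
  shows "rows_transfer as rs bs F = (\<Sum>T | length T = length rs \<and> set T \<subseteq> {\<tau>. length \<tau> = length as \<and> set \<tau> \<subseteq> UNIV}.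
    if rows_fit T bs (map snd rs) then (\<Prod>(r, \<tau>)\<leftarrow>zip rs T. row_weight (fst r) as \<tau>) * F (rows_top T bs) else 0)"
  using assms
proof (induction rs arbitrary: bs)
  case Nil
  show ?case
    unfolding list.size(3) sum_lists_0 by simp
next
  case (Cons r rs)
  obtain x e where r: "r = (x, e)" by fastforce
  have IH: "rows_transfer as rs (row_top \<tau> None bs) F =
    (\<Sum>T | length T = length rs \<and> set T \<subseteq> {\<tau>. length \<tau> = length as \<and> set \<tau> \<subseteq> UNIV}.
    if rows_fit T (row_top \<tau> None bs) (map snd rs)
    then (\<Prod>(r, \<tau>)\<leftarrow>zip rs T. row_weight (fst r) as \<tau>) * F (rows_top T (row_top \<tau> None bs)) else 0)"
    if "length \<tau> = length as" for \<tau>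
    using Cons.IH[of "row_top \<tau> None bs"] length_row_top[of \<tau> bs] Cons.prems that by simp
  have "rows_transfer as (r # rs) bs F = (\<Sum>\<tau> | length \<tau> = length as \<and> set \<tau> \<subseteq> UNIV.
      if row_fits \<tau> None bs e then row_weight x as \<tau> * rows_transfer as rs (row_top \<tau> None bs) F else 0)"
    by (simp add: r row_transfer_eq_sum[OF Cons.prems])
  also have "\<dots> = (\<Sum>\<tau> | length \<tau> = length as \<and> set \<tau> \<subseteq> UNIV.
      \<Sum>T | length T = length rs \<and> set T \<subseteq> {\<tau>. length \<tau> = length as \<and> set \<tau> \<subseteq> UNIV}.
      if rows_fit (\<tau> # T) bs (map snd (r # rs))
      then (\<Prod>(r, \<tau>)\<leftarrow>zip (r # rs) (\<tau> # T). row_weight (fst r) as \<tau>) * F (rows_top (\<tau> # T) bs) else 0)"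
    by (rule sum.cong[OF refl]) (auto simp: IH r sum_distrib_left mult.assoc intro!: sum.cong)
  finally show ?case
    unfolding length_Cons sum_lists_Suc .
qed

text \<open>\<open>edge_labels t b r c\<close> are the labels of the west and the south edge of the square in row
  \<open>r\<close>, counted from the bottom, and column \<open>c\<close>, both starting at \<open>0\<close>.\<close>

function edge_labels :: "(nat \<Rightarrow> nat \<Rightarrow> tile) \<Rightarrow> (nat \<Rightarrow> lab) \<Rightarrow> nat \<Rightarrow> nat \<Rightarrow> lab \<times> lab" where
  "edge_labels t b r c =
    (case c of 0 \<Rightarrow> None
       | Suc c' \<Rightarrow> (case edge_labels t b r c' of (h, s) \<Rightarrow> east_label (t r c') h s),
     case r of 0 \<Rightarrow> b c
       | Suc r' \<Rightarrow> (case edge_labels t b r' c of (h, s) \<Rightarrow> north_label (t r' c) h s))"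
  by auto
termination by (relation "measure (\<lambda>(t, b, r, c). r + c)") auto

declare edge_labels.simps [simp del]

context
  fixes t :: "nat \<Rightarrow> nat \<Rightarrow> tile" and b :: "nat \<Rightarrow> lab"
begin

definition west_label :: "nat \<Rightarrow> nat \<Rightarrow> lab" where "west_label r c = fst (edge_labels t b r c)"
definition south_label :: "nat \<Rightarrow> nat \<Rightarrow> lab" where "south_label r c = snd (edge_labels t b r c)"

lemma west_label_0 [simp]: "west_label r 0 = None"
  by (simp add: west_label_def edge_labels.simps)

lemma south_label_0 [simp]: "south_label 0 c = b c"
  by (simp add: south_label_def edge_labels.simps)

lemma west_label_Suc: "west_label r (Suc c) = east_label (t r c) (west_label r c) (south_label r c)"
  by (simp add: west_label_def south_label_def edge_labels.simps[of t b r "Suc c"] case_prod_unfold)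

lemma south_label_Suc: "south_label (Suc r) c = north_label (t r c) (west_label r c) (south_label r c)"
  by (simp add: west_label_def south_label_def edge_labels.simps[of t b "Suc r" c] case_prod_unfold)

lemma row_fits_iff:
  assumes "c \<le> N"
  shows "row_fits (map (t r) [c..<N]) (west_label r c) (map (south_label r) [c..<N]) e \<longleftrightarrow>
      (\<forall>c'\<in>{c..<N}. fits_reduced (t r c') (west_label r c') (south_label r c')) \<and> west_label r N = e"
  using assms
proof (induction "N - c" arbitrary: c)
  case (Suc d)
  then have c: "[c..<N] = c # [Suc c..<N]" "{c..<N} = insert c {Suc c..<N}"
    by (auto simp: upt_conv_Cons)
  show ?case
    unfolding c using Suc(1)[of "Suc c"] Suc(2) by (auto simp: west_label_Suc)
qed auto

lemma row_top_eq:
  assumes "c \<le> N"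
  shows "row_top (map (t r) [c..<N]) (west_label r c) (map (south_label r) [c..<N]) = map (south_label (Suc r)) [c..<N]"
  using assms
proof (induction "N - c" arbitrary: c)
  case (Suc d)
  then have c: "[c..<N] = c # [Suc c..<N]"
    by (auto simp: upt_conv_Cons)
  show ?case
    unfolding c using Suc(1)[of "Suc c"] Suc(2) by (auto simp: west_label_Suc south_label_Suc)
qed auto

lemma rows_fit_iff:
  assumes "r \<le> M"
  shows "rows_fit (map (\<lambda>r. map (t r) [0..<N]) [r..<M]) (map (south_label r) [0..<N]) (map ex [r..<M]) \<longleftrightarrow>
      (\<forall>r'\<in>{r..<M}. (\<forall>c<N. fits_reduced (t r' c) (west_label r' c) (south_label r' c)) \<and> west_label r' N = ex r')"
  using assms
proof (induction "M - r" arbitrary: r)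
  case (Suc d)
  then have r: "[r..<M] = r # [Suc r..<M]" "{r..<M} = insert r {Suc r..<M}"
    by (auto simp: upt_conv_Cons)
  show ?case
    unfolding r using Suc(1)[of "Suc r"] Suc(2) row_fits_iff[of 0 N r] row_top_eq[of 0 N r] by auto
qed auto

lemma rows_top_eq:
  assumes "r \<le> M"
  shows "rows_top (map (\<lambda>r. map (t r) [0..<N]) [r..<M]) (map (south_label r) [0..<N]) = map (south_label M) [0..<N]"
  using assms
proof (induction "M - r" arbitrary: r)
  case (Suc d)
  then have r: "[r..<M] = r # [Suc r..<M]"
    by (auto simp: upt_conv_Cons)
  show ?case
    unfolding r using Suc(1)[of "Suc r"] Suc(2) row_top_eq[of 0 N r] by auto
qed auto

end

section \<open>Reducedness through the order of two labels in a word\<close>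

fun before :: "int \<Rightarrow> int \<Rightarrow> int list \<Rightarrow> bool" where
  "before k l [] \<longleftrightarrow> False"
| "before k l (x # xs) \<longleftrightarrow> x = k \<and> l \<in> set xs \<or> before k l xs"

lemma before_append:
  "before k l (u @ v) \<longleftrightarrow> before k l u \<or> before k l v \<or> k \<in> set u \<and> l \<in> set v"
  by (induction u) auto

lemma before_imp_mem: "before k l w \<Longrightarrow> k \<in> set w \<and> l \<in> set w"
  by (induction w) auto

lemma before_swap:
  assumes "distinct (u @ h # s # v)"
  shows "before k l (u @ s # h # v) \<longleftrightarrow>
    (if {k, l} = {h, s} \<and> k \<noteq> l then \<not> before k l (u @ h # s # v) else before k l (u @ h # s # v))"
  using assms by (auto simp: before_append doubleton_eq_iff dest: before_imp_mem)

lemma before_adjacent: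
  assumes "distinct (u @ h # s # v)"
  shows "before h s (u @ h # s # v)" "\<not> before s h (u @ h # s # v)"
  using assms by (auto simp: before_append dest: before_imp_mem)

lemma before_sorted: "sorted_wrt (<) w \<Longrightarrow> k \<in> set w \<Longrightarrow> l \<in> set w \<Longrightarrow> k < l \<Longrightarrow> before k l w"
  by (induction w) auto

lemma sorted_if_before:
  assumes "distinct w" "\<And>k l. k \<in> set w \<Longrightarrow> l \<in> set w \<Longrightarrow> k < l \<Longrightarrow> before k l w"
  shows "sorted_wrt (<) w"
  using assms
proof (induction w)
  case (Cons x w)
  have "x < y" if "y \<in> set w" for y
  proof (rule ccontr)
    assume "\<not> x < y"
    moreover have "y \<noteq> x" using that Cons.prems(1) by auto
    ultimately have "before y x (x # w)" using that by (intro Cons.prems(2)) simp_all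
    then show False using Cons.prems(1) before_imp_mem[of y x w] \<open>y \<noteq> x\<close> by simp
  qed
  moreover have "sorted_wrt (<) w"
  proof (rule Cons.IH)
    fix k l assume "k \<in> set w" "l \<in> set w" "k < l"
    then show "before k l w" using Cons.prems(2)[of k l] Cons.prems(1) by (cases "k = x") simp_all
  qed (use Cons.prems in auto)
  ultimately show ?case by simp
qed simp

lemma fits_labels:
  assumes "fits t h s"
  shows "t \<noteq> Crossing \<Longrightarrow> labels [north_label t h s, east_label t h s] = labels [h, s]"
    and "t = Crossing \<Longrightarrow> \<exists>k l. h = Some k \<and> s = Some l"
    and "north t \<longleftrightarrow> north_label t h s \<noteq> None" "east t \<longleftrightarrow> east_label t h s \<noteq> None"
  using assms by (cases t; cases h; cases s; simp add: fits_def)+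

definition is_pair :: "int \<Rightarrow> int \<Rightarrow> lab \<Rightarrow> lab \<Rightarrow> bool" where
  "is_pair k l h s \<longleftrightarrow> h = Some k \<and> s = Some l \<or> h = Some l \<and> s = Some k"

locale tile_grid =
  fixes t :: "nat \<Rightarrow> nat \<Rightarrow> tile" and b :: "nat \<Rightarrow> lab" and M N :: nat
begin

abbreviation (input) "Hl \<equiv> west_label t b"
abbreviation (input) "Vl \<equiv> south_label t b"

text \<open>The labels on the staircase that separates the squares before \<open>(r, c)\<close> in reading order from
  the others, followed by those of the pipes that have left through the east boundary.\<close>

definition word :: "nat \<Rightarrow> nat \<Rightarrow> int list" where
  "word r c = labels (map (Vl (Suc r)) [0..<c] @ Hl r c # map (Vl r) [c..<N] @ map (\<lambda>r'. Hl r' N) (rev [0..<r]))"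

definition crossed :: "int \<Rightarrow> int \<Rightarrow> nat \<Rightarrow> nat \<Rightarrow> (nat \<times> nat) set" where
  "crossed k l r c = {(r', c'). c' < N \<and> (r' < r \<or> r' = r \<and> c' < c) \<and> t r' c' = Crossing \<and>
     is_pair k l (Hl r' c') (Vl r' c')}"

text \<open>Squares are read row by row from the bottom; \<open>(M, 0)\<close> is the state after
  the last square.\<close>

lemma reading_induct [consumes 3, case_names init square row]:
  assumes "r \<le> M" "c \<le> N" "r = M \<longrightarrow> c = 0"
    and "Q 0 0"
    and "\<And>r c. r < M \<Longrightarrow> c < N \<Longrightarrow> Q r c \<Longrightarrow> Q r (Suc c)"
    and "\<And>r. r < M \<Longrightarrow> Q r N \<Longrightarrow> Q (Suc r) 0"
  shows "Q r c"
proof -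
  have row: "Q r c" if "Q r 0" "r < M" "c \<le> N" for r c
    using that by (induction c) (auto intro: assms(5))
  have "Q r 0" if "r \<le> M" for r
    using that
  proof (induction r)
    case (Suc r)
    then show ?case using assms(6)[of r] row[of r N] by simp
  qed (rule assms(4))
  then show ?thesis
    using row assms(1-3) by (cases "r = M") auto
qed

lemma finite_crossed: "finite (crossed k l r c)"
  by (rule finite_subset[of _ "{..r} \<times> {..<N}"]) (auto simp: crossed_def)

lemma crossed_start: "crossed k l 0 0 = {}"
  by (simp add: crossed_def)

lemma crossed_row: "crossed k l (Suc r) 0 = crossed k l r N"
  by (auto simp: crossed_def less_Suc_eq)

lemma crossed_square:
  assumes "c < N"
  shows "crossed k l r (Suc c) = (if t r c = Crossing \<and> is_pair k l (Hl r c) (Vl r c)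
    then insert (r, c) (crossed k l r c) else crossed k l r c)"
  using assms by (auto simp: crossed_def less_Suc_eq)

lemma crossed_new: "(r, c) \<notin> crossed k l r c"
  by (simp add: crossed_def)

lemma word_row: "word (Suc r) 0 = word r N"
proof -
  have "map (\<lambda>r'. Hl r' N) (rev [0..<Suc r]) = Hl r N # map (\<lambda>r'. Hl r' N) (rev [0..<r])"
    by simp
  then show ?thesis
    unfolding word_def by simp
qed

text \<open>Reading a square replaces its west and south edges on the staircase by its north and
  east edges. Except at a crossing, these carry the same labels in the same order.\<close>

lemma word_square:
  assumes "c < N" "fits (t r c) (Hl r c) (Vl r c)"
  obtains u v where "word r c = u @ labels [Hl r c, Vl r c] @ v"
    and "word r (Suc c) = u @ (if t r c = Crossing then labels [Vl r c, Hl r c] else labels [Hl r c, Vl r c]) @ v"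
proof -
  let ?u = "labels (map (Vl (Suc r)) [0..<c])"
  let ?w = "map (Vl r) [Suc c..<N] @ map (\<lambda>r'. Hl r' N) (rev [0..<r])"
  let ?v = "labels ?w"
  have eq: "map (Vl r) [c..<N] = Vl r c # map (Vl r) [Suc c..<N]"
    using assms(1) by (simp add: upt_conv_Cons)
  have split: "labels (ps @ x # y # qs) = labels ps @ labels [x, y] @ labels qs" for ps qs x y
    using labels_append[of ps "[x, y] @ qs"] labels_append[of "[x, y]" qs] by simp
  have f1: "word r c = ?u @ labels [Hl r c, Vl r c] @ ?v"
    unfolding word_def eq using split[of "map (Vl (Suc r)) [0..<c]" "Hl r c" "Vl r c" ?w]
    by (simp only: append_Cons)
  have f2: "word r (Suc c) = ?u @ labels [Vl (Suc r) c, Hl r (Suc c)] @ ?v"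
    unfolding word_def using split[of "map (Vl (Suc r)) [0..<c]" "Vl (Suc r) c" "Hl r (Suc c)" ?w]
    by (simp only: upt_Suc_append le0 map_append list.map append_assoc append_Cons append_Nil)
  have f3: "labels [Vl (Suc r) c, Hl r (Suc c)] =
      (if t r c = Crossing then labels [Vl r c, Hl r c] else labels [Hl r c, Vl r c])"
    using fits_labels(1)[OF assms(2)] by (simp add: west_label_Suc south_label_Suc)
  show thesis
    by (rule that[OF f1 f2[unfolded f3]])
qed

context
  assumes fits: "\<And>r c. r < M \<Longrightarrow> c < N \<Longrightarrow> fits (t r c) (Hl r c) (Vl r c)"
    and start: "sorted_wrt (<) (word 0 0)"
begin

lemma word_set:
  assumes "r \<le> M" "c \<le> N" "r = M \<longrightarrow> c = 0"
  shows "distinct (word r c) \<and> set (word r c) = set (word 0 0)"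
  using assms
proof (induction r c rule: reading_induct)
  case init
  then show ?case using start by (simp add: strict_sorted_iff)
next
  case (square r c)
  obtain u v where uv: "word r c = u @ labels [Hl r c, Vl r c] @ v"
    "word r (Suc c) = u @ (if t r c = Crossing then labels [Vl r c, Hl r c] else labels [Hl r c, Vl r c]) @ v"
    by (rule word_square[OF square(2) fits[OF square(1,2)]])
  have perm: "mset (labels [Vl r c, Hl r c]) = mset (labels [Hl r c, Vl r c])"
    by (cases "Hl r c"; cases "Vl r c") auto
  have "mset (word r (Suc c)) = mset (word r c)"
    unfolding uv by (simp add: perm del: labels.simps)
  then show ?case
    using square(3) mset_eq_imp_distinct_iff mset_eq_setD by metis
qed (simp add: word_row)

lemma crossing_square:
  assumes "r < M" "c < N" "t r c = Crossing"
  obtains u v h s where "Hl r c = Some h" "Vl r c = Some s"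
    "word r c = u @ h # s # v" "word r (Suc c) = u @ s # h # v" "distinct (u @ h # s # v)"
proof -
  obtain h s where hs: "Hl r c = Some h" "Vl r c = Some s"
    using fits_labels(2)[OF fits[OF assms(1,2)] assms(3)] by blast
  obtain u v where uv: "word r c = u @ labels [Hl r c, Vl r c] @ v"
    "word r (Suc c) = u @ (if t r c = Crossing then labels [Vl r c, Hl r c] else labels [Hl r c, Vl r c]) @ v"
    by (rule word_square[OF assms(2) fits[OF assms(1,2)]])
  have "distinct (word r c)"
    using word_set[of r c] assms by simp
  then show thesis
    using that[of h s u v] hs uv assms(3) by simp
qed

lemma before_square:
  assumes "r < M" "c < N" "k \<noteq> l"
  shows "before k l (word r (Suc c)) \<longleftrightarrow>
    (if t r c = Crossing \<and> is_pair k l (Hl r c) (Vl r c) then \<not> before k l (word r c) else before k l (word r c))"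
proof (cases "t r c = Crossing")
  case True
  obtain u v h s where hs: "Hl r c = Some h" "Vl r c = Some s"
    "word r c = u @ h # s # v" "word r (Suc c) = u @ s # h # v" "distinct (u @ h # s # v)"
    by (rule crossing_square[OF assms(1,2) True])
  have "is_pair k l (Some h) (Some s) \<longleftrightarrow> {k, l} = {h, s}"
    by (auto simp: is_pair_def doubleton_eq_iff)
  then show ?thesis
    using before_swap[OF hs(5), of k l] assms(3) True hs by simp
next
  case False
  obtain u v where "word r c = u @ labels [Hl r c, Vl r c] @ v"
    "word r (Suc c) = u @ (if t r c = Crossing then labels [Vl r c, Hl r c] else labels [Hl r c, Vl r c]) @ v"
    by (rule word_square[OF assms(2) fits[OF assms(1,2)]])
  with False show ?thesis by simp
qed

text \<open>The smaller label comes first initially, and exactly the crossings of the two pipes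
  exchange them.\<close>

lemma before_iff_even:
  assumes "r \<le> M" "c \<le> N" "r = M \<longrightarrow> c = 0"
    and kl: "k < l" "k \<in> set (word 0 0)" "l \<in> set (word 0 0)"
  shows "before k l (word r c) \<longleftrightarrow> even (card (crossed k l r c))"
  using assms(1-3)
proof (induction r c rule: reading_induct)
  case init
  then show ?case using before_sorted[OF start kl(2,3,1)] by (simp add: crossed_start)
next
  case (square r c)
  then show ?case
    using kl(1) crossed_new[of r c k l] by (auto simp: before_square crossed_square finite_crossed)
qed (simp add: word_row crossed_row)

text \<open>A second crossing of two pipes would be one in which the pipe with the larger label
  comes from the west, and conversely.\<close>

lemma reduced_imp_crossed_le_1:
  assumes reduced: "\<And>r c. r < M \<Longrightarrow> c < N \<Longrightarrow> fits_reduced (t r c) (Hl r c) (Vl r c)"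
    and "r \<le> M" "c \<le> N" "r = M \<longrightarrow> c = 0"
    and kl: "k < l" "k \<in> set (word 0 0)" "l \<in> set (word 0 0)"
  shows "card (crossed k l r c) = (if before k l (word r c) then 0 else 1)"
  using assms(2-4)
proof (induction r c rule: reading_induct)
  case init
  then show ?case using before_sorted[OF start kl(2,3,1)] by (simp add: crossed_start)
next
  case (square r c)
  show ?case
  proof (cases "t r c = Crossing \<and> is_pair k l (Hl r c) (Vl r c)")
    case True
    obtain u v h s where hs: "Hl r c = Some h" "Vl r c = Some s"
      "word r c = u @ h # s # v" "word r (Suc c) = u @ s # h # v" "distinct (u @ h # s # v)"
      by (rule crossing_square[OF square(1,2)]) (use True in auto)
    have "h < s"
      using reduced[OF square(1,2)] True hs by (simp add: fits_reduced_def)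
    then have "h = k" "s = l"
      using True hs kl(1) by (auto simp: is_pair_def)
    then have "before k l (word r c)"
      using before_adjacent(1)[OF hs(5)] hs(3) by simp
    then show ?thesis
      using True square crossed_new[of r c k l] kl(1)
      by (simp add: before_square crossed_square finite_crossed)
  next
    case False
    then have "(t r c = Crossing \<and> is_pair k l (Hl r c) (Vl r c)) = False" by blast
    then show ?thesis
      using square(3)
      by (simp only: crossed_square[OF square(2)] before_square[OF square(1,2) less_imp_neq[OF kl(1)]] if_False)
  qed
qed (simp add: word_row crossed_row)

lemma crossed_mono:
  assumes "r < M" "c < N" "t r c = Crossing" "is_pair k l (Hl r c) (Vl r c)"
  shows "insert (r, c) (crossed k l r c) \<subseteq> crossed k l M 0"
  using assms by (auto simp: crossed_def)

text \<open>If the larger label came from the west, the two labels would already be out of order, so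
  an odd number of earlier crossings would precede this one.\<close>

lemma crossed_le_1_imp_reduced:
  assumes "\<And>k l. k \<in> set (word 0 0) \<Longrightarrow> l \<in> set (word 0 0) \<Longrightarrow> k < l \<Longrightarrow> card (crossed k l M 0) \<le> 1"
    and rc: "r < M" "c < N"
  shows "fits_reduced (t r c) (Hl r c) (Vl r c)"
proof -
  have "the (Hl r c) < the (Vl r c)" if cr: "t r c = Crossing"
  proof -
    obtain u v h s where hs: "Hl r c = Some h" "Vl r c = Some s"
      "word r c = u @ h # s # v" "word r (Suc c) = u @ s # h # v" "distinct (u @ h # s # v)"
      by (rule crossing_square[OF rc cr])
    have mem: "h \<in> set (word 0 0)" "s \<in> set (word 0 0)"
      using word_set[of r c] rc hs(3) by auto
    have "h < s"
    proof (rule ccontr)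
      assume "\<not> h < s"
      then have sh: "s < h" using hs(5) by auto
      have "\<not> before s h (word r c)"
        using before_adjacent(2)[OF hs(5)] hs(3) by simp
      then have "odd (card (crossed s h r c))"
        using before_iff_even[of r c s h] rc sh mem by simp
      then have "1 \<le> card (crossed s h r c)"
        by (cases "card (crossed s h r c)") auto
      moreover have "card (insert (r, c) (crossed s h r c)) \<le> card (crossed s h M 0)"
        by (rule card_mono[OF finite_crossed crossed_mono]) (use rc cr hs in \<open>auto simp: is_pair_def\<close>)
      ultimately show False
        using assms(1)[OF mem(2,1) sh] crossed_new[of r c s h] by (simp add: finite_crossed)
    qed
    then show ?thesis by (simp add: hs)
  qed
  then show ?thesis
    using fits[OF rc] by (simp add: fits_reduced_def)
qed

end

end

text \<open>For \<open>r = n\<close> and for \<open>c = 2 * n\<close> this is a square just outside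
  the rectangle, in row 0 or in column \<open>n + 1\<close>, where exits are recorded.\<close>

definition square :: "nat \<Rightarrow> nat \<Rightarrow> nat \<Rightarrow> int \<times> int" where
  "square n r c = (int n - int r, 1 - int n + int c)"

lemma square_rect: "square n r c \<in> rect n \<longleftrightarrow> r < n \<and> c < 2 * n"
  by (auto simp: square_def rect_def)

lemma bij_betw_square: "bij_betw (\<lambda>(r, c). square n r c) ({..<n} \<times> {..<2 * n}) (rect n)"
  by (rule bij_betw_byWitness[of _ "\<lambda>(i, j). (nat (int n - i), nat (j + int n - 1))"])
     (auto simp: square_def rect_def)

lemma rectE:
  assumes "(i, j) \<in> rect n"
  obtains r c where "r < n" "c < 2 * n" "(i, j) = square n r c"
proof -
  have "(i, j) \<in> (\<lambda>(r, c). square n r c) ` ({..<n} \<times> {..<2 * n})"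
    using assms bij_betw_square[of n] by (simp add: bij_betw_def)
  then show thesis using that by auto
qed

lemma upto_eq_map_upt: "[1 - int n..int n] = map (\<lambda>c. 1 - int n + int c) [0..<2 * n]"
  by (rule nth_equalityI) auto

lemma rev_upto_eq_map_upt: "rev [1..int n] = map (\<lambda>r. int n - int r) [0..<n]"
  by (rule nth_equalityI) (auto simp: rev_nth)

section \<open>Edge labels and the pipes traced through a tiling\<close>

locale rect_tiling =
  fixes n :: nat and P :: "int \<times> int \<Rightarrow> tile"
begin

sublocale tile_grid "\<lambda>r c. P (square n r c)" "\<lambda>c. Some (1 - int n + int c)" n "2 * n" .

abbreviation (input) "T r c \<equiv> P (square n r c)"
abbreviation (input) "HL \<equiv> west_label (\<lambda>r c. P (square n r c)) (\<lambda>c. Some (1 - int n + int c))"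
abbreviation (input) "VL \<equiv> south_label (\<lambda>r c. P (square n r c)) (\<lambda>c. Some (1 - int n + int c))"

lemma north_square: "square n (Suc r) c = (int n - int r - 1, 1 - int n + int c)"
  and east_square: "square n r (Suc c) = (int n - int r, 1 - int n + int c + 1)"
  by (simp_all add: square_def)

text \<open>Together with \<open>enters_imp_labels\<close> this identifies computed labels with
  traced pipes, for any tiling. A label not on the boundary comes from a square with smaller
  \<open>r + c\<close>, whose tile tells which rule of \<open>enters\<close> applies.\<close>

lemma labels_imp_enters:
  shows "VL r c = Some k \<Longrightarrow> r \<le> n \<Longrightarrow> c < 2 * n \<Longrightarrow> enters n P k South (square n r c)"
    and "HL r c = Some k \<Longrightarrow> r < n \<Longrightarrow> c \<le> 2 * n \<Longrightarrow> enters n P k West (square n r c)"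
proof (induction "r + c" arbitrary: r c rule: less_induct)
  case less
  {
    case 1
    show ?case
    proof (cases r)
      case 0
      have "enters n P k South (int n, k)"
        by (rule enters.start) (use 1 0 in auto)
      moreover have "square n r c = (int n, k)"
        using 1 0 by (simp add: square_def)
      ultimately show ?thesis by simp
    next
      case (Suc r')
      have lab: "north_label (T r' c) (HL r' c) (VL r' c) = Some k"
        using 1 by (simp add: Suc south_label_Suc)
      have rect: "(int n - int r', 1 - int n + int c) \<in> rect n"
        using 1 Suc square_rect[of n r' c] by (simp add: square_def)
      have "\<exists>d. enters n P k d (square n r' c) \<and> (d, T r' c) \<in> {(South, Vertical), (South, Crossing), (West, NW)}"
        using lab less(1)[of r' c] less(2)[of r' c] 1 Suc by (cases "T r' c") auto
      then obtain d where "enters n P k d (square n r' c)"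
        "(d, T r' c) \<in> {(South, Vertical), (South, Crossing), (West, NW)}" by blast
      then show ?thesis
        unfolding Suc north_square unfolding square_def using rect by (intro enters.up)
    qed
  next
    case 2
    show ?case
    proof (cases c)
      case 0
      then show ?thesis using 2 by simp
    next
      case (Suc c')
      have lab: "east_label (T r c') (HL r c') (VL r c') = Some k"
        using 2 by (simp add: Suc west_label_Suc)
      have rect: "(int n - int r, 1 - int n + int c') \<in> rect n"
        using 2 Suc square_rect[of n r c'] by (simp add: square_def)
      have "\<exists>d. enters n P k d (square n r c') \<and> (d, T r c') \<in> {(West, Horizontal), (West, Crossing), (South, SE)}"
        using lab less(1)[of r c'] less(2)[of r c'] 2 Suc by (cases "T r c'") auto
      then obtain d where "enters n P k d (square n r c')"
        "(d, T r c') \<in> {(West, Horizontal), (West, Crossing), (South, SE)}" by blast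
      then show ?thesis
        unfolding Suc east_square unfolding square_def using rect by (intro enters.right)
    qed
  }
qed

lemma enters_imp_labels:
  assumes "enters n P k d z"
  shows "\<exists>r c. z = square n r c \<and>
    (if d = South then r \<le> n \<and> c < 2 * n \<and> VL r c = Some k else r < n \<and> c \<le> 2 * n \<and> HL r c = Some k)"
  using assms
proof (induction rule: enters.induct)
  case start
  then show ?case
    by (intro exI[of _ 0] exI[of _ "nat (k + int n - 1)"]) (auto simp: square_def)
next
  case (up d i j)
  then obtain r c where rc: "(i, j) = square n r c"
    "if d = South then r \<le> n \<and> c < 2 * n \<and> VL r c = Some k else r < n \<and> c \<le> 2 * n \<and> HL r c = Some k"
    by blast
  have "r < n" "c < 2 * n" using up.hyps(2) square_rect[of n r c] rc(1) by auto
  moreover have "(i - 1, j) = square n (Suc r) c" using rc(1) by (simp add: square_def)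
  moreover have "VL (Suc r) c = Some k"
    using up.hyps(3) rc by (auto simp: south_label_Suc)
  ultimately show ?case by (intro exI[of _ "Suc r"] exI[of _ c]) auto
next
  case (right d i j)
  then obtain r c where rc: "(i, j) = square n r c"
    "if d = South then r \<le> n \<and> c < 2 * n \<and> VL r c = Some k else r < n \<and> c \<le> 2 * n \<and> HL r c = Some k"
    by blast
  have "r < n" "c < 2 * n" using right.hyps(2) square_rect[of n r c] rc(1) by auto
  moreover have "(i, j + 1) = square n r (Suc c)" using rc(1) by (simp add: square_def)
  moreover have "HL r (Suc c) = Some k"
    using right.hyps(3) rc by (auto simp: west_label_Suc)
  ultimately show ?case by (intro exI[of _ r] exI[of _ "Suc c"]) auto
qed

lemma square_eq_iff: "square n r c = square n r' c' \<longleftrightarrow> r = r' \<and> c = c'"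
  by (auto simp: square_def)

lemma enters_south_iff:
  "r \<le> n \<Longrightarrow> c < 2 * n \<Longrightarrow> enters n P k South (square n r c) \<longleftrightarrow> VL r c = Some k"
  using enters_imp_labels[of k South "square n r c"] labels_imp_enters(1)[of r c k]
  by (auto simp: square_eq_iff)

lemma enters_west_iff:
  "r < n \<Longrightarrow> c \<le> 2 * n \<Longrightarrow> enters n P k West (square n r c) \<longleftrightarrow> HL r c = Some k"
  using enters_imp_labels[of k West "square n r c"] labels_imp_enters(2)[of r c k]
  by (auto simp: square_eq_iff)

lemma edges_imp_fits:
  assumes "\<forall>i j. (i, j) \<in> rect n \<and> (i + 1, j) \<in> rect n \<longrightarrow> south (P (i, j)) = north (P (i + 1, j))"
    and "\<forall>i j. (i, j) \<in> rect n \<and> (i, j + 1) \<in> rect n \<longrightarrow> east (P (i, j)) = west (P (i, j + 1))"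
    and "\<forall>i\<in>{1..int n}. \<not> west (P (i, 1 - int n))"
    and "\<forall>j\<in>{1 - int n..int n}. south (P (int n, j))"
    and "r < n" "c < 2 * n"
  shows "fits (T r c) (HL r c) (VL r c)"
  using assms(5,6)
proof (induction "r + c" arbitrary: r c rule: less_induct)
  case less
  have "west (T r c) \<longleftrightarrow> HL r c \<noteq> None"
  proof (cases c)
    case 0
    then show ?thesis using assms(3) less.prems by (simp add: square_def)
  next
    case (Suc c')
    have "east (T r c') = west (T r c)"
      using assms(2)[rule_format, of "int n - int r" "1 - int n + int c'"] square_rect[of n r c'] square_rect[of n r c]
        less.prems Suc by (simp add: square_def algebra_simps)
    then show ?thesis
      using fits_labels(4)[OF less.hyps[of r c']] less.prems Suc by (simp add: west_label_Suc)
  qed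
  moreover have "south (T r c) \<longleftrightarrow> VL r c \<noteq> None"
  proof (cases r)
    case 0
    then show ?thesis using assms(4) less.prems by (simp add: square_def)
  next
    case (Suc r')
    have "south (T r c) = north (T r' c)"
      using assms(1)[rule_format, of "int n - int r" "1 - int n + int c"] square_rect[of n r' c] square_rect[of n r c]
        less.prems Suc by (simp add: square_def algebra_simps)
    then show ?thesis
      using fits_labels(3)[OF less.hyps[of r' c]] less.prems Suc by (simp add: south_label_Suc)
  qed
  ultimately show ?case by (simp add: fits_def)
qed

lemma fits_imp_edges:
  assumes fits: "\<And>r c. r < n \<Longrightarrow> c < 2 * n \<Longrightarrow> fits (T r c) (HL r c) (VL r c)"
  shows "(i, j) \<in> rect n \<Longrightarrow> (i + 1, j) \<in> rect n \<Longrightarrow> south (P (i, j)) = north (P (i + 1, j))"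
    and "(i, j) \<in> rect n \<Longrightarrow> (i, j + 1) \<in> rect n \<Longrightarrow> east (P (i, j)) = west (P (i, j + 1))"
    and "i \<in> {1..int n} \<Longrightarrow> \<not> west (P (i, 1 - int n))"
    and "j \<in> {1 - int n..int n} \<Longrightarrow> south (P (int n, j))"
proof -
  assume ij: "(i, j) \<in> rect n" "(i + 1, j) \<in> rect n"
  then obtain r c where rc: "r < n" "c < 2 * n" "(i + 1, j) = square n r c" by (elim rectE)
  then have sq: "(i, j) = square n (Suc r) c" by (simp add: square_def)
  then have "Suc r < n" using ij(1) square_rect by metis
  then show "south (P (i, j)) = north (P (i + 1, j))"
    unfolding sq rc(3) using fits[of "Suc r" c] fits_labels(3)[OF fits[OF rc(1,2)]] rc
    by (simp add: fits_def south_label_Suc del: south.simps north.simps)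
next
  assume ij: "(i, j) \<in> rect n" "(i, j + 1) \<in> rect n"
  then obtain r c where rc: "r < n" "c < 2 * n" "(i, j) = square n r c" by (elim rectE)
  then have sq: "(i, j + 1) = square n r (Suc c)" by (simp add: square_def)
  then have "Suc c < 2 * n" using ij(2) square_rect by metis
  then show "east (P (i, j)) = west (P (i, j + 1))"
    unfolding sq rc(3) using fits[of r "Suc c"] fits_labels(4)[OF fits[OF rc(1,2)]] rc
    by (simp add: fits_def west_label_Suc del: west.simps east.simps)
next
  assume "i \<in> {1..int n}"
  then have "(i, 1 - int n) = square n (nat (int n - i)) 0" "nat (int n - i) < n" "0 < 2 * n"
    by (auto simp: square_def)
  then show "\<not> west (P (i, 1 - int n))"
    using fits[of "nat (int n - i)" 0] by (simp add: fits_def del: west.simps)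
next
  assume "j \<in> {1 - int n..int n}"
  then have "(int n, j) = square n 0 (nat (j + int n - 1))" "nat (j + int n - 1) < 2 * n" "0 < n"
    by (auto simp: square_def)
  then show "south (P (int n, j))"
    using fits[of 0 "nat (j + int n - 1)"] by (simp add: fits_def del: south.simps)
qed

lemma crossings_eq: "crossings n P k l = (\<lambda>(r, c). square n r c) ` crossed k l n 0"
proof (intro equalityI subsetI)
  fix s assume s: "s \<in> crossings n P k l"
  then obtain r c where rc: "r < n" "c < 2 * n" "s = square n r c"
    by (cases s) (auto simp: crossings_def elim: rectE)
  then have "(r, c) \<in> crossed k l n 0"
    using s by (auto simp: crossings_def crossed_def is_pair_def enters_south_iff enters_west_iff)
  then show "s \<in> (\<lambda>(r, c). square n r c) ` crossed k l n 0"
    using rc by force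
next
  fix s assume "s \<in> (\<lambda>(r, c). square n r c) ` crossed k l n 0"
  then show "s \<in> crossings n P k l"
    by (auto simp: crossings_def crossed_def is_pair_def enters_south_iff enters_west_iff square_rect)
qed

lemma card_crossings: "card (crossings n P k l) = card (crossed k l n 0)"
  unfolding crossings_eq by (rule card_image) (auto simp: inj_on_def square_eq_iff)

lemma crossed_sym: "crossed k l r c = crossed l k r c"
  by (auto simp: crossed_def is_pair_def)

lemma word_start: "word 0 0 = [1 - int n..int n]"
proof -
  have "map (VL 0) [0..<2 * n] = map Some (map (\<lambda>c. 1 - int n + int c) [0..<2 * n])"
    by simp
  then show ?thesis
    unfolding word_def upto_eq_map_upt by (simp del: map_map)
qed

lemma sorted_word_start: "sorted_wrt (<) (word 0 0)"
  by (simp add: word_start)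

text \<open>The final staircase runs along the north boundary and then down the east boundary, so
  the exits appear in the order of the rows \<open>1..n\<close>.\<close>

lemma word_end:
  assumes "\<forall>r<n. HL r (2 * n) = Some (w (int n - int r))"
  shows "word n 0 = labels (map (VL n) [0..<2 * n]) @ map w [1..int n]"
proof -
  have "map (\<lambda>r. HL r (2 * n)) (rev [0..<n]) = map Some (map w (map (\<lambda>r. int n - int r) (rev [0..<n])))"
    using assms by simp
  also have "map (\<lambda>r. int n - int r) (rev [0..<n]) = [1..int n]"
    using rev_upto_eq_map_upt[of n] by (metis rev_map rev_rev_ident)
  finally have "map (\<lambda>r. HL r (2 * n)) (rev [0..<n]) = map Some (map w [1..int n])" .
  then show ?thesis
    unfolding word_def by (simp del: map_map)
qed

lemma exits_iff:
  assumes "w permutes {1..int n}"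
  shows "(\<forall>k\<in>{1..int n}. enters n P k West (inv_into UNIV w k, int n + 1)) \<longleftrightarrow>
    (\<forall>r<n. HL r (2 * n) = Some (w (int n - int r)))"
proof -
  have sq: "(int n - int r, int n + 1) = square n r (2 * n)" for r
    by (simp add: square_def)
  have w: "inv_into UNIV w (w i) = i" "w (inv_into UNIV w i) = i" for i
    using permutes_inverses[OF assms] by auto
  show ?thesis
  proof (intro iffI allI impI ballI)
    fix r assume "\<forall>k\<in>{1..int n}. enters n P k West (inv_into UNIV w k, int n + 1)" "r < n"
    moreover from this have "w (int n - int r) \<in> {1..int n}"
      using permutes_in_image[OF assms] by simp
    ultimately have "enters n P (w (int n - int r)) West (square n r (2 * n))"
      using w(1) sq by metis
    then show "HL r (2 * n) = Some (w (int n - int r))"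
      using \<open>r < n\<close> by (simp add: enters_west_iff)
  next
    fix k assume k: "\<forall>r<n. HL r (2 * n) = Some (w (int n - int r))" "k \<in> {1..int n}"
    define r where "r = nat (int n - inv_into UNIV w k)"
    have "inv_into UNIV w k \<in> {1..int n}"
      using permutes_in_image[OF permutes_inv[OF assms]] k(2) by simp
    then have r: "r < n" "inv_into UNIV w k = int n - int r"
      by (auto simp: r_def)
    then have "HL r (2 * n) = Some k"
      using k(1) w(2)[of k] by simp
    then show "enters n P k West (inv_into UNIV w k, int n + 1)"
      unfolding r(2) sq using r(1) by (simp add: enters_west_iff)
  qed
qed

text \<open>Both directions compare the first and the last word. Nonpositive pipes that cross
  nothing keep their order and reach the north boundary increasingly. Conversely, in a last word
  beginning with \<open>1 - n..0\<close> every nonpositive label precedes all larger ones, so by the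
  parity of crossings it has crossed none of them.\<close>

lemma rect_bpd_iff:
  assumes w: "w permutes {1..int n}" and ext: "P \<in> rect n \<rightarrow>\<^sub>E UNIV"
  shows "rect_bpd n w P \<longleftrightarrow>
    (\<forall>r<n. (\<forall>c<2 * n. fits_reduced (T r c) (HL r c) (VL r c)) \<and> HL r (2 * n) = Some (w (int n - int r))) \<and>
    labels (map (VL n) [0..<2 * n]) = [1 - int n..0]" (is "_ \<longleftrightarrow> ?good")
proof
  let ?top = "labels (map (VL n) [0..<2 * n])"
  have image: "set (map w [1..int n]) = {1..int n}"
    using permutes_image[OF w] by simp
  {
    assume bpd: "rect_bpd n w P"
    have fits: "fits (T r c) (HL r c) (VL r c)" if "r < n" "c < 2 * n" for r c
      by (rule edges_imp_fits) (use bpd that in \<open>simp_all add: rect_bpd_def del: south.simps north.simps west.simps east.simps\<close>)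
    have exits: "\<forall>r<n. HL r (2 * n) = Some (w (int n - int r))"
      using bpd exits_iff[OF w] by (simp add: rect_bpd_def)
    have none: "\<forall>k\<in>{1 - int n..0}. \<forall>l\<in>{1 - int n..int n}. k \<noteq> l \<longrightarrow> crossings n P k l = {}"
      using bpd unfolding rect_bpd_def by (elim conjE)
    have le1: "\<forall>k\<in>{1 - int n..int n}. \<forall>l\<in>{1 - int n..int n}. k \<noteq> l \<longrightarrow> card (crossings n P k l) \<le> 1"
      using bpd unfolding rect_bpd_def by (elim conjE)
    note wend = word_end[OF exits]
    have "distinct (word n 0)" and set: "set (word n 0) = {1 - int n..int n}"
      using word_set[OF fits sorted_word_start, of n 0] by (simp_all add: word_start)
    \<comment> \<open>No label is lost and the positive ones leave in the east, so exactly the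
      nonpositive ones are left for the north boundary.\<close>
    then have top: "distinct ?top" "set ?top \<inter> {1..int n} = {}" "set ?top \<union> {1..int n} = {1 - int n..int n}"
      unfolding wend using image by (simp_all del: set_map)
    have set_top: "set ?top = {1 - int n..0}"
    proof (intro equalityI subsetI)
      fix k assume "k \<in> set ?top"
      then have "k \<in> {1 - int n..int n}" "k \<notin> {1..int n}" using top(2,3) by blast+
      then show "k \<in> {1 - int n..0}" by simp
    next
      fix k assume "k \<in> {1 - int n..0}"
      then have "k \<in> {1 - int n..int n}" "k \<notin> {1..int n}" by auto
      then show "k \<in> set ?top" using top(3) by blast
    qed
    have "sorted_wrt (<) ?top"
    proof (rule sorted_if_before[OF top(1)])
      fix k l assume kl: "k \<in> set ?top" "l \<in> set ?top" "k < l"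
      then have mem: "k \<in> {1 - int n..0}" "l \<in> {1 - int n..int n}" using set_top by auto
      then have "crossings n P k l = {}"
        using none kl(3) by (metis less_irrefl)
      then have "card (crossed k l n 0) = 0"
        using card_crossings[of k l] by simp
      then have "before k l (word n 0)"
        using before_iff_even[OF fits sorted_word_start, of n 0 k l] kl(3) mem by (simp add: word_start)
      then show "before k l ?top"
        unfolding wend before_append using kl top(2) image by (auto dest!: before_imp_mem)
    qed
    then have "?top = [1 - int n..0]"
      using set_top by (intro sorted_distinct_set_unique) (auto simp: strict_sorted_iff)
    moreover have "fits_reduced (T r c) (HL r c) (VL r c)" if "r < n" "c < 2 * n" for r c
    proof (rule crossed_le_1_imp_reduced[OF fits sorted_word_start _ that])
      fix k l assume "k \<in> set (word 0 0)" "l \<in> set (word 0 0)" "k < l"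
      then have "card (crossings n P k l) \<le> 1"
        using le1 unfolding word_start by (metis less_irrefl set_upto)
      then show "card (crossed k l n 0) \<le> 1"
        by (simp add: card_crossings)
    qed
    ultimately show ?good using exits by blast
  }
  {
    assume good: ?good
    then have reduced: "fits_reduced (T r c) (HL r c) (VL r c)" if "r < n" "c < 2 * n" for r c
      using that by blast
    then have fits: "fits (T r c) (HL r c) (VL r c)" if "r < n" "c < 2 * n" for r c
      using that by (simp add: fits_reduced_def)
    from good have exits: "\<forall>r<n. HL r (2 * n) = Some (w (int n - int r))" and top: "?top = [1 - int n..0]"
      by blast+
    note wend = word_end[OF exits, unfolded top]
    have cr: "card (crossed k l n 0) = (if before k l (word n 0) then 0 else 1)"
      if "k < l" "k \<in> {1 - int n..int n}" "l \<in> {1 - int n..int n}" for k l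
      using reduced_imp_crossed_le_1[OF fits sorted_word_start reduced, of n 0 k l] that by (simp add: word_start)
    have le1: "card (crossings n P k l) \<le> 1"
      if "k \<noteq> l" "k \<in> {1 - int n..int n}" "l \<in> {1 - int n..int n}" for k l
      using that cr[of k l] cr[of l k] crossed_sym[of k l n 0] unfolding card_crossings by (cases "k < l") auto
    have empty: "crossings n P k l = {}" if kl: "k < l" "k \<in> {1 - int n..0}" "l \<in> {1 - int n..int n}" for k l
    proof -
      have "before k l (word n 0)"
      proof (cases "l \<le> 0")
        case True
        then show ?thesis
          unfolding wend before_append using before_sorted[of "[1 - int n..0]" k l] kl by simp
      next
        case False
        then have "l \<in> set (map w [1..int n])" unfolding image using kl by simp
        then show ?thesis
          unfolding wend before_append using kl by simp
      qed
      then have "crossed k l n 0 = {}"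
        using cr[of k l] kl finite_crossed[of k l n 0] by simp
      then show ?thesis by (simp add: crossings_eq)
    qed
    have sym: "crossings n P k l = crossings n P l k" for k l
      unfolding crossings_eq crossed_sym[of k l] ..
    have north: "\<exists>j. enters n P k South (0, j)" if "k \<in> {1 - int n..0}" for k
    proof -
      have mem: "Some k \<in> set ts" if "k \<in> set (labels ts)" for ts
        using that by (induction ts rule: labels.induct) auto
      have "Some k \<in> set (map (VL n) [0..<2 * n])"
        using that top by (intro mem) simp
      then obtain c where c: "c < 2 * n" "VL n c = Some k" by auto
      then have "enters n P k South (square n n c)"
        by (simp add: enters_south_iff)
      then show ?thesis by (auto simp: square_def)
    qed
    have none: "crossings n P k l = {}" if "k \<in> {1 - int n..0}" "l \<in> {1 - int n..int n}" "k \<noteq> l" for k l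
      using empty[of k l] empty[of l k] sym[of k l] that by (cases "k < l") auto
    note edges = fits_imp_edges[OF fits]
    show "rect_bpd n w P"
      unfolding rect_bpd_def exits_iff[OF w]
    proof (intro conjI)
      show "\<forall>i j. (i, j) \<in> rect n \<and> (i + 1, j) \<in> rect n \<longrightarrow> south (P (i, j)) = north (P (i + 1, j))"
        by (intro allI impI, elim conjE, rule edges(1))
      show "\<forall>i j. (i, j) \<in> rect n \<and> (i, j + 1) \<in> rect n \<longrightarrow> east (P (i, j)) = west (P (i, j + 1))"
        by (intro allI impI, elim conjE, rule edges(2))
      show "\<forall>i\<in>{1..int n}. \<not> west (P (i, 1 - int n))"
        by (intro ballI, rule edges(3))
      show "\<forall>j\<in>{1 - int n..int n}. south (P (int n, j))"
        by (intro ballI, rule edges(4))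
      show "\<forall>k\<in>{1 - int n..0}. \<exists>j. enters n P k South (0, j)"
        by (intro ballI, rule north)
      show "\<forall>k\<in>{1 - int n..int n}. \<forall>l\<in>{1 - int n..int n}. k \<noteq> l \<longrightarrow> card (crossings n P k l) \<le> 1"
        by (intro ballI impI, rule le1)
      show "\<forall>k\<in>{1 - int n..0}. \<forall>l\<in>{1 - int n..int n}. k \<noteq> l \<longrightarrow> crossings n P k l = {}"
        by (intro ballI impI, rule none)
    qed (fact ext, fact exits)
  }
qed

lemma top_shape:
  assumes "\<And>r c. r < n \<Longrightarrow> c < 2 * n \<Longrightarrow> fits_reduced (T r c) (HL r c) (VL r c)"
  shows "shape n (map (VL n) [0..<2 * n]) = bpd_shape n P"
proof -
  have "VL n c \<noteq> None \<longleftrightarrow> north (P (1, 1 - int n + int c))" if c: "c < 2 * n" for c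
  proof -
    obtain m where m: "n = Suc m" using c by (cases n) auto
    then show ?thesis
      using fits_labels(3)[of "T m c" "HL m c" "VL m c"] assms[of m c] that
      by (simp add: fits_reduced_def m south_label_Suc square_def del: north.simps)
  qed
  then have "map (\<lambda>t. t \<noteq> None) (rev (map (VL n) [0..<2 * n])) =
      map (\<lambda>j. north (P (1, j))) (rev (map (\<lambda>c. 1 - int n + int c) [0..<2 * n]))"
    by (simp add: rev_map del: north.simps)
  then show ?thesis
    unfolding shape_def bpd_shape_def upto_eq_map_upt by (rule arg_cong)
qed

lemma bpd_weight_eq:
  "(\<Prod>(y, \<tau>)\<leftarrow>zip (map (\<lambda>r. (x_var (int n - int r), e r)) [0..<n]) (map (\<lambda>r. map (T r) [0..<2 * n]) [0..<n]).
      row_weight (fst y) (map (\<lambda>c. a_var (1 - int n + int c)) [0..<2 * n]) \<tau>) = bpd_weight n P"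
proof -
  let ?f = "\<lambda>s. tile_weight (x_var (fst s)) (a_var (snd s)) (P s)"
  have row: "row_weight (x_var (int n - int r)) (map (\<lambda>c. a_var (1 - int n + int c)) [0..<2 * n]) (map (T r) [0..<2 * n]) =
      (\<Prod>c\<in>{..<2 * n}. ?f (square n r c))" for r
    unfolding row_weight_def zip_map_map zip_same_conv_map
    by (simp add: comp_def square_def prod.distinct_set_conv_list[symmetric] lessThan_atLeast0)
  have "(\<Prod>(y, \<tau>)\<leftarrow>zip (map (\<lambda>r. (x_var (int n - int r), e r)) [0..<n]) (map (\<lambda>r. map (T r) [0..<2 * n]) [0..<n]).
      row_weight (fst y) (map (\<lambda>c. a_var (1 - int n + int c)) [0..<2 * n]) \<tau>) =
      (\<Prod>r\<in>{..<n}. \<Prod>c\<in>{..<2 * n}. ?f (square n r c))"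
    unfolding zip_map_map zip_same_conv_map
    by (simp add: comp_def row prod.distinct_set_conv_list[symmetric] lessThan_atLeast0)
  also have "\<dots> = (\<Prod>z\<in>{..<n} \<times> {..<2 * n}. ?f (case z of (r, c) \<Rightarrow> square n r c))"
    by (simp add: prod.cartesian_product case_prod_unfold)
  also have "\<dots> = (\<Prod>s\<in>rect n. ?f s)"
    by (rule prod.reindex_bij_betw[OF bij_betw_square])
  also have "\<dots> = bpd_weight n P"
    unfolding bpd_weight_def
    by (rule prod.mono_neutral_cong_right) (auto simp: tile_weight_def rect_def)
  finally show ?thesis .
qed

end

section \<open>Summation over tilings and passage to the limit\<close>

definition tiling_rows :: "nat \<Rightarrow> (int \<times> int \<Rightarrow> tile) \<Rightarrow> tile list list" where
  "tiling_rows n P = map (\<lambda>r. map (\<lambda>c. P (square n r c)) [0..<2 * n]) [0..<n]"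

lemma bij_betw_tiling_rows:
  "bij_betw (tiling_rows n) (rect n \<rightarrow>\<^sub>E UNIV)
     {T. length T = n \<and> set T \<subseteq> {\<tau>. length \<tau> = 2 * n \<and> set \<tau> \<subseteq> UNIV}}"
proof (rule bij_betw_imageI)
  show "inj_on (tiling_rows n) (rect n \<rightarrow>\<^sub>E UNIV)"
  proof (rule inj_onI)
    fix P Q :: "int \<times> int \<Rightarrow> tile"
    assume PQ: "P \<in> rect n \<rightarrow>\<^sub>E UNIV" "Q \<in> rect n \<rightarrow>\<^sub>E UNIV" "tiling_rows n P = tiling_rows n Q"
    show "P = Q"
    proof (rule PiE_ext[OF PQ(1,2)])
      fix s assume "s \<in> rect n"
      then obtain r c where rc: "r < n" "c < 2 * n" "s = square n r c"
        by (cases s) (auto elim: rectE)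
      then have "tiling_rows n P ! r ! c = P s" "tiling_rows n Q ! r ! c = Q s"
        by (simp_all add: tiling_rows_def)
      then show "P s = Q s"
        by (simp add: PQ(3))
    qed
  qed
  show "tiling_rows n ` (rect n \<rightarrow>\<^sub>E UNIV) = {T. length T = n \<and> set T \<subseteq> {\<tau>. length \<tau> = 2 * n \<and> set \<tau> \<subseteq> UNIV}}"
  proof (intro equalityI subsetI)
    fix T :: "tile list list"
    assume "T \<in> {T. length T = n \<and> set T \<subseteq> {\<tau>. length \<tau> = 2 * n \<and> set \<tau> \<subseteq> UNIV}}"
    then have T: "length T = n" "\<And>r. r < n \<Longrightarrow> length (T ! r) = 2 * n"
      by (auto dest: nth_mem)
    define P where "P = restrict (\<lambda>(i, j). T ! nat (int n - i) ! nat (j + int n - 1)) (rect n)"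
    have P: "P (square n r c) = T ! r ! c" if "r < n" "c < 2 * n" for r c
      using that square_rect[of n r c] by (simp add: P_def square_def)
    have "tiling_rows n P = T"
    proof (rule nth_equalityI)
      fix r assume "r < length (tiling_rows n P)"
      then have r: "r < n" by (simp add: tiling_rows_def)
      then show "tiling_rows n P ! r = T ! r"
        by (intro nth_equalityI) (auto simp: tiling_rows_def T P)
    qed (simp add: tiling_rows_def T)
    moreover have "P \<in> rect n \<rightarrow>\<^sub>E UNIV"
      by (simp add: P_def)
    ultimately show "T \<in> tiling_rows n ` (rect n \<rightarrow>\<^sub>E UNIV)"
      by blast
  qed (auto simp: tiling_rows_def)
qed

lemma finite_rect: "finite (rect n)"
  by (simp add: rect_def)

text \<open>A tiling is cut into its rows. The condition on the top labels is the part of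
  \<open>rect_bpd_iff\<close> that the rows themselves do not enforce.\<close>

lemma rows_transfer_eq_bpd_sum:
  assumes w: "w permutes {1..int n}"
  shows "rows_transfer (map a_var [1 - int n..int n]) (map (\<lambda>i. (x_var i, Some (w i))) (rev [1..int n]))
      (map Some [1 - int n..int n])
      (\<lambda>ts. if labels ts = [1 - int n..0] then S (shape n ts) else 0) =
    (\<Sum>P\<in>{P. rect_bpd n w P}. bpd_weight n P * S (bpd_shape n P))"
proof -
  let ?as = "map (\<lambda>c. a_var (1 - int n + int c)) [0..<2 * n]"
  let ?rs = "map (\<lambda>r. (x_var (int n - int r), Some (w (int n - int r)))) [0..<n]"
  let ?bs = "map (\<lambda>c. Some (1 - int n + int c)) [0..<2 * n]"
  let ?F = "\<lambda>ts. if labels ts = [1 - int n..0] then S (shape n ts) else 0"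
  let ?G = "\<lambda>T. if rows_fit T ?bs (map snd ?rs)
    then (\<Prod>(r, \<tau>)\<leftarrow>zip ?rs T. row_weight (fst r) ?as \<tau>) * ?F (rows_top T ?bs) else 0"
  have G: "?G (tiling_rows n P) = (if rect_bpd n w P then bpd_weight n P * S (bpd_shape n P) else 0)"
    if P: "P \<in> rect n \<rightarrow>\<^sub>E UNIV" for P
  proof -
    interpret rect_tiling n P .
    have bs: "?bs = map (VL 0) [0..<2 * n]" by simp
    have fit: "rows_fit (tiling_rows n P) ?bs (map snd ?rs) \<longleftrightarrow>
        (\<forall>r<n. (\<forall>c<2 * n. fits_reduced (T r c) (HL r c) (VL r c)) \<and> HL r (2 * n) = Some (w (int n - int r)))"
      unfolding bs tiling_rows_def
      using rows_fit_iff[of 0 n "\<lambda>r c. P (square n r c)" "2 * n" "\<lambda>c. Some (1 - int n + int c)"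
          "\<lambda>r. Some (w (int n - int r))"] by (simp add: comp_def atLeast0LessThan lessThan_iff Ball_def)
    have top: "rows_top (tiling_rows n P) ?bs = map (VL n) [0..<2 * n]"
      unfolding bs tiling_rows_def by (rule rows_top_eq) simp
    show ?thesis
      using rect_bpd_iff[OF w P] top_shape
        bpd_weight_eq[of "\<lambda>r. Some (w (int n - int r))"]
      unfolding fit top unfolding tiling_rows_def by auto
  qed
  have "rows_transfer ?as ?rs ?bs ?F =
      (\<Sum>T | length T = length ?rs \<and> set T \<subseteq> {\<tau>. length \<tau> = length ?as \<and> set \<tau> \<subseteq> UNIV}. ?G T)"
    by (rule rows_transfer_eq_sum) simp
  also have "\<dots> = (\<Sum>T | length T = n \<and> set T \<subseteq> {\<tau>. length \<tau> = 2 * n \<and> set \<tau> \<subseteq> UNIV}. ?G T)"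
    by simp
  also have "\<dots> = (\<Sum>P\<in>rect n \<rightarrow>\<^sub>E UNIV. ?G (tiling_rows n P))"
    by (rule sum.reindex_bij_betw[OF bij_betw_tiling_rows, symmetric])
  also have "\<dots> = (\<Sum>P\<in>{P. rect_bpd n w P}. bpd_weight n P * S (bpd_shape n P))"
  proof (rule sum.mono_neutral_cong_right)
    show "finite (rect n \<rightarrow>\<^sub>E (UNIV :: tile set))"
      by (rule finite_PiE[OF finite_rect]) (rule finite_UNIV_tile)
    show sub: "{P. rect_bpd n w P} \<subseteq> rect n \<rightarrow>\<^sub>E UNIV"
      unfolding rect_bpd_def by blast
    show "\<forall>P\<in>(rect n \<rightarrow>\<^sub>E UNIV) - {P. rect_bpd n w P}. ?G (tiling_rows n P) = 0"
      using G by simp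
    show "?G (tiling_rows n P) = bpd_weight n P * S (bpd_shape n P)" if "P \<in> {P. rect_bpd n w P}" for P
    proof -
      have "P \<in> rect n \<rightarrow>\<^sub>E UNIV" using sub that by blast
      from G[OF this] show ?thesis using that by (simp only: mem_Collect_eq if_True)
    qed
  qed
  finally show ?thesis
    by (simp add: upto_eq_map_upt rev_upto_eq_map_upt comp_def)
qed

lemma double_schubert_interval_eq_bpd_sum:
  assumes w: "w permutes {1..int n}" and p: "p \<le> 1 - int n" "p \<le> 0" and q: "int n \<le> q" "1 \<le> q"
  shows "double_schubert_interval p q w =
    (\<Sum>P\<in>{P. rect_bpd n w P}. bpd_weight n P * truncate p (double_schur (bpd_shape n P)))"
proof -
  have w_id: "w i = i" if "int n < i" for i
    using permutes_not_in[OF w, of i] that by simp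
  have "double_schubert_interval p q w = pipe_sum p q x_var a_var w"
    by (rule double_schubert_interval_eq) (use p q in \<open>auto intro: permutes_subset[OF w]\<close>)
  also have "\<dots> = pipe_sum p (int n) x_var a_var w"
    using pipe_sum_drop[of p "int n" w "nat (q - int n)" x_var a_var] p q w_id by simp
  also have "\<dots> = rows_transfer (map a_var [1 - int n..int n]) (map (\<lambda>i. (x_var i, Some (w i))) (rev [1..int n]))
      (map Some [1 - int n..int n])
      (\<lambda>ts. if labels ts = [1 - int n..0] then truncate p (double_schur (shape n ts)) else 0)"
    unfolding pipe_sum_cut[OF w p(1)]
    by (rule rows_transfer_cong) (use p top_rows_eq_truncate in auto)
  also have "\<dots> = (\<Sum>P\<in>{P. rect_bpd n w P}. bpd_weight n P * truncate p (double_schur (bpd_shape n P)))"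
    by (rule rows_transfer_eq_bpd_sum[OF w])
  finally show ?thesis .
qed

theorem theorem5p11:
  fixes n :: nat and w :: "int \<Rightarrow> int"
  assumes "w permutes {1..int n}"
  shows "back_stable_double_schubert w =
    (\<Sum>P\<in>{P. rect_bpd n w P}.
       ser_of (bpd_weight n P) * dsym_ser (double_schur (bpd_shape n P)))"
\<comment> \<open>The bounds 0 and 1 take effect for \<open>n = 0\<close>, where they keep the
  interval \<open>p..q\<close> nonempty.\<close>
proof (rule back_stable_eqI[of "min 0 (1 - int n)" "max 1 (int n)"])
  fix p q assume pq: "p \<le> min 0 (1 - int n)" "max 1 (int n) \<le> q"
  interpret s: comm_ring_hom "ser_of :: xa mpol \<Rightarrow> xa mser" by (rule ser_of_hom)
  have eq: "ser_of (double_schubert_interval p q w) =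
      (\<Sum>P\<in>{P. rect_bpd n w P}. ser_of (bpd_weight n P) * ser_of (truncate p (double_schur (bpd_shape n P))))"
    using double_schubert_interval_eq_bpd_sum[OF assms, of p q] pq by (simp add: s.hom_sum s.hom_mult)
  show "agree p (ser_of (double_schubert_interval p q w))
      (\<Sum>P\<in>{P. rect_bpd n w P}. ser_of (bpd_weight n P) * dsym_ser (double_schur (bpd_shape n P)))"
    unfolding eq
    by (intro agree_sum agree_mult agree_refl)
      (use agree_truncate in \<open>simp add: agree_def\<close>)
qed

end
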